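(* Let $\mathbb{P}$ be a prop, let $\mathcal{C}$ be a symmetric monoidal category, and let $s$ be a supply of $\mathbb{P}$ in $\mathcal{C}$. Then the collection of $s$-homomorphisms forms a monoidal subcategory $\mathcal{C}_s$ of $\mathcal{C}$ with $\mathcal{C}_0\subseteq\mathcal{C}_s\subseteq\mathcal{C}$, and the strong monoidal functor $\tilde{s}\colon\mathbb{P}\to\mathsf{SMF}(\mathcal{C}_0,\mathcal{C})$ corresponding to $s$ factors (through the restriction functor $\mathsf{SMF}(\mathcal{C}_s,\mathcal{C})\to\mathsf{SMF}(\mathcal{C}_0,\mathcal{C})$) through a strong monoidal functor $\mathbb{P}\to\mathsf{SMF}(\mathcal{C}_s,\mathcal{C})$ such that (i) each $m\in\mathbb{N}$ is sent to $\mathrm{inc}_s^{\otimes m}$, where $\mathrm{inc}_s\colon\mathcal{C}_s\to\mathcal{C}$ is the inclusion, and (ii) for each $m,n\in\mathbb{N}$ the strongator $\mathrm{inc}_s^{\otimes m}\otimes\mathrm{inc}_s^{\otimes n}\to\mathrm{inc}_s^{\otimes(m+n)}$ is the unique coherence map.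
   Context: Strong monoidal functors between symmetric monoidal categories are always understood to be symmetric; their structure isomorphisms are called strongators. In a symmetric monoidal category $(\mathcal{C},I,\otimes)$, write $b^{\otimes m}$ for the left-bracketed $m$-fold product $((b\otimes b)\otimes\cdots)\otimes b$, with $b^{\otimes 0}=I$ and $b^{\otimes 1}=b$. Write $\sigma\colon c^{\otimes n}\otimes d^{\otimes n}\to(c\otimes d)^{\otimes n}$ and $\sigma\colon I\to I^{\otimes n}$ for the canonical (Mac Lane coherence) isomorphisms, the first one realizing the evident shuffle permutation. A prop is a symmetric strict monoidal category whose monoid of objects is $(\mathbb{N},0,+)$. A supply $s$ of a prop $\mathbb{P}$ in $\mathcal{C}$ consists of a strong monoidal functor $s_c\colon\mathbb{P}\to\mathcal{C}$ for each object $c\in\mathcal{C}$ such that: (i) $s_c(m)=c^{\otimes m}$ for each $m\in\mathbb{N}$; (ii) the strongator $c^{\otimes m}\otimes c^{\otimes n}\to c^{\otimes(m+n)}$ is the unique coherence (rebracketing) isomorphism for each $m,n$; (iii) for all $c,d\in\mathcal{C}$ and $\mu\colon m\to n$ in $\mathbb{P}$, $s_{c\otimes d}(\mu)\circ\sigma=\sigma\circ(s_c(\mu)\otimes s_d(\mu))$ as maps $c^{\otimes m}\otimes d^{\otimes m}\to(c\otimes d)^{\otimes n}$, and $s_I(\mu)\circ\sigma=\sigma$ as maps $I\to I^{\otimes n}$. A morphism $f\colon c\to d$ in $\mathcal{C}$ is an $s$-homomorphism if $f^{\otimes n}\circ s_c(\mu)=s_d(\mu)\circ f^{\otimes m}$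 for every $\mu\colon m\to n$ in $\mathbb{P}$. $\mathsf{SMF}(\mathcal{A},\mathcal{B})$ is the symmetric monoidal category whose objects are strong monoidal functors $\mathcal{A}\to\mathcal{B}$ and whose morphisms are monoidal natural transformations, with pointwise symmetric monoidal structure: the unit is the constant functor at $I_{\mathcal{B}}$, $(F\otimes G)(a)=F(a)\otimes G(a)$, and the strongator of $F\otimes G$ is the symmetry isomorphism $(Fa\otimes Ga)\otimes(Fa'\otimes Ga')\cong(Fa\otimes Fa')\otimes(Ga\otimes Ga')$ followed by the tensor product of the strongators of $F$ and $G$. $\mathcal{C}_0\subseteq\mathcal{C}$ is the smallest monoidal subcategory containing all objects of $\mathcal{C}$ and all coherence isomorphisms (unitors, associators, braidings and their inverses); $\mathrm{inc}\colon\mathcal{C}_0\to\mathcal{C}$ is the inclusion. A supply $s$ corresponds to the strong monoidal functor $\tilde{s}\colon\mathbb{P}\to\mathsf{SMF}(\mathcal{C}_0,\mathcal{C})$ with $\tilde{s}(m)=\mathrm{inc}^{\otimes m}$, $\tilde{s}(\mu)_c=s_c(\mu)$, and strongators the coherence (rebracketing) maps. *)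

theory Defs
  imports Main "HOL-Library.FuncSet"
begin

section \<open>Symmetric monoidal categories\<close>

text \<open>
  Composition is written in applicative order: \<open>g \<cdot> f\<close> is \<open>f\<close> followed by \<open>g\<close>.  All operations are
  total functions; only their values on the carriers \<open>Obj\<close>, \<open>Arr\<close> matter.
\<close>

record ('o, 'a) smcat =
  Obj :: "'o set"
  Arr :: "'a set"
  Dom :: "'a \<Rightarrow> 'o"
  Cod :: "'a \<Rightarrow> 'o"
  Ident :: "'o \<Rightarrow> 'a"
  Comp :: "'a \<Rightarrow> 'a \<Rightarrow> 'a"  (infixr \<open>\<cdot>\<index>\<close> 60)
  Unit :: "'o"  (\<open>\<one>\<index>\<close>)
  TenO :: "'o \<Rightarrow> 'o \<Rightarrow> 'o"  (infixl \<open>\<otimes>\<index>\<close> 70)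
  TenA :: "'a \<Rightarrow> 'a \<Rightarrow> 'a"  (infixl \<open>\<boxtimes>\<index>\<close> 70)
  Assoc :: "'o \<Rightarrow> 'o \<Rightarrow> 'o \<Rightarrow> 'a"
  LUnit :: "'o \<Rightarrow> 'a"
  RUnit :: "'o \<Rightarrow> 'a"
  Braid :: "'o \<Rightarrow> 'o \<Rightarrow> 'a"

definition Hom :: "('o, 'a) smcat \<Rightarrow> 'o \<Rightarrow> 'o \<Rightarrow> 'a set" where
  "Hom C a b = {f \<in> Arr C. Dom C f = a \<and> Cod C f = b}"

definition inverse_arrows :: "('o, 'a) smcat \<Rightarrow> 'a \<Rightarrow> 'a \<Rightarrow> bool" where
  "inverse_arrows C f g \<longleftrightarrow>
     f \<in> Arr C \<and> g \<in> Hom C (Cod C f) (Dom C f) \<and>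
     g \<cdot>\<^bsub>C\<^esub> f = Ident C (Dom C f) \<and> f \<cdot>\<^bsub>C\<^esub> g = Ident C (Cod C f)"

definition is_iso :: "('o, 'a) smcat \<Rightarrow> 'a \<Rightarrow> bool" where
  "is_iso C f \<longleftrightarrow> (\<exists>g. inverse_arrows C f g)"

definition Inv :: "('o, 'a) smcat \<Rightarrow> 'a \<Rightarrow> 'a" where
  "Inv C f = (THE g. inverse_arrows C f g)"

locale category =
  fixes C :: "('o, 'a) smcat" (structure)
  assumes Dom_Obj: "f \<in> Arr C \<Longrightarrow> Dom C f \<in> Obj C"
    and Cod_Obj: "f \<in> Arr C \<Longrightarrow> Cod C f \<in> Obj C"
    and Ident_Hom: "a \<in> Obj C \<Longrightarrow> Ident C a \<in> Hom C a a"
    and Comp_Hom: "\<lbrakk>f \<in> Hom C a b; g \<in> Hom C b c\<rbrakk> \<Longrightarrow> g \<cdot> f \<in> Hom C a c"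
    and Comp_Ident_right: "f \<in> Hom C a b \<Longrightarrow> f \<cdot> Ident C a = f"
    and Comp_Ident_left: "f \<in> Hom C a b \<Longrightarrow> Ident C b \<cdot> f = f"
    and Comp_assoc:
      "\<lbrakk>f \<in> Hom C a b; g \<in> Hom C b c; h \<in> Hom C c d\<rbrakk> \<Longrightarrow> (h \<cdot> g) \<cdot> f = h \<cdot> (g \<cdot> f)"

locale symmetric_monoidal_category = category +
  assumes Unit_Obj: "\<one> \<in> Obj C"
    and TenO_Obj: "\<lbrakk>a \<in> Obj C; b \<in> Obj C\<rbrakk> \<Longrightarrow> a \<otimes> b \<in> Obj C"
    and TenA_Hom:
      "\<lbrakk>f \<in> Hom C a b; g \<in> Hom C c d\<rbrakk> \<Longrightarrow> f \<boxtimes> g \<in> Hom C (a \<otimes> c) (b \<otimes> d)"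
    and TenA_Ident:
      "\<lbrakk>a \<in> Obj C; b \<in> Obj C\<rbrakk> \<Longrightarrow> Ident C a \<boxtimes> Ident C b = Ident C (a \<otimes> b)"
    and TenA_Comp:
      "\<lbrakk>f \<in> Hom C a b; g \<in> Hom C b c; f' \<in> Hom C a' b'; g' \<in> Hom C b' c'\<rbrakk>
        \<Longrightarrow> (g \<cdot> f) \<boxtimes> (g' \<cdot> f') = (g \<boxtimes> g') \<cdot> (f \<boxtimes> f')"
    and Assoc_Hom:
      "\<lbrakk>a \<in> Obj C; b \<in> Obj C; c \<in> Obj C\<rbrakk>
        \<Longrightarrow> Assoc C a b c \<in> Hom C ((a \<otimes> b) \<otimes> c) (a \<otimes> (b \<otimes> c))"
    and Assoc_iso:
      "\<lbrakk>a \<in> Obj C; b \<in> Obj C; c \<in> Obj C\<rbrakk> \<Longrightarrow> is_iso C (Assoc C a b c)"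
    and Assoc_natural:
      "\<lbrakk>f \<in> Hom C a a'; g \<in> Hom C b b'; h \<in> Hom C c c'\<rbrakk>
        \<Longrightarrow> Assoc C a' b' c' \<cdot> ((f \<boxtimes> g) \<boxtimes> h) = (f \<boxtimes> (g \<boxtimes> h)) \<cdot> Assoc C a b c"
    and LUnit_Hom: "a \<in> Obj C \<Longrightarrow> LUnit C a \<in> Hom C (\<one> \<otimes> a) a"
    and LUnit_iso: "a \<in> Obj C \<Longrightarrow> is_iso C (LUnit C a)"
    and LUnit_natural:
      "f \<in> Hom C a b \<Longrightarrow> LUnit C b \<cdot> (Ident C \<one> \<boxtimes> f) = f \<cdot> LUnit C a"
    and RUnit_Hom: "a \<in> Obj C \<Longrightarrow> RUnit C a \<in> Hom C (a \<otimes> \<one>) a"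
    and RUnit_iso: "a \<in> Obj C \<Longrightarrow> is_iso C (RUnit C a)"
    and RUnit_natural:
      "f \<in> Hom C a b \<Longrightarrow> RUnit C b \<cdot> (f \<boxtimes> Ident C \<one>) = f \<cdot> RUnit C a"
    and pentagon:
      "\<lbrakk>a \<in> Obj C; b \<in> Obj C; c \<in> Obj C; d \<in> Obj C\<rbrakk>
        \<Longrightarrow> (Ident C a \<boxtimes> Assoc C b c d) \<cdot> Assoc C a (b \<otimes> c) d \<cdot> (Assoc C a b c \<boxtimes> Ident C d)
            = Assoc C a b (c \<otimes> d) \<cdot> Assoc C (a \<otimes> b) c d"
    and triangle:
      "\<lbrakk>a \<in> Obj C; b \<in> Obj C\<rbrakk>
        \<Longrightarrow> (Ident C a \<boxtimes> LUnit C b) \<cdot> Assoc C a \<one> b = RUnit C a \<boxtimes> Ident C b"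
    and Braid_Hom:
      "\<lbrakk>a \<in> Obj C; b \<in> Obj C\<rbrakk> \<Longrightarrow> Braid C a b \<in> Hom C (a \<otimes> b) (b \<otimes> a)"
    and Braid_natural:
      "\<lbrakk>f \<in> Hom C a a'; g \<in> Hom C b b'\<rbrakk>
        \<Longrightarrow> Braid C a' b' \<cdot> (f \<boxtimes> g) = (g \<boxtimes> f) \<cdot> Braid C a b"
    and Braid_Braid:
      "\<lbrakk>a \<in> Obj C; b \<in> Obj C\<rbrakk> \<Longrightarrow> Braid C b a \<cdot> Braid C a b = Ident C (a \<otimes> b)"
    and hexagon:
      "\<lbrakk>a \<in> Obj C; b \<in> Obj C; c \<in> Obj C\<rbrakk>
        \<Longrightarrow> Assoc C b c a \<cdot> Braid C a (b \<otimes> c) \<cdot> Assoc C a b c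
            = (Ident C b \<boxtimes> Braid C a c) \<cdot> Assoc C b a c \<cdot> (Braid C a b \<boxtimes> Ident C c)"

definition is_prop :: "(nat, 'p) smcat \<Rightarrow> bool" where
  "is_prop P \<longleftrightarrow>
     symmetric_monoidal_category P \<and>
     Obj P = UNIV \<and> \<one>\<^bsub>P\<^esub> = 0 \<and> (\<forall>m n. m \<otimes>\<^bsub>P\<^esub> n = m + n) \<and>
     (\<forall>l m n. Assoc P l m n = Ident P (l + m + n)) \<and>
     (\<forall>m. LUnit P m = Ident P m) \<and> (\<forall>m. RUnit P m = Ident P m)"


section \<open>Strong monoidal functors and monoidal natural transformations\<close>

text \<open>
  \<open>fmul F (a, b) : F a \<otimes> F b \<rightarrow> F (a \<otimes> b)\<close> and \<open>funi F : \<one> \<rightarrow> F \<one>\<close> are the strongators.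
\<close>

record ('o, 'a, 'p, 'b) smfun =
  fob :: "'o \<Rightarrow> 'p"
  far :: "'a \<Rightarrow> 'b"
  fmul :: "'o \<times> 'o \<Rightarrow> 'b"
  funi :: "'b"

definition strong_monoidal_functor ::
    "('o, 'a) smcat \<Rightarrow> ('p, 'b) smcat \<Rightarrow> ('o, 'a, 'p, 'b) smfun \<Rightarrow> bool" where
  "strong_monoidal_functor A B F \<longleftrightarrow>
     (\<forall>a \<in> Obj A. fob F a \<in> Obj B) \<and>
     (\<forall>a b. \<forall>f \<in> Hom A a b. far F f \<in> Hom B (fob F a) (fob F b)) \<and>
     (\<forall>a \<in> Obj A. far F (Ident A a) = Ident B (fob F a)) \<and>
     (\<forall>a b c. \<forall>f \<in> Hom A a b. \<forall>g \<in> Hom A b c. far F (g \<cdot>\<^bsub>A\<^esub> f) = far F g \<cdot>\<^bsub>B\<^esub> far F f) \<and>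
     (\<forall>a \<in> Obj A. \<forall>b \<in> Obj A.
        fmul F (a, b) \<in> Hom B (fob F a \<otimes>\<^bsub>B\<^esub> fob F b) (fob F (a \<otimes>\<^bsub>A\<^esub> b)) \<and>
        is_iso B (fmul F (a, b))) \<and>
     funi F \<in> Hom B \<one>\<^bsub>B\<^esub> (fob F \<one>\<^bsub>A\<^esub>) \<and> is_iso B (funi F) \<and>
     (\<forall>a a' b b'. \<forall>f \<in> Hom A a a'. \<forall>g \<in> Hom A b b'.
        fmul F (a', b') \<cdot>\<^bsub>B\<^esub> (far F f \<boxtimes>\<^bsub>B\<^esub> far F g) = far F (f \<boxtimes>\<^bsub>A\<^esub> g) \<cdot>\<^bsub>B\<^esub> fmul F (a, b)) \<and>
     (\<forall>a \<in> Obj A. \<forall>b \<in> Obj A. \<forall>c \<in> Obj A.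
        far F (Assoc A a b c) \<cdot>\<^bsub>B\<^esub> fmul F (a \<otimes>\<^bsub>A\<^esub> b, c)
          \<cdot>\<^bsub>B\<^esub> (fmul F (a, b) \<boxtimes>\<^bsub>B\<^esub> Ident B (fob F c))
        = fmul F (a, b \<otimes>\<^bsub>A\<^esub> c) \<cdot>\<^bsub>B\<^esub> (Ident B (fob F a) \<boxtimes>\<^bsub>B\<^esub> fmul F (b, c))
          \<cdot>\<^bsub>B\<^esub> Assoc B (fob F a) (fob F b) (fob F c)) \<and>
     (\<forall>a \<in> Obj A.
        far F (LUnit A a) \<cdot>\<^bsub>B\<^esub> fmul F (\<one>\<^bsub>A\<^esub>, a) \<cdot>\<^bsub>B\<^esub> (funi F \<boxtimes>\<^bsub>B\<^esub> Ident B (fob F a))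
        = LUnit B (fob F a)) \<and>
     (\<forall>a \<in> Obj A.
        far F (RUnit A a) \<cdot>\<^bsub>B\<^esub> fmul F (a, \<one>\<^bsub>A\<^esub>) \<cdot>\<^bsub>B\<^esub> (Ident B (fob F a) \<boxtimes>\<^bsub>B\<^esub> funi F)
        = RUnit B (fob F a)) \<and>
     (\<forall>a \<in> Obj A. \<forall>b \<in> Obj A.
        far F (Braid A a b) \<cdot>\<^bsub>B\<^esub> fmul F (a, b)
        = fmul F (b, a) \<cdot>\<^bsub>B\<^esub> Braid B (fob F a) (fob F b))"

text \<open>
  Among all representations of a functor by total functions, this picks the one that is
  \<^const>\<open>undefined\<close> off the carriers, so that equality of records is equality of functors.
\<close>

definition normalized :: "('o, 'a) smcat \<Rightarrow> ('o, 'a, 'p, 'b) smfun \<Rightarrow> bool" where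
  "normalized A F \<longleftrightarrow>
     fob F \<in> extensional (Obj A) \<and> far F \<in> extensional (Arr A) \<and>
     fmul F \<in> extensional (Obj A \<times> Obj A)"

definition compose_functors ::
    "('o, 'a) smcat \<Rightarrow> ('q, 'c) smcat \<Rightarrow> ('p, 'b, 'q, 'c) smfun \<Rightarrow> ('o, 'a, 'p, 'b) smfun
      \<Rightarrow> ('o, 'a, 'q, 'c) smfun" where
  "compose_functors A D G F =
     \<lparr> fob = (\<lambda>a\<in>Obj A. fob G (fob F a)),
       far = (\<lambda>f\<in>Arr A. far G (far F f)),
       fmul = (\<lambda>(a, b)\<in>Obj A \<times> Obj A. far G (fmul F (a, b)) \<cdot>\<^bsub>D\<^esub> fmul G (fob F a, fob F b)),
       funi = far G (funi F) \<cdot>\<^bsub>D\<^esub> funi G \<rparr>"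

record ('o, 'a, 'p, 'b) mnt =
  nsrc :: "('o, 'a, 'p, 'b) smfun"
  ntgt :: "('o, 'a, 'p, 'b) smfun"
  ncmp :: "'o \<Rightarrow> 'b"

definition monoidal_natural ::
    "('o, 'a) smcat \<Rightarrow> ('p, 'b) smcat \<Rightarrow> ('o, 'a, 'p, 'b) mnt \<Rightarrow> bool" where
  "monoidal_natural A B t \<longleftrightarrow>
     ncmp t \<in> extensional (Obj A) \<and>
     (\<forall>a \<in> Obj A. ncmp t a \<in> Hom B (fob (nsrc t) a) (fob (ntgt t) a)) \<and>
     (\<forall>a b. \<forall>f \<in> Hom A a b. ncmp t b \<cdot>\<^bsub>B\<^esub> far (nsrc t) f = far (ntgt t) f \<cdot>\<^bsub>B\<^esub> ncmp t a) \<and>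
     (\<forall>a \<in> Obj A. \<forall>b \<in> Obj A.
        ncmp t (a \<otimes>\<^bsub>A\<^esub> b) \<cdot>\<^bsub>B\<^esub> fmul (nsrc t) (a, b)
        = fmul (ntgt t) (a, b) \<cdot>\<^bsub>B\<^esub> (ncmp t a \<boxtimes>\<^bsub>B\<^esub> ncmp t b)) \<and>
     ncmp t \<one>\<^bsub>A\<^esub> \<cdot>\<^bsub>B\<^esub> funi (nsrc t) = funi (ntgt t)"


section \<open>The symmetric monoidal category of strong monoidal functors\<close>

text \<open>The symmetry isomorphism \<open>(a \<otimes> b) \<otimes> (c \<otimes> d) \<rightarrow> (a \<otimes> c) \<otimes> (b \<otimes> d)\<close>.\<close>

definition interchange :: "('o, 'a) smcat \<Rightarrow> 'o \<Rightarrow> 'o \<Rightarrow> 'o \<Rightarrow> 'o \<Rightarrow> 'a" where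
  "interchange C a b c d =
     Inv C (Assoc C a c (b \<otimes>\<^bsub>C\<^esub> d))
     \<cdot>\<^bsub>C\<^esub> (Ident C a \<boxtimes>\<^bsub>C\<^esub> Assoc C c b d)
     \<cdot>\<^bsub>C\<^esub> (Ident C a \<boxtimes>\<^bsub>C\<^esub> (Braid C b c \<boxtimes>\<^bsub>C\<^esub> Ident C d))
     \<cdot>\<^bsub>C\<^esub> (Ident C a \<boxtimes>\<^bsub>C\<^esub> Inv C (Assoc C b c d))
     \<cdot>\<^bsub>C\<^esub> Assoc C a b (c \<otimes>\<^bsub>C\<^esub> d)"

definition unit_functor ::
    "('o, 'a) smcat \<Rightarrow> ('p, 'b) smcat \<Rightarrow> ('o, 'a, 'p, 'b) smfun" where
  "unit_functor A B =
     \<lparr> fob = (\<lambda>a\<in>Obj A. \<one>\<^bsub>B\<^esub>),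
       far = (\<lambda>f\<in>Arr A. Ident B \<one>\<^bsub>B\<^esub>),
       fmul = (\<lambda>(a, b)\<in>Obj A \<times> Obj A. LUnit B \<one>\<^bsub>B\<^esub>),
       funi = Ident B \<one>\<^bsub>B\<^esub> \<rparr>"

definition tensor_functors ::
    "('o, 'a) smcat \<Rightarrow> ('p, 'b) smcat \<Rightarrow> ('o, 'a, 'p, 'b) smfun \<Rightarrow> ('o, 'a, 'p, 'b) smfun
      \<Rightarrow> ('o, 'a, 'p, 'b) smfun" where
  "tensor_functors A B F G =
     \<lparr> fob = (\<lambda>a\<in>Obj A. fob F a \<otimes>\<^bsub>B\<^esub> fob G a),
       far = (\<lambda>f\<in>Arr A. far F f \<boxtimes>\<^bsub>B\<^esub> far G f),
       fmul = (\<lambda>(a, b)\<in>Obj A \<times> Obj A.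
                 (fmul F (a, b) \<boxtimes>\<^bsub>B\<^esub> fmul G (a, b))
                 \<cdot>\<^bsub>B\<^esub> interchange B (fob F a) (fob G a) (fob F b) (fob G b)),
       funi = (funi F \<boxtimes>\<^bsub>B\<^esub> funi G) \<cdot>\<^bsub>B\<^esub> Inv B (LUnit B \<one>\<^bsub>B\<^esub>) \<rparr>"

definition SMF ::
    "('o, 'a) smcat \<Rightarrow> ('p, 'b) smcat
      \<Rightarrow> (('o, 'a, 'p, 'b) smfun, ('o, 'a, 'p, 'b) mnt) smcat" where
  "SMF A B =
     \<lparr> Obj = {F. strong_monoidal_functor A B F \<and> normalized A F},
       Arr = {t. strong_monoidal_functor A B (nsrc t) \<and> normalized A (nsrc t) \<and>
                 strong_monoidal_functor A B (ntgt t) \<and> normalized A (ntgt t) \<and>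
                 monoidal_natural A B t},
       Dom = nsrc,
       Cod = ntgt,
       Ident = (\<lambda>F. \<lparr> nsrc = F, ntgt = F, ncmp = (\<lambda>a\<in>Obj A. Ident B (fob F a)) \<rparr>),
       Comp = (\<lambda>u t. \<lparr> nsrc = nsrc t, ntgt = ntgt u,
                       ncmp = (\<lambda>a\<in>Obj A. ncmp u a \<cdot>\<^bsub>B\<^esub> ncmp t a) \<rparr>),
       Unit = unit_functor A B,
       TenO = tensor_functors A B,
       TenA = (\<lambda>t u. \<lparr> nsrc = tensor_functors A B (nsrc t) (nsrc u),
                       ntgt = tensor_functors A B (ntgt t) (ntgt u),
                       ncmp = (\<lambda>a\<in>Obj A. ncmp t a \<boxtimes>\<^bsub>B\<^esub> ncmp u a) \<rparr>),
       Assoc = (\<lambda>F G H.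
                  \<lparr> nsrc = tensor_functors A B (tensor_functors A B F G) H,
                    ntgt = tensor_functors A B F (tensor_functors A B G H),
                    ncmp = (\<lambda>a\<in>Obj A. Assoc B (fob F a) (fob G a) (fob H a)) \<rparr>),
       LUnit = (\<lambda>F. \<lparr> nsrc = tensor_functors A B (unit_functor A B) F, ntgt = F,
                      ncmp = (\<lambda>a\<in>Obj A. LUnit B (fob F a)) \<rparr>),
       RUnit = (\<lambda>F. \<lparr> nsrc = tensor_functors A B F (unit_functor A B), ntgt = F,
                      ncmp = (\<lambda>a\<in>Obj A. RUnit B (fob F a)) \<rparr>),
       Braid = (\<lambda>F G. \<lparr> nsrc = tensor_functors A B F G, ntgt = tensor_functors A B G F,
                        ncmp = (\<lambda>a\<in>Obj A. Braid B (fob F a) (fob G a)) \<rparr>) \<rparr>"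

text \<open>Precomposition with the inclusion \<open>S0 \<subseteq> S\<close>; it is strictly monoidal.\<close>

definition restrict_functor ::
    "('o, 'a) smcat \<Rightarrow> ('o, 'a, 'p, 'b) smfun \<Rightarrow> ('o, 'a, 'p, 'b) smfun" where
  "restrict_functor S0 F =
     \<lparr> fob = restrict (fob F) (Obj S0),
       far = restrict (far F) (Arr S0),
       fmul = restrict (fmul F) (Obj S0 \<times> Obj S0),
       funi = funi F \<rparr>"

definition restriction ::
    "('o, 'a) smcat \<Rightarrow> ('o, 'a) smcat \<Rightarrow> ('p, 'b) smcat
      \<Rightarrow> (('o, 'a, 'p, 'b) smfun, ('o, 'a, 'p, 'b) mnt,
          ('o, 'a, 'p, 'b) smfun, ('o, 'a, 'p, 'b) mnt) smfun" where
  "restriction S S0 B =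
     \<lparr> fob = (\<lambda>F\<in>Obj (SMF S B). restrict_functor S0 F),
       far = (\<lambda>t\<in>Arr (SMF S B).
                \<lparr> nsrc = restrict_functor S0 (nsrc t), ntgt = restrict_functor S0 (ntgt t),
                  ncmp = restrict (ncmp t) (Obj S0) \<rparr>),
       fmul = (\<lambda>(F, G)\<in>Obj (SMF S B) \<times> Obj (SMF S B).
                 Ident (SMF S0 B) (restrict_functor S0 (F \<otimes>\<^bsub>SMF S B\<^esub> G))),
       funi = Ident (SMF S0 B) (restrict_functor S0 \<one>\<^bsub>SMF S B\<^esub>) \<rparr>"


section \<open>Tensor powers and canonical coherence isomorphisms\<close>

fun TPow :: "('o, 'a) smcat \<Rightarrow> 'o \<Rightarrow> nat \<Rightarrow> 'o" where
  "TPow C b 0 = \<one>\<^bsub>C\<^esub>"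
| "TPow C b (Suc 0) = b"
| "TPow C b (Suc (Suc n)) = TPow C b (Suc n) \<otimes>\<^bsub>C\<^esub> b"

fun TPowA :: "('o, 'a) smcat \<Rightarrow> 'a \<Rightarrow> nat \<Rightarrow> 'a" where
  "TPowA C f 0 = Ident C \<one>\<^bsub>C\<^esub>"
| "TPowA C f (Suc 0) = f"
| "TPowA C f (Suc (Suc n)) = TPowA C f (Suc n) \<boxtimes>\<^bsub>C\<^esub> f"

text \<open>
  By Mac Lane's coherence theorem there is exactly one map built from associators and unitors
  between two bracketings of the same word, and exactly one map built from associators, unitors
  and braidings that realizes a given permutation; the following recursions name these maps.

  \<open>rebracket C b m n : b\<^sup>m \<otimes> b\<^sup>n \<rightarrow> b\<^sup>m\<^sup>+\<^sup>n\<close>.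
\<close>

fun rebracket :: "('o, 'a) smcat \<Rightarrow> 'o \<Rightarrow> nat \<Rightarrow> nat \<Rightarrow> 'a" where
  "rebracket C b 0 n = LUnit C (TPow C b n)"
| "rebracket C b (Suc m) 0 = RUnit C (TPow C b (Suc m))"
| "rebracket C b (Suc m) (Suc 0) = Ident C (TPow C b (Suc (Suc m)))"
| "rebracket C b (Suc m) (Suc (Suc n)) =
     (rebracket C b (Suc m) (Suc n) \<boxtimes>\<^bsub>C\<^esub> Ident C b)
     \<cdot>\<^bsub>C\<^esub> Inv C (Assoc C (TPow C b (Suc m)) (TPow C b (Suc n)) b)"

text \<open>\<open>shuffle C c d n : c\<^sup>n \<otimes> d\<^sup>n \<rightarrow> (c \<otimes> d)\<^sup>n\<close>, pairing the \<open>i\<close>-th \<open>c\<close> with the \<open>i\<close>-th \<open>d\<close>.\<close>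

fun shuffle :: "('o, 'a) smcat \<Rightarrow> 'o \<Rightarrow> 'o \<Rightarrow> nat \<Rightarrow> 'a" where
  "shuffle C c d 0 = LUnit C \<one>\<^bsub>C\<^esub>"
| "shuffle C c d (Suc 0) = Ident C (c \<otimes>\<^bsub>C\<^esub> d)"
| "shuffle C c d (Suc (Suc n)) =
     (shuffle C c d (Suc n) \<boxtimes>\<^bsub>C\<^esub> Ident C (c \<otimes>\<^bsub>C\<^esub> d))
     \<cdot>\<^bsub>C\<^esub> interchange C (TPow C c (Suc n)) c (TPow C d (Suc n)) d"

text \<open>\<open>unit_shuffle C n : \<one> \<rightarrow> \<one>\<^sup>n\<close>.\<close>

fun unit_shuffle :: "('o, 'a) smcat \<Rightarrow> nat \<Rightarrow> 'a" where
  "unit_shuffle C 0 = Ident C \<one>\<^bsub>C\<^esub>"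
| "unit_shuffle C (Suc 0) = Ident C \<one>\<^bsub>C\<^esub>"
| "unit_shuffle C (Suc (Suc n)) =
     (unit_shuffle C (Suc n) \<boxtimes>\<^bsub>C\<^esub> Ident C \<one>\<^bsub>C\<^esub>) \<cdot>\<^bsub>C\<^esub> Inv C (LUnit C \<one>\<^bsub>C\<^esub>)"


section \<open>Monoidal subcategories\<close>

text \<open>A subcategory is its ambient category with the two carriers shrunk.\<close>

definition subcat :: "('o, 'a) smcat \<Rightarrow> 'o set \<Rightarrow> 'a set \<Rightarrow> ('o, 'a) smcat" where
  "subcat C X M = C\<lparr>Obj := X, Arr := M\<rparr>"

definition monoidal_subcategory :: "('o, 'a) smcat \<Rightarrow> ('o, 'a) smcat \<Rightarrow> bool" where
  "monoidal_subcategory S C \<longleftrightarrow>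
     S = subcat C (Obj S) (Arr S) \<and> Obj S \<subseteq> Obj C \<and> Arr S \<subseteq> Arr C \<and>
     (\<forall>f \<in> Arr S. Dom C f \<in> Obj S \<and> Cod C f \<in> Obj S) \<and>
     (\<forall>a \<in> Obj S. Ident C a \<in> Arr S) \<and>
     (\<forall>f \<in> Arr S. \<forall>g \<in> Arr S. Dom C g = Cod C f \<longrightarrow> g \<cdot>\<^bsub>C\<^esub> f \<in> Arr S) \<and>
     \<one>\<^bsub>C\<^esub> \<in> Obj S \<and>
     (\<forall>a \<in> Obj S. \<forall>b \<in> Obj S. a \<otimes>\<^bsub>C\<^esub> b \<in> Obj S) \<and>
     (\<forall>f \<in> Arr S. \<forall>g \<in> Arr S. f \<boxtimes>\<^bsub>C\<^esub> g \<in> Arr S) \<and>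
     (\<forall>a \<in> Obj S. \<forall>b \<in> Obj S. \<forall>c \<in> Obj S.
        Assoc C a b c \<in> Arr S \<and> Inv C (Assoc C a b c) \<in> Arr S) \<and>
     (\<forall>a \<in> Obj S. LUnit C a \<in> Arr S \<and> Inv C (LUnit C a) \<in> Arr S) \<and>
     (\<forall>a \<in> Obj S. RUnit C a \<in> Arr S \<and> Inv C (RUnit C a) \<in> Arr S)"

text \<open>
  The smallest monoidal subcategory containing all objects, unitors, associators, braidings and
  their inverses.
\<close>

inductive_set coherence_arrows :: "('o, 'a) smcat \<Rightarrow> 'a set" for C :: "('o, 'a) smcat" where
  coh_Ident: "a \<in> Obj C \<Longrightarrow> Ident C a \<in> coherence_arrows C"
| coh_Assoc: "\<lbrakk>a \<in> Obj C; b \<in> Obj C; c \<in> Obj C\<rbrakk> \<Longrightarrow> Assoc C a b c \<in> coherence_arrows C"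
| coh_Inv_Assoc:
    "\<lbrakk>a \<in> Obj C; b \<in> Obj C; c \<in> Obj C\<rbrakk> \<Longrightarrow> Inv C (Assoc C a b c) \<in> coherence_arrows C"
| coh_LUnit: "a \<in> Obj C \<Longrightarrow> LUnit C a \<in> coherence_arrows C"
| coh_Inv_LUnit: "a \<in> Obj C \<Longrightarrow> Inv C (LUnit C a) \<in> coherence_arrows C"
| coh_RUnit: "a \<in> Obj C \<Longrightarrow> RUnit C a \<in> coherence_arrows C"
| coh_Inv_RUnit: "a \<in> Obj C \<Longrightarrow> Inv C (RUnit C a) \<in> coherence_arrows C"
| coh_Braid: "\<lbrakk>a \<in> Obj C; b \<in> Obj C\<rbrakk> \<Longrightarrow> Braid C a b \<in> coherence_arrows C"
| coh_Inv_Braid: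
    "\<lbrakk>a \<in> Obj C; b \<in> Obj C\<rbrakk> \<Longrightarrow> Inv C (Braid C a b) \<in> coherence_arrows C"
| coh_Comp:
    "\<lbrakk>f \<in> coherence_arrows C; g \<in> coherence_arrows C; Dom C g = Cod C f\<rbrakk>
      \<Longrightarrow> g \<cdot>\<^bsub>C\<^esub> f \<in> coherence_arrows C"
| coh_TenA:
    "\<lbrakk>f \<in> coherence_arrows C; g \<in> coherence_arrows C\<rbrakk>
      \<Longrightarrow> f \<boxtimes>\<^bsub>C\<^esub> g \<in> coherence_arrows C"

definition coherence_subcat :: "('o, 'a) smcat \<Rightarrow> ('o, 'a) smcat" where
  "coherence_subcat C = subcat C (Obj C) (coherence_arrows C)"

definition inclusion :: "('o, 'a) smcat \<Rightarrow> ('o, 'a) smcat \<Rightarrow> ('o, 'a, 'o, 'a) smfun" where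
  "inclusion S C =
     \<lparr> fob = (\<lambda>a\<in>Obj S. a),
       far = (\<lambda>f\<in>Arr S. f),
       fmul = (\<lambda>(a, b)\<in>Obj S \<times> Obj S. Ident C (a \<otimes>\<^bsub>C\<^esub> b)),
       funi = Ident C \<one>\<^bsub>C\<^esub> \<rparr>"


section \<open>Supplies and their homomorphisms\<close>

definition is_supply ::
    "(nat, 'p) smcat \<Rightarrow> ('o, 'a) smcat \<Rightarrow> ('o \<Rightarrow> (nat, 'p, 'o, 'a) smfun) \<Rightarrow> bool" where
  "is_supply P C s \<longleftrightarrow>
     (\<forall>c \<in> Obj C.
        strong_monoidal_functor P C (s c) \<and>
        (\<forall>m. fob (s c) m = TPow C c m) \<and>
        (\<forall>m n. fmul (s c) (m, n) = rebracket C c m n)) \<and>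
     (\<forall>c \<in> Obj C. \<forall>d \<in> Obj C. \<forall>m n. \<forall>\<mu> \<in> Hom P m n.
        far (s (c \<otimes>\<^bsub>C\<^esub> d)) \<mu> \<cdot>\<^bsub>C\<^esub> shuffle C c d m
        = shuffle C c d n \<cdot>\<^bsub>C\<^esub> (far (s c) \<mu> \<boxtimes>\<^bsub>C\<^esub> far (s d) \<mu>)) \<and>
     (\<forall>m n. \<forall>\<mu> \<in> Hom P m n.
        far (s \<one>\<^bsub>C\<^esub>) \<mu> \<cdot>\<^bsub>C\<^esub> unit_shuffle C m = unit_shuffle C n)"

definition s_homomorphism ::
    "(nat, 'p) smcat \<Rightarrow> ('o, 'a) smcat \<Rightarrow> ('o \<Rightarrow> (nat, 'p, 'o, 'a) smfun) \<Rightarrow> 'a \<Rightarrow> bool" where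
  "s_homomorphism P C s f \<longleftrightarrow>
     f \<in> Arr C \<and>
     (\<forall>m n. \<forall>\<mu> \<in> Hom P m n.
        TPowA C f n \<cdot>\<^bsub>C\<^esub> far (s (Dom C f)) \<mu> = far (s (Cod C f)) \<mu> \<cdot>\<^bsub>C\<^esub> TPowA C f m)"

definition homomorphism_subcat ::
    "(nat, 'p) smcat \<Rightarrow> ('o, 'a) smcat \<Rightarrow> ('o \<Rightarrow> (nat, 'p, 'o, 'a) smfun)
      \<Rightarrow> ('o, 'a) smcat" where
  "homomorphism_subcat P C s = subcat C (Obj C) {f. s_homomorphism P C s f}"

definition supply_functor ::
    "(nat, 'p) smcat \<Rightarrow> ('o, 'a) smcat \<Rightarrow> ('o \<Rightarrow> (nat, 'p, 'o, 'a) smfun)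
      \<Rightarrow> (nat, 'p, ('o, 'a, 'o, 'a) smfun, ('o, 'a, 'o, 'a) mnt) smfun" where
  "supply_functor P C s =
     (let C0 = coherence_subcat C; inc = inclusion C0 C in
      \<lparr> fob = TPow (SMF C0 C) inc,
        far = (\<lambda>\<mu>\<in>Arr P.
                 \<lparr> nsrc = TPow (SMF C0 C) inc (Dom P \<mu>), ntgt = TPow (SMF C0 C) inc (Cod P \<mu>),
                   ncmp = (\<lambda>c\<in>Obj C. far (s c) \<mu>) \<rparr>),
        fmul = (\<lambda>(m, n). rebracket (SMF C0 C) inc m n),
        funi = Ident (SMF C0 C) \<one>\<^bsub>SMF C0 C\<^esub> \<rparr>)"

end

theory Submission
  imports Defs
begin

text \<open>
  The coherence isomorphism \<open>(a \<otimes> b) \<otimes> (c \<otimes> d) \<rightarrow> (a \<otimes> c) \<otimes> (b \<otimes> d)\<close> makes the tensor product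
  of \<open>C\<close> a strong monoidal functor, so strong monoidal functors into \<open>C\<close> can be tensored.  In
  particular \<open>inc\<^sup>\<otimes>\<^sup>m\<close> is one, for the inclusion \<open>inc\<close> of any symmetric monoidal subcategory; its
  strongators are the shuffles.  The supply axiom (iii) therefore says that, for each \<open>\<mu> : m \<rightarrow> n\<close>, the
  family \<open>c \<mapsto> s\<^sub>c(\<mu>)\<close> is compatible with the strongators of \<open>inc\<^sup>\<otimes>\<^sup>m\<close> and \<open>inc\<^sup>\<otimes>\<^sup>n\<close>, and the
  \<open>s\<close>-homomorphisms are the arrows at which all these families are natural.  For any monoidal family the
  arrows at which it is natural are closed under composition, tensor and inverses and contain all coherence
  isomorphisms.  On \<open>C\<^sub>s\<close> the families become morphisms of \<open>SMF(C\<^sub>s, C)\<close>, and the axioms for the functor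
  \<open>P \<rightarrow> SMF(C\<^sub>s, C)\<close> hold componentwise because each \<open>s\<^sub>c\<close> is a strong monoidal functor.
\<close>


section \<open>Symmetric monoidal categories\<close>

text \<open>The coherence equations are derived by hand from pentagon, triangle and hexagon, and
  come in two forms. With \<open>interchange\<close> as strongator, the associativity, unit and
  symmetry laws of \<otimes> as a functor of two variables make a tensor product of functors strong
  monoidal. The same squares with the middle arguments exchanged make associators and unitors
  monoidal transformations between such functors, which allows \<open>rebracket\<close> to be formed
  in \<open>SMF\<close>. Since \<open>interchange C a c b d\<close> inverts
  \<open>interchange C a b c d\<close>, the second form follows from the first by cancellation.

  The families c \<mapsto> s_c(\<mu>) are natural only at homomorphisms, and
  \<open>C\<^sub>s\<close> is not known to be a category until closure is proved. So they are first
  treated over all of C as families with monoidality but no naturality. The functor is then built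
  over an arbitrary symmetric monoidal subcategory of homomorphisms, so that one construction serves
  both \<open>C\<^sub>s\<close> and \<open>C\<^sub>0\<close>.\<close>

context category
begin

lemma HomI: "\<lbrakk>f \<in> Arr C; Dom C f = a; Cod C f = b\<rbrakk> \<Longrightarrow> f \<in> Hom C a b"
  by (simp add: Hom_def)

text \<open>The \<open>Hom\<close> axioms are recast as rules on \<open>Arr\<close>,
  \<open>Dom\<close> and \<open>Cod\<close>, so that \<open>simp\<close> settles the typing
  conditions of later rewriting without having to guess endpoints.\<close>

lemma Arr_Ident [simp]: "a \<in> Obj C \<Longrightarrow> Ident C a \<in> Arr C"
  and Dom_Ident [simp]: "a \<in> Obj C \<Longrightarrow> Dom C (Ident C a) = a"
  and Cod_Ident [simp]: "a \<in> Obj C \<Longrightarrow> Cod C (Ident C a) = a"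
  using Ident_Hom[of a] by (auto simp: Hom_def)

lemma Dom_Obj' [simp]: "f \<in> Arr C \<Longrightarrow> Dom C f \<in> Obj C"
  and Cod_Obj' [simp]: "f \<in> Arr C \<Longrightarrow> Cod C f \<in> Obj C"
  by (simp_all add: Dom_Obj Cod_Obj)

lemma
  assumes "f \<in> Arr C" "g \<in> Arr C" "Dom C g = Cod C f"
  shows Arr_Comp [simp]: "g \<cdot> f \<in> Arr C"
    and Dom_Comp [simp]: "Dom C (g \<cdot> f) = Dom C f"
    and Cod_Comp [simp]: "Cod C (g \<cdot> f) = Cod C g"
  using Comp_Hom[OF HomI[OF assms(1) refl refl] HomI[OF assms(2) assms(3) refl]]
  by (auto simp: Hom_def)

lemma Comp_Ident [simp]: "\<lbrakk>f \<in> Arr C; Dom C f = a\<rbrakk> \<Longrightarrow> f \<cdot> Ident C a = f"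
  and Ident_Comp [simp]: "\<lbrakk>f \<in> Arr C; Cod C f = b\<rbrakk> \<Longrightarrow> Ident C b \<cdot> f = f"
  by (auto intro: Comp_Ident_right Comp_Ident_left HomI)

lemma Comp_assoc' [simp]:
  "\<lbrakk>f \<in> Arr C; g \<in> Arr C; h \<in> Arr C; Dom C g = Cod C f; Dom C h = Cod C g\<rbrakk>
    \<Longrightarrow> (h \<cdot> g) \<cdot> f = h \<cdot> (g \<cdot> f)"
  by (rule Comp_assoc) (auto intro: HomI)

text \<open>Composites are kept nested to the right, so the left side of a law g \<cdot> f = k does
  not occur literally inside a longer chain. This rule and \<open>Comp_reduce2\<close> carry such a
  law into the chain; the primed and \<open>_reduce\<close> lemmas below are instances.\<close>

lemma Comp_reduce:
  assumes "g \<cdot> f = k" "f \<in> Arr C" "g \<in> Arr C" "Dom C g = Cod C f" "h \<in> Arr C" "Cod C h = Dom C f"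
  shows "g \<cdot> (f \<cdot> h) = k \<cdot> h"
  using assms Comp_assoc'[of h f g] by simp

lemma Comp_reduce2:
  assumes "g \<cdot> f = k \<cdot> l" "f \<in> Arr C" "g \<in> Arr C" "Dom C g = Cod C f"
    "k \<in> Arr C" "l \<in> Arr C" "Dom C k = Cod C l" "h \<in> Arr C" "Cod C h = Dom C f" "Dom C l = Dom C f"
  shows "g \<cdot> (f \<cdot> h) = k \<cdot> (l \<cdot> h)"
  using assms Comp_assoc'[of h f g] Comp_assoc'[of h l k] by simp

lemma inverse_arrowsI:
  "\<lbrakk>f \<in> Arr C; g \<in> Arr C; Dom C g = Cod C f; Cod C g = Dom C f;
    g \<cdot> f = Ident C (Dom C f); f \<cdot> g = Ident C (Cod C f)\<rbrakk> \<Longrightarrow> inverse_arrows C f g"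
  by (simp add: inverse_arrows_def Hom_def)

lemma inverse_arrows_unique:
  assumes "inverse_arrows C f g" "inverse_arrows C f h"
  shows "g = h"
proof -
  have "g = g \<cdot> (f \<cdot> h)" using assms by (simp add: inverse_arrows_def Hom_def)
  also have "\<dots> = (g \<cdot> f) \<cdot> h" using assms by (subst Comp_assoc') (auto simp: inverse_arrows_def Hom_def)
  also have "\<dots> = h" using assms by (simp add: inverse_arrows_def Hom_def)
  finally show ?thesis .
qed

lemma Inv_eqI: "inverse_arrows C f g \<Longrightarrow> Inv C f = g"
  unfolding Inv_def using inverse_arrows_unique by blast

lemma inverse_arrows_Inv: "is_iso C f \<Longrightarrow> inverse_arrows C f (Inv C f)"
  using Inv_eqI by (auto simp: is_iso_def)

lemma
  assumes "is_iso C f"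
  shows iso_Arr: "f \<in> Arr C"
    and Arr_Inv [simp]: "Inv C f \<in> Arr C"
    and Dom_Inv [simp]: "Dom C (Inv C f) = Cod C f"
    and Cod_Inv [simp]: "Cod C (Inv C f) = Dom C f"
    and Inv_Comp [simp]: "Inv C f \<cdot> f = Ident C (Dom C f)"
    and Comp_Inv [simp]: "f \<cdot> Inv C f = Ident C (Cod C f)"
  using inverse_arrows_Inv[OF assms] by (auto simp: inverse_arrows_def Hom_def)

lemma is_iso_Inv [simp]: "is_iso C f \<Longrightarrow> is_iso C (Inv C f)"
  unfolding is_iso_def[of C "Inv C f"]
  by (rule exI[of _ f], rule inverse_arrowsI) (simp_all add: iso_Arr)

lemma Inv_Inv [simp]: "is_iso C f \<Longrightarrow> Inv C (Inv C f) = f"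
  by (rule Inv_eqI, rule inverse_arrowsI) (simp_all add: iso_Arr)

lemma is_iso_Ident [simp]: "a \<in> Obj C \<Longrightarrow> is_iso C (Ident C a)"
  unfolding is_iso_def by (rule exI[of _ "Ident C a"]) (simp add: inverse_arrows_def Hom_def)

lemma Inv_Ident [simp]: "a \<in> Obj C \<Longrightarrow> Inv C (Ident C a) = Ident C a"
  by (rule Inv_eqI) (simp add: inverse_arrows_def Hom_def)

lemma
  assumes "is_iso C f" "h \<in> Arr C"
  shows Inv_Comp_reduce [simp]: "Cod C h = Dom C f \<Longrightarrow> Inv C f \<cdot> (f \<cdot> h) = h"
    and Comp_Inv_reduce [simp]: "Cod C h = Cod C f \<Longrightarrow> f \<cdot> (Inv C f \<cdot> h) = h"
  using assms iso_Arr[OF assms(1)] by (simp_all flip: Comp_assoc' del: Comp_assoc')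

lemma is_iso_Comp [simp]:
  assumes "is_iso C f" "is_iso C g" "Dom C g = Cod C f"
  shows "is_iso C (g \<cdot> f)"
  unfolding is_iso_def
  by (rule exI[of _ "Inv C f \<cdot> Inv C g"], rule inverse_arrowsI) (use assms iso_Arr in simp_all)

lemma Inv_Comp_distrib:
  assumes "is_iso C f" "is_iso C g" "Dom C g = Cod C f"
  shows "Inv C (g \<cdot> f) = Inv C f \<cdot> Inv C g"
  by (rule Inv_eqI, rule inverse_arrowsI) (use assms iso_Arr in simp_all)

text \<open>Together with \<open>iso_epi\<close> this closes most coherence proofs: both sides are
  composed with an isomorphism that makes a pentagon, triangle or hexagon applicable, and it is then
  cancelled.\<close>

lemma iso_mono:
  assumes "f \<cdot> g = f \<cdot> h" "is_iso C f" "g \<in> Arr C" "h \<in> Arr C" "Cod C g = Dom C f" "Cod C h = Dom C f"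
  shows "g = h"
proof -
  have "g = Inv C f \<cdot> (f \<cdot> g)" using assms(2-) by simp
  also have "\<dots> = Inv C f \<cdot> (f \<cdot> h)" by (simp only: assms(1))
  also have "\<dots> = h" using assms(2-) by simp
  finally show ?thesis .
qed

lemma iso_epi:
  assumes "g \<cdot> f = h \<cdot> f" "is_iso C f" "g \<in> Arr C" "h \<in> Arr C" "Dom C g = Cod C f" "Dom C h = Cod C f"
  shows "g = h"
proof -
  have "g = (g \<cdot> f) \<cdot> Inv C f" using assms(2-) iso_Arr[OF assms(2)] by simp
  also have "\<dots> = (h \<cdot> f) \<cdot> Inv C f" by (simp only: assms(1))
  also have "\<dots> = h" using assms(2-) iso_Arr[OF assms(2)] by simp
  finally show ?thesis .
qed

lemma Inv_move_left:
  assumes "f \<cdot> g = h" "is_iso C f" "g \<in> Arr C" "Cod C g = Dom C f"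
  shows "g = Inv C f \<cdot> h"
  using assms by auto

end

context symmetric_monoidal_category
begin

lemma Obj_Unit [simp]: "\<one> \<in> Obj C" by (rule Unit_Obj)
lemma Obj_TenO [simp]: "\<lbrakk>a \<in> Obj C; b \<in> Obj C\<rbrakk> \<Longrightarrow> a \<otimes> b \<in> Obj C" by (rule TenO_Obj)

lemma
  assumes "f \<in> Arr C" "g \<in> Arr C"
  shows Arr_TenA [simp]: "f \<boxtimes> g \<in> Arr C"
    and Dom_TenA [simp]: "Dom C (f \<boxtimes> g) = Dom C f \<otimes> Dom C g"
    and Cod_TenA [simp]: "Cod C (f \<boxtimes> g) = Cod C f \<otimes> Cod C g"
  using TenA_Hom[OF HomI[OF assms(1) refl refl] HomI[OF assms(2) refl refl]] by (auto simp: Hom_def)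

declare TenA_Ident [simp]

text \<open>Bifunctoriality is oriented towards fusing tensors. Calculations that need a tensor
  split write the split form out and let \<open>simp\<close> fuse both sides.\<close>

lemma TenA_merge [simp]:
  assumes "f \<in> Arr C" "g \<in> Arr C" "f' \<in> Arr C" "g' \<in> Arr C" "Dom C g = Cod C f" "Dom C g' = Cod C f'"
  shows "(g \<boxtimes> g') \<cdot> (f \<boxtimes> f') = (g \<cdot> f) \<boxtimes> (g' \<cdot> f')"
  using assms by (intro TenA_Comp[symmetric]) (auto intro: HomI)

lemma TenA_merge' [simp]:
  assumes "f \<in> Arr C" "g \<in> Arr C" "f' \<in> Arr C" "g' \<in> Arr C" "Dom C g = Cod C f" "Dom C g' = Cod C f'"
    "h \<in> Arr C" "Cod C h = Dom C f \<otimes> Dom C f'"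
  shows "(g \<boxtimes> g') \<cdot> ((f \<boxtimes> f') \<cdot> h) = ((g \<cdot> f) \<boxtimes> (g' \<cdot> f')) \<cdot> h"
  using assms by (intro Comp_reduce) auto

lemma is_iso_TenA [simp]:
  assumes "is_iso C f" "is_iso C g"
  shows "is_iso C (f \<boxtimes> g)"
  unfolding is_iso_def
  by (rule exI[of _ "Inv C f \<boxtimes> Inv C g"], rule inverse_arrowsI) (use assms iso_Arr in simp_all)

lemma Inv_TenA [simp]:
  assumes "is_iso C f" "is_iso C g"
  shows "Inv C (f \<boxtimes> g) = Inv C f \<boxtimes> Inv C g"
  by (rule Inv_eqI, rule inverse_arrowsI) (use assms iso_Arr in simp_all)

lemma
  assumes "a \<in> Obj C" "b \<in> Obj C" "c \<in> Obj C"
  shows Arr_Assoc [simp]: "Assoc C a b c \<in> Arr C"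
    and Dom_Assoc [simp]: "Dom C (Assoc C a b c) = (a \<otimes> b) \<otimes> c"
    and Cod_Assoc [simp]: "Cod C (Assoc C a b c) = a \<otimes> (b \<otimes> c)"
    and is_iso_Assoc [simp]: "is_iso C (Assoc C a b c)"
  using Assoc_Hom[OF assms] Assoc_iso[OF assms] by (auto simp: Hom_def)

lemma
  assumes "a \<in> Obj C"
  shows Arr_LUnit [simp]: "LUnit C a \<in> Arr C"
    and Dom_LUnit [simp]: "Dom C (LUnit C a) = \<one> \<otimes> a"
    and Cod_LUnit [simp]: "Cod C (LUnit C a) = a"
    and is_iso_LUnit [simp]: "is_iso C (LUnit C a)"
    and Arr_RUnit [simp]: "RUnit C a \<in> Arr C"
    and Dom_RUnit [simp]: "Dom C (RUnit C a) = a \<otimes> \<one>"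
    and Cod_RUnit [simp]: "Cod C (RUnit C a) = a"
    and is_iso_RUnit [simp]: "is_iso C (RUnit C a)"
  using LUnit_Hom[OF assms] LUnit_iso[OF assms] RUnit_Hom[OF assms] RUnit_iso[OF assms]
  by (auto simp: Hom_def)

lemma
  assumes "a \<in> Obj C" "b \<in> Obj C"
  shows Arr_Braid [simp]: "Braid C a b \<in> Arr C"
    and Dom_Braid [simp]: "Dom C (Braid C a b) = a \<otimes> b"
    and Cod_Braid [simp]: "Cod C (Braid C a b) = b \<otimes> a"
    and Inv_Braid [simp]: "Inv C (Braid C a b) = Braid C b a"
    and is_iso_Braid [simp]: "is_iso C (Braid C a b)"
    and Braid_Braid' [simp]: "Braid C b a \<cdot> Braid C a b = Ident C (a \<otimes> b)"
proof -
  note [simp] = assms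
  show 1: "Braid C a b \<in> Arr C" "Dom C (Braid C a b) = a \<otimes> b" "Cod C (Braid C a b) = b \<otimes> a"
    using Braid_Hom[OF assms] by (auto simp: Hom_def)
  have 2: "inverse_arrows C (Braid C a b) (Braid C b a)"
    using 1 Braid_Hom[of b a] Braid_Braid[of a b] Braid_Braid[of b a]
    by (simp add: inverse_arrows_def)
  show "Inv C (Braid C a b) = Braid C b a" by (rule Inv_eqI[OF 2])
  show "is_iso C (Braid C a b)" using 2 by (auto simp: is_iso_def)
  show "Braid C b a \<cdot> Braid C a b = Ident C (a \<otimes> b)" by (simp add: Braid_Braid)
qed

lemma Assoc_nat:
  assumes "f \<in> Arr C" "g \<in> Arr C" "h \<in> Arr C" "Cod C f = a" "Cod C g = b" "Cod C h = c"
  shows "Assoc C a b c \<cdot> ((f \<boxtimes> g) \<boxtimes> h) = (f \<boxtimes> (g \<boxtimes> h)) \<cdot> Assoc C (Dom C f) (Dom C g) (Dom C h)"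
  using assms by (intro Assoc_natural HomI) auto

lemma Assoc_nat':
  assumes "f \<in> Arr C" "g \<in> Arr C" "h \<in> Arr C" "Cod C f = a" "Cod C g = b" "Cod C h = c"
    "k \<in> Arr C" "Cod C k = (Dom C f \<otimes> Dom C g) \<otimes> Dom C h"
  shows "Assoc C a b c \<cdot> (((f \<boxtimes> g) \<boxtimes> h) \<cdot> k)
    = (f \<boxtimes> (g \<boxtimes> h)) \<cdot> (Assoc C (Dom C f) (Dom C g) (Dom C h) \<cdot> k)"
  using assms by (intro Comp_reduce2[OF Assoc_nat]) auto

text \<open>\<open>TenA_Ident\<close> fuses the tensor of two identities, after which
  \<open>Assoc_nat\<close> no longer matches; this is naturality in the fused form.\<close>

lemma Assoc_nat_I:
  assumes "a' \<in> Obj C" "b' \<in> Obj C" "h \<in> Arr C" "a = a'" "b = b'" "Cod C h = c"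
  shows "Assoc C a b c \<cdot> (Ident C (a' \<otimes> b') \<boxtimes> h) = (Ident C a \<boxtimes> (Ident C b \<boxtimes> h)) \<cdot> Assoc C a b (Dom C h)"
  using Assoc_nat[of "Ident C a" "Ident C b" h a b c] assms by simp

lemma Assoc_nat_I':
  assumes "a' \<in> Obj C" "b' \<in> Obj C" "h \<in> Arr C" "a = a'" "b = b'" "Cod C h = c"
    "k \<in> Arr C" "Cod C k = (a \<otimes> b) \<otimes> Dom C h"
  shows "Assoc C a b c \<cdot> ((Ident C (a' \<otimes> b') \<boxtimes> h) \<cdot> k)
    = (Ident C a \<boxtimes> (Ident C b \<boxtimes> h)) \<cdot> (Assoc C a b (Dom C h) \<cdot> k)"
  using assms by (intro Comp_reduce2[OF Assoc_nat_I]) auto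

lemma Braid_nat:
  assumes "f \<in> Arr C" "g \<in> Arr C" "Cod C f = a" "Cod C g = b"
  shows "Braid C a b \<cdot> (f \<boxtimes> g) = (g \<boxtimes> f) \<cdot> Braid C (Dom C f) (Dom C g)"
  using assms by (intro Braid_natural HomI) auto

lemma LUnit_nat:
  assumes "f \<in> Arr C" "Cod C f = a"
  shows "LUnit C a \<cdot> (Ident C \<one> \<boxtimes> f) = f \<cdot> LUnit C (Dom C f)"
  using assms by (intro LUnit_natural HomI) auto

lemma RUnit_nat:
  assumes "f \<in> Arr C" "Cod C f = a"
  shows "RUnit C a \<cdot> (f \<boxtimes> Ident C \<one>) = f \<cdot> RUnit C (Dom C f)"
  using assms by (intro RUnit_natural HomI) auto

text \<open>Through the natural isomorphism \<open>LUnit\<close>, tensoring with the unit is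
  isomorphic to the identity functor, hence faithful.\<close>

lemma TenA_unit_left_inject:
  assumes "Ident C \<one> \<boxtimes> f = Ident C \<one> \<boxtimes> g" "f \<in> Arr C" "g \<in> Arr C" "Cod C f = Cod C g" "Dom C f = Dom C g"
  shows "f = g"
  using LUnit_nat[of f "Cod C f"] LUnit_nat[of g "Cod C f"] assms
  by (intro iso_epi[of f "LUnit C (Dom C f)" g]) auto

lemma TenA_unit_right_inject:
  assumes "f \<boxtimes> Ident C \<one> = g \<boxtimes> Ident C \<one>" "f \<in> Arr C" "g \<in> Arr C" "Cod C f = Cod C g" "Dom C f = Dom C g"
  shows "f = g"
  using RUnit_nat[of f "Cod C f"] RUnit_nat[of g "Cod C f"] assms
  by (intro iso_epi[of f "RUnit C (Dom C f)" g]) auto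

end

section \<open>Unit coherence and swaps of adjacent letters\<close>

context symmetric_monoidal_category
begin

lemma triangle_reduce:
  assumes "a \<in> Obj C" "b \<in> Obj C" "h \<in> Arr C" "Cod C h = (a \<otimes> \<one>) \<otimes> b"
  shows "(Ident C a \<boxtimes> LUnit C b) \<cdot> (Assoc C a \<one> b \<cdot> h) = (RUnit C a \<boxtimes> Ident C b) \<cdot> h"
  using assms by (intro Comp_reduce triangle) auto

lemma pentagon_reduce:
  assumes "a \<in> Obj C" "b \<in> Obj C" "c \<in> Obj C" "d \<in> Obj C" "h \<in> Arr C" "Cod C h = ((a \<otimes> b) \<otimes> c) \<otimes> d"
  shows "(Ident C a \<boxtimes> Assoc C b c d) \<cdot> (Assoc C a (b \<otimes> c) d \<cdot> ((Assoc C a b c \<boxtimes> Ident C d) \<cdot> h))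
     = Assoc C a b (c \<otimes> d) \<cdot> (Assoc C (a \<otimes> b) c d \<cdot> h)"
proof -
  have "((Ident C a \<boxtimes> Assoc C b c d) \<cdot> Assoc C a (b \<otimes> c) d \<cdot> (Assoc C a b c \<boxtimes> Ident C d)) \<cdot> h
    = (Assoc C a b (c \<otimes> d) \<cdot> Assoc C (a \<otimes> b) c d) \<cdot> h"
    using assms by (simp only: pentagon)
  then show ?thesis using assms by simp
qed

lemma Assoc_RUnit_middle:
  assumes "a \<in> Obj C" "b \<in> Obj C" "c \<in> Obj C"
  shows "Assoc C a b c \<cdot> ((RUnit C a \<boxtimes> Ident C b) \<boxtimes> Ident C c)
    = (RUnit C a \<boxtimes> Ident C (b \<otimes> c)) \<cdot> Assoc C (a \<otimes> \<one>) b c"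
  using assms Assoc_nat[of "RUnit C a" "Ident C b" "Ident C c"] by simp

text \<open>Kelly's argument: after tensoring with the unit on the left, the pentagon for I, I, a, b
  and two triangles identify both sides along the invertible path \<open>?B \<cdot> ?A\<close>,
  which is then cancelled together with the extra unit.\<close>

lemma LUnit_TenO:
  assumes [simp]: "a \<in> Obj C" "b \<in> Obj C"
  shows "LUnit C (a \<otimes> b) \<cdot> Assoc C \<one> a b = LUnit C a \<boxtimes> Ident C b"
proof -
  let ?A = "Assoc C \<one> \<one> a \<boxtimes> Ident C b"
  let ?B = "Assoc C \<one> (\<one> \<otimes> a) b"
  have "(Ident C \<one> \<boxtimes> (LUnit C (a \<otimes> b) \<cdot> Assoc C \<one> a b)) \<cdot> (?B \<cdot> ?A)
    = (Ident C \<one> \<boxtimes> LUnit C (a \<otimes> b)) \<cdot> ((Ident C \<one> \<boxtimes> Assoc C \<one> a b) \<cdot> (?B \<cdot> ?A))"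
    by simp
  also have "\<dots> = (Ident C \<one> \<boxtimes> LUnit C (a \<otimes> b)) \<cdot> (Assoc C \<one> \<one> (a \<otimes> b) \<cdot> Assoc C (\<one> \<otimes> \<one>) a b)"
    by (simp only: pentagon assms Obj_Unit)
  also have "\<dots> = (RUnit C \<one> \<boxtimes> Ident C (a \<otimes> b)) \<cdot> Assoc C (\<one> \<otimes> \<one>) a b"
    by (rule triangle_reduce) simp_all
  also have "\<dots> = Assoc C \<one> a b \<cdot> ((RUnit C \<one> \<boxtimes> Ident C a) \<boxtimes> Ident C b)"
    by (simp add: Assoc_RUnit_middle)
  also have "\<dots> = Assoc C \<one> a b \<cdot> (((Ident C \<one> \<boxtimes> LUnit C a) \<boxtimes> Ident C b) \<cdot> ?A)"
    by (simp add: triangle)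
  also have "\<dots> = (Ident C \<one> \<boxtimes> (LUnit C a \<boxtimes> Ident C b)) \<cdot> (?B \<cdot> ?A)"
    by (subst Assoc_nat') simp_all
  finally have "Ident C \<one> \<boxtimes> (LUnit C (a \<otimes> b) \<cdot> Assoc C \<one> a b) = Ident C \<one> \<boxtimes> (LUnit C a \<boxtimes> Ident C b)"
    by (rule iso_epi) simp_all
  then show ?thesis by (rule TenA_unit_left_inject) simp_all
qed

text \<open>Mirror image of \<open>LUnit_TenO\<close>: the pentagon for a, b, I, I, with the
  auxiliary unit tensored on the right.\<close>

lemma RUnit_TenO:
  assumes [simp]: "a \<in> Obj C" "b \<in> Obj C"
  shows "(Ident C a \<boxtimes> RUnit C b) \<cdot> Assoc C a b \<one> = RUnit C (a \<otimes> b)"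
proof -
  let ?R = "RUnit C (a \<otimes> b)"
  have "Assoc C a b \<one> \<cdot> (((Ident C a \<boxtimes> RUnit C b) \<cdot> Assoc C a b \<one>) \<boxtimes> Ident C \<one>)
    = Assoc C a b \<one> \<cdot> (((Ident C a \<boxtimes> RUnit C b) \<boxtimes> Ident C \<one>) \<cdot> (Assoc C a b \<one> \<boxtimes> Ident C \<one>))"
    by simp
  also have "\<dots> = (Ident C a \<boxtimes> (RUnit C b \<boxtimes> Ident C \<one>)) \<cdot> (Assoc C a (b \<otimes> \<one>) \<one> \<cdot> (Assoc C a b \<one> \<boxtimes> Ident C \<one>))"
    by (subst Assoc_nat') simp_all
  also have "\<dots> = (Ident C a \<boxtimes> (Ident C b \<boxtimes> LUnit C \<one>)) \<cdot>
    ((Ident C a \<boxtimes> Assoc C b \<one> \<one>) \<cdot> (Assoc C a (b \<otimes> \<one>) \<one> \<cdot> (Assoc C a b \<one> \<boxtimes> Ident C \<one>)))"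
    by (simp add: triangle)
  also have "\<dots> = (Ident C a \<boxtimes> (Ident C b \<boxtimes> LUnit C \<one>)) \<cdot> (Assoc C a b (\<one> \<otimes> \<one>) \<cdot> Assoc C (a \<otimes> b) \<one> \<one>)"
    by (simp only: pentagon assms Obj_Unit)
  also have "\<dots> = Assoc C a b \<one> \<cdot> ((Ident C (a \<otimes> b) \<boxtimes> LUnit C \<one>) \<cdot> Assoc C (a \<otimes> b) \<one> \<one>)"
    by (subst Assoc_nat_I') simp_all
  also have "\<dots> = Assoc C a b \<one> \<cdot> (?R \<boxtimes> Ident C \<one>)"
    by (simp add: triangle)
  finally have "((Ident C a \<boxtimes> RUnit C b) \<cdot> Assoc C a b \<one>) \<boxtimes> Ident C \<one> = ?R \<boxtimes> Ident C \<one>"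
    by (rule iso_mono) simp_all
  then show ?thesis by (rule TenA_unit_right_inject) simp_all
qed

text \<open>Naturality of \<open>LUnit\<close> at \<open>LUnit C \<one>\<close> turns the left
  unitor of I \<otimes> I into 1 \<otimes> \<open>LUnit C \<one>\<close>. Then
  \<open>LUnit_TenO\<close> and the triangle, both at I, I, have the same left side.\<close>

lemma LUnit_Unit: "LUnit C \<one> = RUnit C \<one>"
proof -
  have "LUnit C \<one> \<cdot> (Ident C \<one> \<boxtimes> LUnit C \<one>) = LUnit C \<one> \<cdot> LUnit C (\<one> \<otimes> \<one>)"
    by (subst LUnit_nat) simp_all
  then have "Ident C \<one> \<boxtimes> LUnit C \<one> = LUnit C (\<one> \<otimes> \<one>)"
    by (rule iso_mono) simp_all
  then have "LUnit C \<one> \<boxtimes> Ident C \<one> = RUnit C \<one> \<boxtimes> Ident C \<one>"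
    using LUnit_TenO[of \<one> \<one>] triangle[of \<one> \<one>] by simp
  then show ?thesis by (rule TenA_unit_right_inject) simp_all
qed

text \<open>The hexagon for a, I, I is composed with \<open>LUnit C (\<one> \<otimes> a)\<close>,
  which absorbs the associators into unitors. The common factor \<open>Braid C a \<one>\<close> and
  the extra unit are then cancelled.\<close>

lemma LUnit_Braid:
  assumes [simp]: "a \<in> Obj C"
  shows "LUnit C a \<cdot> Braid C a \<one> = RUnit C a"
proof -
  have hex: "Assoc C \<one> \<one> a \<cdot> (Braid C a (\<one> \<otimes> \<one>) \<cdot> Assoc C a \<one> \<one>)
    = (Ident C \<one> \<boxtimes> Braid C a \<one>) \<cdot> (Assoc C \<one> a \<one> \<cdot> (Braid C a \<one> \<boxtimes> Ident C \<one>))"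
    by (rule hexagon) simp_all
  have "Braid C a \<one> \<cdot> (RUnit C a \<boxtimes> Ident C \<one>)
     = Braid C a \<one> \<cdot> ((Ident C a \<boxtimes> LUnit C \<one>) \<cdot> Assoc C a \<one> \<one>)"
    by (simp add: triangle)
  also have "\<dots> = (LUnit C \<one> \<boxtimes> Ident C a) \<cdot> (Braid C a (\<one> \<otimes> \<one>) \<cdot> Assoc C a \<one> \<one>)"
    using Comp_reduce2[OF Braid_nat[of "Ident C a" "LUnit C \<one>" a \<one>], of "Assoc C a \<one> \<one>"] by simp
  also have "\<dots> = LUnit C (\<one> \<otimes> a) \<cdot> (Assoc C \<one> \<one> a \<cdot> (Braid C a (\<one> \<otimes> \<one>) \<cdot> Assoc C a \<one> \<one>))"
    by (subst Comp_reduce[OF LUnit_TenO]) simp_all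
  also have "\<dots> = LUnit C (\<one> \<otimes> a) \<cdot> ((Ident C \<one> \<boxtimes> Braid C a \<one>) \<cdot> (Assoc C \<one> a \<one> \<cdot> (Braid C a \<one> \<boxtimes> Ident C \<one>)))"
    by (simp only: hex)
  also have "\<dots> = Braid C a \<one> \<cdot> (LUnit C (a \<otimes> \<one>) \<cdot> (Assoc C \<one> a \<one> \<cdot> (Braid C a \<one> \<boxtimes> Ident C \<one>)))"
    by (subst Comp_reduce2[OF LUnit_nat]) simp_all
  also have "\<dots> = Braid C a \<one> \<cdot> ((LUnit C a \<boxtimes> Ident C \<one>) \<cdot> (Braid C a \<one> \<boxtimes> Ident C \<one>))"
    by (subst Comp_reduce[OF LUnit_TenO]) simp_all
  also have "\<dots> = Braid C a \<one> \<cdot> ((LUnit C a \<cdot> Braid C a \<one>) \<boxtimes> Ident C \<one>)"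
    by simp
  finally have "RUnit C a \<boxtimes> Ident C \<one> = (LUnit C a \<cdot> Braid C a \<one>) \<boxtimes> Ident C \<one>"
    by (rule iso_mono) simp_all
  then have "RUnit C a = LUnit C a \<cdot> Braid C a \<one>" by (rule TenA_unit_right_inject) simp_all
  then show ?thesis by (rule sym)
qed

lemma RUnit_Braid:
  assumes [simp]: "a \<in> Obj C"
  shows "RUnit C a \<cdot> Braid C \<one> a = LUnit C a"
  by (simp flip: LUnit_Braid)

text \<open>In right-bracketed words, \<^const>\<open>interchange\<close> is a single swap of adjacent letters (lemma
  \<open>interchange_swap\<close>), so its coherence reduces to the two hexagons for swaps.\<close>

definition swap :: "'a \<Rightarrow> 'a \<Rightarrow> 'a \<Rightarrow> 'b" where
  "swap b c x = Assoc C c b x \<cdot> ((Braid C b c \<boxtimes> Ident C x) \<cdot> Inv C (Assoc C b c x))"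

lemma
  assumes [simp]: "b \<in> Obj C" "c \<in> Obj C" "x \<in> Obj C"
  shows Arr_swap [simp]: "swap b c x \<in> Arr C"
    and Dom_swap [simp]: "Dom C (swap b c x) = b \<otimes> (c \<otimes> x)"
    and Cod_swap [simp]: "Cod C (swap b c x) = c \<otimes> (b \<otimes> x)"
    and is_iso_swap [simp]: "is_iso C (swap b c x)"
  by (simp_all add: swap_def)

lemma swap_swap [simp]:
  assumes "b \<in> Obj C" "c \<in> Obj C" "x \<in> Obj C"
  shows "swap c b x \<cdot> swap b c x = Ident C (b \<otimes> (c \<otimes> x))"
  using assms by (simp add: swap_def)

lemma Inv_swap [simp]:
  assumes [simp]: "b \<in> Obj C" "c \<in> Obj C" "x \<in> Obj C"
  shows "Inv C (swap b c x) = swap c b x"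
  by (rule Inv_eqI, rule inverse_arrowsI) simp_all

lemma Inv_Assoc_nat:
  assumes "f \<in> Arr C" "g \<in> Arr C" "h \<in> Arr C" "Cod C f = a" "Cod C g = b" "Cod C h = c"
  shows "Inv C (Assoc C a b c) \<cdot> (f \<boxtimes> (g \<boxtimes> h))
    = ((f \<boxtimes> g) \<boxtimes> h) \<cdot> Inv C (Assoc C (Dom C f) (Dom C g) (Dom C h))"
proof -
  have "Assoc C a b c \<cdot> (((f \<boxtimes> g) \<boxtimes> h) \<cdot> Inv C (Assoc C (Dom C f) (Dom C g) (Dom C h)))
    = f \<boxtimes> (g \<boxtimes> h)"
    using assms by (subst Assoc_nat') auto
  then show ?thesis by (rule Inv_move_left[symmetric]) (use assms in auto)
qed

lemma swap_nat:
  assumes [simp]: "f \<in> Arr C" "g \<in> Arr C" "h \<in> Arr C" "Cod C f = a" "Cod C g = b" "Cod C h = c"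
  shows "swap a b c \<cdot> (f \<boxtimes> (g \<boxtimes> h)) = (g \<boxtimes> (f \<boxtimes> h)) \<cdot> swap (Dom C f) (Dom C g) (Dom C h)"
proof -
  have [simp]: "a \<in> Obj C" "b \<in> Obj C" "c \<in> Obj C" using assms by (metis Cod_Obj')+
  show ?thesis
    by (simp add: swap_def Inv_Assoc_nat Braid_nat)
       (subst Assoc_nat'[symmetric], simp_all)
qed

lemma interchange_swap:
  assumes [simp]: "a \<in> Obj C" "b \<in> Obj C" "c \<in> Obj C" "d \<in> Obj C"
  shows "interchange C a b c d
    = Inv C (Assoc C a c (b \<otimes> d)) \<cdot> ((Ident C a \<boxtimes> swap b c d) \<cdot> Assoc C a b (c \<otimes> d))"
  by (simp add: interchange_def swap_def)

lemma swap_Assoc: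
  assumes "b \<in> Obj C" "c \<in> Obj C" "x \<in> Obj C"
  shows "swap b c x \<cdot> Assoc C b c x = Assoc C c b x \<cdot> (Braid C b c \<boxtimes> Ident C x)"
  using assms by (simp add: swap_def)

lemma swap_Assoc_reduce:
  assumes "b \<in> Obj C" "c \<in> Obj C" "x \<in> Obj C" "h \<in> Arr C" "Cod C h = (b \<otimes> c) \<otimes> x"
  shows "swap b c x \<cdot> (Assoc C b c x \<cdot> h) = Assoc C c b x \<cdot> ((Braid C b c \<boxtimes> Ident C x) \<cdot> h)"
  using assms by (intro Comp_reduce2[OF swap_Assoc]) auto

text \<open>A swap ignores the bracketing of its tail. Precomposing with \<open>?i\<close> removes
  the inverse associator inside \<open>swap\<close>; two pentagons around naturality of the
  associator at the braiding do the rest.\<close>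

lemma swap_TenO_tail:
  assumes [simp]: "b \<in> Obj C" "c \<in> Obj C" "x \<in> Obj C" "y \<in> Obj C"
  shows "(Ident C c \<boxtimes> Assoc C b x y) \<cdot> (Assoc C c (b \<otimes> x) y \<cdot> (swap b c x \<boxtimes> Ident C y))
    = swap b c (x \<otimes> y) \<cdot> ((Ident C b \<boxtimes> Assoc C c x y) \<cdot> Assoc C b (c \<otimes> x) y)"
    (is "?l = ?r")
proof -
  let ?i = "Assoc C b c x \<boxtimes> Ident C y"
  have "?l \<cdot> ?i = (Ident C c \<boxtimes> Assoc C b x y) \<cdot> (Assoc C c (b \<otimes> x) y \<cdot>
      ((Assoc C c b x \<boxtimes> Ident C y) \<cdot> ((Braid C b c \<boxtimes> Ident C x) \<boxtimes> Ident C y)))"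
    by (simp add: swap_Assoc)
  also have "\<dots> = Assoc C c b (x \<otimes> y) \<cdot> (Assoc C (c \<otimes> b) x y \<cdot> ((Braid C b c \<boxtimes> Ident C x) \<boxtimes> Ident C y))"
    by (rule pentagon_reduce) simp_all
  also have "\<dots> = Assoc C c b (x \<otimes> y) \<cdot> ((Braid C b c \<boxtimes> Ident C (x \<otimes> y)) \<cdot> Assoc C (b \<otimes> c) x y)"
    by (subst Assoc_nat) simp_all
  also have "\<dots> = swap b c (x \<otimes> y) \<cdot> (Assoc C b c (x \<otimes> y) \<cdot> Assoc C (b \<otimes> c) x y)"
    by (simp add: swap_Assoc_reduce)
  also have "\<dots> = ?r \<cdot> ?i"
    by (simp add: pentagon)
  finally show ?thesis by (rule iso_epi) simp_all
qed

text \<open>The hexagon in front of a tail x: moving b past c \<otimes> e is moving it past c and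
  then past e. The pentagons only transport the hexagon from three letters to a word with a
  tail.\<close>

lemma swap_TenO_middle:
  assumes [simp]: "b \<in> Obj C" "c \<in> Obj C" "e \<in> Obj C" "x \<in> Obj C"
  shows "Assoc C c e (b \<otimes> x) \<cdot> swap b (c \<otimes> e) x
    = (Ident C c \<boxtimes> swap b e x) \<cdot> (swap b c (e \<otimes> x) \<cdot> (Ident C b \<boxtimes> Assoc C c e x))"
    (is "?l = ?r")
proof -
  let ?i = "Assoc C b (c \<otimes> e) x \<cdot> (Assoc C b c e \<boxtimes> Ident C x)"
  have "?l \<cdot> ?i = Assoc C c e (b \<otimes> x) \<cdot> (Assoc C (c \<otimes> e) b x \<cdot>
      ((Braid C b (c \<otimes> e) \<cdot> Assoc C b c e) \<boxtimes> Ident C x))"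
    by (simp add: swap_Assoc_reduce)
  also have "\<dots> = (Ident C c \<boxtimes> Assoc C e b x) \<cdot> (Assoc C c (e \<otimes> b) x \<cdot> ((Assoc C c e b \<boxtimes> Ident C x) \<cdot>
      ((Braid C b (c \<otimes> e) \<cdot> Assoc C b c e) \<boxtimes> Ident C x)))"
    by (subst pentagon_reduce) simp_all
  also have "\<dots> = (Ident C c \<boxtimes> Assoc C e b x) \<cdot> (Assoc C c (e \<otimes> b) x \<cdot>
      (((Ident C c \<boxtimes> Braid C b e) \<cdot> (Assoc C c b e \<cdot> (Braid C b c \<boxtimes> Ident C e))) \<boxtimes> Ident C x))"
    by (simp add: hexagon)
  also have "\<dots> = (Ident C c \<boxtimes> Assoc C e b x) \<cdot> (Assoc C c (e \<otimes> b) x \<cdot>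
      (((Ident C c \<boxtimes> Braid C b e) \<boxtimes> Ident C x) \<cdot> ((Assoc C c b e \<cdot> (Braid C b c \<boxtimes> Ident C e)) \<boxtimes> Ident C x)))"
    by simp
  also have "\<dots> = (Ident C c \<boxtimes> (Assoc C e b x \<cdot> (Braid C b e \<boxtimes> Ident C x))) \<cdot> (Assoc C c (b \<otimes> e) x \<cdot>
      ((Assoc C c b e \<cdot> (Braid C b c \<boxtimes> Ident C e)) \<boxtimes> Ident C x))"
    by (subst Assoc_nat') simp_all
  also have "\<dots> = (Ident C c \<boxtimes> swap b e x) \<cdot> ((Ident C c \<boxtimes> Assoc C b e x) \<cdot> (Assoc C c (b \<otimes> e) x \<cdot>
      ((Assoc C c b e \<boxtimes> Ident C x) \<cdot> ((Braid C b c \<boxtimes> Ident C e) \<boxtimes> Ident C x))))"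
    by (simp add: swap_Assoc)
  also have "\<dots> = (Ident C c \<boxtimes> swap b e x) \<cdot> (Assoc C c b (e \<otimes> x) \<cdot> (Assoc C (c \<otimes> b) e x \<cdot>
     ((Braid C b c \<boxtimes> Ident C e) \<boxtimes> Ident C x)))"
    by (subst pentagon_reduce) simp_all
  also have "\<dots> = (Ident C c \<boxtimes> swap b e x) \<cdot> (Assoc C c b (e \<otimes> x) \<cdot>
     ((Braid C b c \<boxtimes> Ident C (e \<otimes> x)) \<cdot> Assoc C (b \<otimes> c) e x))"
    by (subst Assoc_nat) simp_all
  also have "\<dots> = (Ident C c \<boxtimes> swap b e x) \<cdot> (swap b c (e \<otimes> x) \<cdot> (Assoc C b c (e \<otimes> x) \<cdot> Assoc C (b \<otimes> c) e x))"
    by (simp add: swap_Assoc_reduce)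
  also have "\<dots> = ?r \<cdot> ?i" by (simp add: pentagon)
  finally show ?thesis by (rule iso_epi) simp_all
qed

text \<open>The other hexagon, obtained by inverting \<open>swap_TenO_middle\<close>, since the
  inverse of a swap is the opposite swap.\<close>

lemma swap_TenO_left:
  assumes [simp]: "b \<in> Obj C" "d \<in> Obj C" "e \<in> Obj C" "x \<in> Obj C"
  shows "(Ident C e \<boxtimes> Assoc C b d x) \<cdot> swap (b \<otimes> d) e x
    = swap b e (d \<otimes> x) \<cdot> ((Ident C b \<boxtimes> swap d e x) \<cdot> Assoc C b d (e \<otimes> x))"
proof -
  have "Inv C (Assoc C b d (e \<otimes> x) \<cdot> swap e (b \<otimes> d) x)
    = Inv C ((Ident C b \<boxtimes> swap e d x) \<cdot> (swap e b (d \<otimes> x) \<cdot> (Ident C e \<boxtimes> Assoc C b d x)))"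
    by (simp only: swap_TenO_middle assms)
  then have "swap (b \<otimes> d) e x \<cdot> Inv C (Assoc C b d (e \<otimes> x))
    = (Ident C e \<boxtimes> Inv C (Assoc C b d x)) \<cdot> (swap b e (d \<otimes> x) \<cdot> (Ident C b \<boxtimes> swap d e x))"
    by (simp add: Inv_Comp_distrib)
  then have "(Ident C e \<boxtimes> Assoc C b d x) \<cdot> ((swap (b \<otimes> d) e x \<cdot> Inv C (Assoc C b d (e \<otimes> x))) \<cdot> Assoc C b d (e \<otimes> x))
    = (Ident C e \<boxtimes> Assoc C b d x) \<cdot> (((Ident C e \<boxtimes> Inv C (Assoc C b d x)) \<cdot> (swap b e (d \<otimes> x) \<cdot> (Ident C b \<boxtimes> swap d e x))) \<cdot> Assoc C b d (e \<otimes> x))"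
    by (simp only:)
  then show ?thesis by simp
qed

text \<open>The hexagon without a tail: the last letter d is itself what b must pass, so the second
  move is a plain braiding instead of a swap.\<close>

lemma hexagon_swap:
  assumes [simp]: "b \<in> Obj C" "c \<in> Obj C" "d \<in> Obj C"
  shows "Assoc C c d b \<cdot> Braid C b (c \<otimes> d) = (Ident C c \<boxtimes> Braid C b d) \<cdot> swap b c d"
proof -
  have "(Assoc C c d b \<cdot> Braid C b (c \<otimes> d)) \<cdot> Assoc C b c d = ((Ident C c \<boxtimes> Braid C b d) \<cdot> swap b c d) \<cdot> Assoc C b c d"
    by (simp add: swap_Assoc hexagon)
  then show ?thesis by (rule iso_epi) simp_all
qed

lemma hexagon_swap_left:
  assumes [simp]: "b \<in> Obj C" "c \<in> Obj C" "d \<in> Obj C"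
  shows "Braid C (c \<otimes> d) b = swap c b d \<cdot> ((Ident C c \<boxtimes> Braid C d b) \<cdot> Assoc C c d b)"
proof -
  have "Inv C (Assoc C c d b \<cdot> Braid C b (c \<otimes> d)) = Inv C ((Ident C c \<boxtimes> Braid C b d) \<cdot> swap b c d)"
    by (simp only: hexagon_swap assms)
  then have "Braid C (c \<otimes> d) b \<cdot> Inv C (Assoc C c d b) = swap c b d \<cdot> (Ident C c \<boxtimes> Braid C d b)"
    by (simp add: Inv_Comp_distrib)
  then have "(Braid C (c \<otimes> d) b \<cdot> Inv C (Assoc C c d b)) \<cdot> Assoc C c d b
     = (swap c b d \<cdot> (Ident C c \<boxtimes> Braid C d b)) \<cdot> Assoc C c d b"
    by (simp only:)
  then show ?thesis by simp
qed

end


section \<open>Coherence of the interchange isomorphism\<close>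

context symmetric_monoidal_category
begin

lemma
  assumes [simp]: "a \<in> Obj C" "b \<in> Obj C" "c \<in> Obj C" "d \<in> Obj C"
  shows Arr_interchange [simp]: "interchange C a b c d \<in> Arr C"
    and Dom_interchange [simp]: "Dom C (interchange C a b c d) = (a \<otimes> b) \<otimes> (c \<otimes> d)"
    and Cod_interchange [simp]: "Cod C (interchange C a b c d) = (a \<otimes> c) \<otimes> (b \<otimes> d)"
    and is_iso_interchange [simp]: "is_iso C (interchange C a b c d)"
    and Inv_interchange [simp]: "Inv C (interchange C a b c d) = interchange C a c b d"
  by (simp_all add: interchange_swap Inv_Comp_distrib)

lemma
  assumes "a \<in> Obj C" "b \<in> Obj C" "c \<in> Obj C" "d \<in> Obj C"
  shows interchange_interchange [simp]:
      "interchange C a c b d \<cdot> interchange C a b c d = Ident C ((a \<otimes> b) \<otimes> (c \<otimes> d))"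
    and interchange_interchange_reduce [simp]: "\<lbrakk>h \<in> Arr C; Cod C h = (a \<otimes> b) \<otimes> (c \<otimes> d)\<rbrakk>
      \<Longrightarrow> interchange C a c b d \<cdot> (interchange C a b c d \<cdot> h) = h"
  using Inv_Comp[OF is_iso_interchange[OF assms]] Inv_Comp_reduce[OF is_iso_interchange[OF assms], of h] assms
  by simp_all

text \<open>Characterizes \<open>interchange\<close> without inverse associators; calculations below
  right-bracket the target so that this form applies.\<close>

lemma Assoc_interchange:
  assumes [simp]: "a \<in> Obj C" "b \<in> Obj C" "c \<in> Obj C" "d \<in> Obj C"
  shows "Assoc C a c (b \<otimes> d) \<cdot> interchange C a b c d = (Ident C a \<boxtimes> swap b c d) \<cdot> Assoc C a b (c \<otimes> d)"
  by (simp add: interchange_swap)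

lemma Assoc_interchange_reduce:
  assumes "a \<in> Obj C" "b \<in> Obj C" "c \<in> Obj C" "d \<in> Obj C" "h \<in> Arr C" "Cod C h = (a \<otimes> b) \<otimes> (c \<otimes> d)"
  shows "Assoc C a c (b \<otimes> d) \<cdot> (interchange C a b c d \<cdot> h) = (Ident C a \<boxtimes> swap b c d) \<cdot> (Assoc C a b (c \<otimes> d) \<cdot> h)"
  using assms by (intro Comp_reduce2[OF Assoc_interchange]) auto

lemma interchange_nat:
  assumes [simp]: "f \<in> Arr C" "g \<in> Arr C" "h \<in> Arr C" "k \<in> Arr C"
    "Cod C f = a" "Cod C g = b" "Cod C h = c" "Cod C k = d"
  shows "interchange C a b c d \<cdot> ((f \<boxtimes> g) \<boxtimes> (h \<boxtimes> k))
    = ((f \<boxtimes> h) \<boxtimes> (g \<boxtimes> k)) \<cdot> interchange C (Dom C f) (Dom C g) (Dom C h) (Dom C k)"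
proof -
  have [simp]: "a \<in> Obj C" "b \<in> Obj C" "c \<in> Obj C" "d \<in> Obj C" using assms by (metis Cod_Obj')+
  have "Assoc C a c (b \<otimes> d) \<cdot> (interchange C a b c d \<cdot> ((f \<boxtimes> g) \<boxtimes> (h \<boxtimes> k)))
    = (Ident C a \<boxtimes> swap b c d) \<cdot> ((f \<boxtimes> (g \<boxtimes> (h \<boxtimes> k))) \<cdot> Assoc C (Dom C f) (Dom C g) (Dom C h \<otimes> Dom C k))"
    by (simp add: Assoc_interchange_reduce Assoc_nat)
  also have "\<dots> = Assoc C a c (b \<otimes> d) \<cdot> (((f \<boxtimes> h) \<boxtimes> (g \<boxtimes> k)) \<cdot> interchange C (Dom C f) (Dom C g) (Dom C h) (Dom C k))"
    by (simp add: Assoc_nat' Assoc_interchange swap_nat)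
  finally show ?thesis by (rule iso_mono) simp_all
qed

lemma interchange_nat':
  assumes "f \<in> Arr C" "g \<in> Arr C" "h \<in> Arr C" "k \<in> Arr C"
    "Cod C f = a" "Cod C g = b" "Cod C h = c" "Cod C k = d"
    "l \<in> Arr C" "Cod C l = (Dom C f \<otimes> Dom C g) \<otimes> (Dom C h \<otimes> Dom C k)"
  shows "interchange C a b c d \<cdot> (((f \<boxtimes> g) \<boxtimes> (h \<boxtimes> k)) \<cdot> l)
    = ((f \<boxtimes> h) \<boxtimes> (g \<boxtimes> k)) \<cdot> (interchange C (Dom C f) (Dom C g) (Dom C h) (Dom C k) \<cdot> l)"
  using assms by (intro Comp_reduce2[OF interchange_nat]) auto

text \<open>The associativity law of \<otimes> as a strong monoidal functor of two variables. Both
  composites move b past c, d past e and b past e; they differ in which of the first two moves comes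
  first, and those two commute by naturality of \<open>swap\<close>.\<close>

lemma interchange_Assoc:
  assumes [simp]: "a \<in> Obj C" "b \<in> Obj C" "c \<in> Obj C" "d \<in> Obj C" "e \<in> Obj C" "f \<in> Obj C"
  shows "(Assoc C a c e \<boxtimes> Assoc C b d f) \<cdot>
      (interchange C (a \<otimes> c) (b \<otimes> d) e f \<cdot> (interchange C a b c d \<boxtimes> Ident C (e \<otimes> f)))
    = interchange C a b (c \<otimes> e) (d \<otimes> f) \<cdot>
      ((Ident C (a \<otimes> b) \<boxtimes> interchange C c d e f) \<cdot> Assoc C (a \<otimes> b) (c \<otimes> d) (e \<otimes> f))"
    (is "?l = ?r")
proof -
  \<comment> \<open>\<open>?K\<close> brackets the common target fully to the right, as the word a,
    c, e, b, d, f.\<close>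
  let ?K = "(Ident C a \<boxtimes> Assoc C c e (b \<otimes> (d \<otimes> f))) \<cdot> Assoc C a (c \<otimes> e) (b \<otimes> (d \<otimes> f))"
  \<comment> \<open>\<open>?Z\<close> performs the moves of d past e and then of b past e; both
    sides are brought to \<open>?Z\<close> after the move of b past c.\<close>
  let ?Z = "(Ident C a \<boxtimes> (Ident C c \<boxtimes> (swap b e (d \<otimes> f) \<cdot> (Ident C b \<boxtimes> swap d e f))))"
  let ?Y = "Assoc C a b ((c \<otimes> d) \<otimes> (e \<otimes> f)) \<cdot> Assoc C (a \<otimes> b) (c \<otimes> d) (e \<otimes> f)"
  let ?i = "interchange C a b c d \<boxtimes> Ident C (e \<otimes> f)"
  have "?K \<cdot> ?r = (Ident C a \<boxtimes> (Assoc C c e (b \<otimes> (d \<otimes> f)) \<cdot> swap b (c \<otimes> e) (d \<otimes> f))) \<cdot>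
      (Assoc C a b ((c \<otimes> e) \<otimes> (d \<otimes> f)) \<cdot>
      ((Ident C (a \<otimes> b) \<boxtimes> interchange C c d e f) \<cdot> Assoc C (a \<otimes> b) (c \<otimes> d) (e \<otimes> f)))"
    by (simp add: Assoc_interchange_reduce)
  also have "\<dots> = (Ident C a \<boxtimes> (Assoc C c e (b \<otimes> (d \<otimes> f)) \<cdot> swap b (c \<otimes> e) (d \<otimes> f))) \<cdot>
     ((Ident C a \<boxtimes> (Ident C b \<boxtimes> interchange C c d e f)) \<cdot> ?Y)"
    by (subst Assoc_nat_I') simp_all
  also have "\<dots> = (Ident C a \<boxtimes> ((Ident C c \<boxtimes> swap b e (d \<otimes> f)) \<cdot> (swap b c (e \<otimes> (d \<otimes> f)) \<cdot>
      (Ident C b \<boxtimes> (Assoc C c e (d \<otimes> f) \<cdot> interchange C c d e f))))) \<cdot> ?Y"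
    by (simp add: swap_TenO_middle)
  also have "\<dots> = (Ident C a \<boxtimes> ((Ident C c \<boxtimes> swap b e (d \<otimes> f)) \<cdot> (swap b c (e \<otimes> (d \<otimes> f)) \<cdot>
      ((Ident C b \<boxtimes> (Ident C c \<boxtimes> swap d e f)) \<cdot> (Ident C b \<boxtimes> Assoc C c d (e \<otimes> f)))))) \<cdot> ?Y"
    by (simp add: Assoc_interchange)
  \<comment> \<open>The two independent moves are exchanged here: \<open>swap d e f\<close> takes
    place in the tail of \<open>swap b c\<close>, so naturality of the latter lets it pass.\<close>
  also have "\<dots> = (Ident C a \<boxtimes> ((Ident C c \<boxtimes> swap b e (d \<otimes> f)) \<cdot> ((Ident C c \<boxtimes> (Ident C b \<boxtimes> swap d e f)) \<cdot>
      (swap b c (d \<otimes> (e \<otimes> f)) \<cdot> (Ident C b \<boxtimes> Assoc C c d (e \<otimes> f)))))) \<cdot> ?Y"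
    by (subst Comp_reduce2[OF swap_nat]) simp_all
  also have "\<dots> = ?Z \<cdot> ((Ident C a \<boxtimes> (swap b c (d \<otimes> (e \<otimes> f)) \<cdot> (Ident C b \<boxtimes> Assoc C c d (e \<otimes> f)))) \<cdot> ?Y)"
    by simp
  finally have R: "?K \<cdot> ?r = \<dots>" .
  have "?K \<cdot> ?l = (Ident C a \<boxtimes> Assoc C c e (b \<otimes> (d \<otimes> f))) \<cdot> (Assoc C a (c \<otimes> e) (b \<otimes> (d \<otimes> f)) \<cdot>
     ((Assoc C a c e \<boxtimes> Ident C (b \<otimes> (d \<otimes> f))) \<cdot> ((Ident C ((a \<otimes> c) \<otimes> e) \<boxtimes> Assoc C b d f) \<cdot>
      (interchange C (a \<otimes> c) (b \<otimes> d) e f \<cdot> ?i))))"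
    by simp
  also have "\<dots> = Assoc C a c (e \<otimes> (b \<otimes> (d \<otimes> f))) \<cdot> (Assoc C (a \<otimes> c) e (b \<otimes> (d \<otimes> f)) \<cdot>
     ((Ident C ((a \<otimes> c) \<otimes> e) \<boxtimes> Assoc C b d f) \<cdot> (interchange C (a \<otimes> c) (b \<otimes> d) e f \<cdot> ?i)))"
    by (subst pentagon_reduce) simp_all
  also have "\<dots> = Assoc C a c (e \<otimes> (b \<otimes> (d \<otimes> f))) \<cdot> ((Ident C (a \<otimes> c) \<boxtimes> (Ident C e \<boxtimes> Assoc C b d f)) \<cdot>
     (Assoc C (a \<otimes> c) e ((b \<otimes> d) \<otimes> f) \<cdot> (interchange C (a \<otimes> c) (b \<otimes> d) e f \<cdot> ?i)))"
    by (subst Assoc_nat_I') simp_all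
  also have "\<dots> = Assoc C a c (e \<otimes> (b \<otimes> (d \<otimes> f))) \<cdot> ((Ident C (a \<otimes> c) \<boxtimes> (swap b e (d \<otimes> f) \<cdot> ((Ident C b \<boxtimes> swap d e f) \<cdot> Assoc C b d (e \<otimes> f)))) \<cdot>
     (Assoc C (a \<otimes> c) (b \<otimes> d) (e \<otimes> f) \<cdot> ?i))"
    by (simp add: Assoc_interchange_reduce swap_TenO_left)
  also have "\<dots> = (Ident C a \<boxtimes> (Ident C c \<boxtimes> (swap b e (d \<otimes> f) \<cdot> ((Ident C b \<boxtimes> swap d e f) \<cdot> Assoc C b d (e \<otimes> f))))) \<cdot>
     (Assoc C a c ((b \<otimes> d) \<otimes> (e \<otimes> f)) \<cdot> (Assoc C (a \<otimes> c) (b \<otimes> d) (e \<otimes> f) \<cdot> ?i))"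
    by (subst Assoc_nat_I') simp_all
  also have "\<dots> = (Ident C a \<boxtimes> (Ident C c \<boxtimes> (swap b e (d \<otimes> f) \<cdot> ((Ident C b \<boxtimes> swap d e f) \<cdot> Assoc C b d (e \<otimes> f))))) \<cdot>
     ((Ident C a \<boxtimes> Assoc C c (b \<otimes> d) (e \<otimes> f)) \<cdot> (Assoc C a (c \<otimes> (b \<otimes> d)) (e \<otimes> f) \<cdot>
      ((Assoc C a c (b \<otimes> d) \<boxtimes> Ident C (e \<otimes> f)) \<cdot> ?i)))"
    by (subst pentagon_reduce) simp_all
  also have "\<dots> = (Ident C a \<boxtimes> (Ident C c \<boxtimes> (swap b e (d \<otimes> f) \<cdot> ((Ident C b \<boxtimes> swap d e f) \<cdot> Assoc C b d (e \<otimes> f))))) \<cdot>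
     ((Ident C a \<boxtimes> Assoc C c (b \<otimes> d) (e \<otimes> f)) \<cdot> (Assoc C a (c \<otimes> (b \<otimes> d)) (e \<otimes> f) \<cdot>
      (((Ident C a \<boxtimes> swap b c d) \<boxtimes> Ident C (e \<otimes> f)) \<cdot> (Assoc C a b (c \<otimes> d) \<boxtimes> Ident C (e \<otimes> f)))))"
    by (simp add: Assoc_interchange)
  also have "\<dots> = (Ident C a \<boxtimes> (Ident C c \<boxtimes> (swap b e (d \<otimes> f) \<cdot> ((Ident C b \<boxtimes> swap d e f) \<cdot> Assoc C b d (e \<otimes> f))))) \<cdot>
     ((Ident C a \<boxtimes> Assoc C c (b \<otimes> d) (e \<otimes> f)) \<cdot> ((Ident C a \<boxtimes> (swap b c d \<boxtimes> Ident C (e \<otimes> f))) \<cdot>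
     (Assoc C a (b \<otimes> (c \<otimes> d)) (e \<otimes> f) \<cdot> (Assoc C a b (c \<otimes> d) \<boxtimes> Ident C (e \<otimes> f)))))"
    by (subst Assoc_nat') simp_all
  also have "\<dots> = ?Z \<cdot> ((Ident C a \<boxtimes> ((Ident C c \<boxtimes> Assoc C b d (e \<otimes> f)) \<cdot> (Assoc C c (b \<otimes> d) (e \<otimes> f) \<cdot> (swap b c d \<boxtimes> Ident C (e \<otimes> f))))) \<cdot>
     (Assoc C a (b \<otimes> (c \<otimes> d)) (e \<otimes> f) \<cdot> (Assoc C a b (c \<otimes> d) \<boxtimes> Ident C (e \<otimes> f))))"
    by simp
  also have "\<dots> = ?Z \<cdot> ((Ident C a \<boxtimes> (swap b c (d \<otimes> (e \<otimes> f)) \<cdot> ((Ident C b \<boxtimes> Assoc C c d (e \<otimes> f)) \<cdot> Assoc C b (c \<otimes> d) (e \<otimes> f)))) \<cdot>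
     (Assoc C a (b \<otimes> (c \<otimes> d)) (e \<otimes> f) \<cdot> (Assoc C a b (c \<otimes> d) \<boxtimes> Ident C (e \<otimes> f))))"
    by (simp only: swap_TenO_tail assms Obj_TenO)
  also have "\<dots> = ?Z \<cdot> ((Ident C a \<boxtimes> (swap b c (d \<otimes> (e \<otimes> f)) \<cdot> (Ident C b \<boxtimes> Assoc C c d (e \<otimes> f)))) \<cdot>
     ((Ident C a \<boxtimes> Assoc C b (c \<otimes> d) (e \<otimes> f)) \<cdot>
     (Assoc C a (b \<otimes> (c \<otimes> d)) (e \<otimes> f) \<cdot> (Assoc C a b (c \<otimes> d) \<boxtimes> Ident C (e \<otimes> f)))))"
    by simp
  also have "\<dots> = ?Z \<cdot> ((Ident C a \<boxtimes> (swap b c (d \<otimes> (e \<otimes> f)) \<cdot> (Ident C b \<boxtimes> Assoc C c d (e \<otimes> f)))) \<cdot> ?Y)"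
    by (simp only: pentagon assms Obj_TenO)
  finally have "?K \<cdot> ?l = ?K \<cdot> ?r" by (simp only: R)
  then show ?thesis by (rule iso_mono) simp_all
qed

text \<open>\<open>interchange_Assoc\<close> at a, d, b, e, c, f with every interchange moved to the
  other side by its inverse. In this form it says that associators respect the strongators of
  threefold tensor products of functors.\<close>

lemma interchange_Assoc_dual:
  assumes [simp]: "a \<in> Obj C" "b \<in> Obj C" "c \<in> Obj C" "d \<in> Obj C" "e \<in> Obj C" "f \<in> Obj C"
  shows "Assoc C (a \<otimes> d) (b \<otimes> e) (c \<otimes> f) \<cdot>
      ((interchange C a b d e \<boxtimes> Ident C (c \<otimes> f)) \<cdot> interchange C (a \<otimes> b) c (d \<otimes> e) f)
    = (Ident C (a \<otimes> d) \<boxtimes> interchange C b c e f) \<cdot>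
      (interchange C a (b \<otimes> c) d (e \<otimes> f) \<cdot> (Assoc C a b c \<boxtimes> Assoc C d e f))"
proof -
  let ?A = "Assoc C (a \<otimes> d) (b \<otimes> e) (c \<otimes> f)" and ?B = "Assoc C a b c \<boxtimes> Assoc C d e f"
  let ?p = "interchange C (a \<otimes> b) (d \<otimes> e) c f" and ?p' = "interchange C (a \<otimes> b) c (d \<otimes> e) f"
  let ?q = "interchange C a d b e \<boxtimes> Ident C (c \<otimes> f)" and ?q' = "interchange C a b d e \<boxtimes> Ident C (c \<otimes> f)"
  let ?r = "interchange C a d (b \<otimes> c) (e \<otimes> f)" and ?r' = "interchange C a (b \<otimes> c) d (e \<otimes> f)"
  let ?t = "Ident C (a \<otimes> d) \<boxtimes> interchange C b e c f" and ?t' = "Ident C (a \<otimes> d) \<boxtimes> interchange C b c e f"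
  have "(?r \<cdot> ?t) \<cdot> (?A \<cdot> (?q' \<cdot> ?p')) = (?r \<cdot> (?t \<cdot> ?A)) \<cdot> (?q' \<cdot> ?p')" by simp
  also have "\<dots> = (?B \<cdot> (?p \<cdot> ?q)) \<cdot> (?q' \<cdot> ?p')" by (simp only: interchange_Assoc assms)
  also have "\<dots> = (?r \<cdot> ?t) \<cdot> (?t' \<cdot> (?r' \<cdot> ?B))" by simp
  finally show ?thesis by (rule iso_mono) simp_all
qed

text \<open>The left unit law of \<otimes> as a strong monoidal functor, with unit strongator
  \<open>Inv C (LUnit C \<one>)\<close>.\<close>

lemma interchange_LUnit:
  assumes [simp]: "a \<in> Obj C" "b \<in> Obj C"
  shows "(LUnit C a \<boxtimes> LUnit C b) \<cdot> (interchange C \<one> \<one> a b \<cdot> (Inv C (LUnit C \<one>) \<boxtimes> Ident C (a \<otimes> b)))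
    = LUnit C (a \<otimes> b)"
proof -
  \<comment> \<open>The swapped letter is the unit, so its braiding is absorbed by
    \<open>RUnit_Braid\<close>; what is left is the triangle and \<open>LUnit_TenO\<close>.\<close>
  have 1: "(Ident C a \<boxtimes> LUnit C b) \<cdot> swap \<one> a b = LUnit C (a \<otimes> b)"
  proof -
    have "((Ident C a \<boxtimes> LUnit C b) \<cdot> swap \<one> a b) \<cdot> Assoc C \<one> a b
      = (Ident C a \<boxtimes> LUnit C b) \<cdot> (Assoc C a \<one> b \<cdot> (Braid C \<one> a \<boxtimes> Ident C b))"
      by (simp add: swap_Assoc)
    also have "\<dots> = (RUnit C a \<boxtimes> Ident C b) \<cdot> (Braid C \<one> a \<boxtimes> Ident C b)"
      by (rule triangle_reduce) simp_all
    also have "\<dots> = LUnit C (a \<otimes> b) \<cdot> Assoc C \<one> a b"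
      by (simp add: RUnit_Braid LUnit_TenO)
    finally show ?thesis by (rule iso_epi) simp_all
  qed
  have "LUnit C a \<boxtimes> LUnit C b = (LUnit C a \<boxtimes> Ident C b) \<cdot> (Ident C (\<one> \<otimes> a) \<boxtimes> LUnit C b)" by simp
  also have "\<dots> = LUnit C (a \<otimes> b) \<cdot> (Assoc C \<one> a b \<cdot> (Ident C (\<one> \<otimes> a) \<boxtimes> LUnit C b))"
    by (subst Comp_reduce[OF LUnit_TenO]) simp_all
  also have "\<dots> = LUnit C (a \<otimes> b) \<cdot> ((Ident C \<one> \<boxtimes> (Ident C a \<boxtimes> LUnit C b)) \<cdot> Assoc C \<one> a (\<one> \<otimes> b))"
    by (subst Assoc_nat_I) simp_all
  finally have "(LUnit C a \<boxtimes> LUnit C b) \<cdot> (interchange C \<one> \<one> a b \<cdot> (Inv C (LUnit C \<one>) \<boxtimes> Ident C (a \<otimes> b)))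
    = LUnit C (a \<otimes> b) \<cdot> ((Ident C \<one> \<boxtimes> ((Ident C a \<boxtimes> LUnit C b) \<cdot> swap \<one> a b)) \<cdot>
      (Assoc C \<one> \<one> (a \<otimes> b) \<cdot> (Inv C (LUnit C \<one>) \<boxtimes> Ident C (a \<otimes> b))))"
    by (simp add: Assoc_interchange_reduce)
  also have "\<dots> = LUnit C (a \<otimes> b) \<cdot> ((Ident C \<one> \<boxtimes> LUnit C (a \<otimes> b)) \<cdot>
      (Assoc C \<one> \<one> (a \<otimes> b) \<cdot> (Inv C (LUnit C \<one>) \<boxtimes> Ident C (a \<otimes> b))))"
    by (simp only: 1)
  also have "\<dots> = LUnit C (a \<otimes> b) \<cdot> ((RUnit C \<one> \<boxtimes> Ident C (a \<otimes> b)) \<cdot> (Inv C (LUnit C \<one>) \<boxtimes> Ident C (a \<otimes> b)))"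
    by (subst triangle_reduce) simp_all
  also have "\<dots> = LUnit C (a \<otimes> b)" by (simp add: LUnit_Unit)
  finally show ?thesis .
qed

lemma interchange_RUnit:
  assumes [simp]: "a \<in> Obj C" "b \<in> Obj C"
  shows "(RUnit C a \<boxtimes> RUnit C b) \<cdot> (interchange C a b \<one> \<one> \<cdot> (Ident C (a \<otimes> b) \<boxtimes> Inv C (LUnit C \<one>)))
    = RUnit C (a \<otimes> b)"
proof -
  \<comment> \<open>Both sides erase the two units of b \<otimes> (I \<otimes> I); the braiding of b
    with the unit disappears by \<open>LUnit_Braid\<close>.\<close>
  have 1: "(RUnit C b \<cdot> LUnit C (b \<otimes> \<one>)) \<cdot> swap b \<one> \<one> = RUnit C b \<cdot> (Ident C b \<boxtimes> LUnit C \<one>)"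
  proof -
    have "((RUnit C b \<cdot> LUnit C (b \<otimes> \<one>)) \<cdot> swap b \<one> \<one>) \<cdot> Assoc C b \<one> \<one>
      = RUnit C b \<cdot> (LUnit C (b \<otimes> \<one>) \<cdot> (Assoc C \<one> b \<one> \<cdot> (Braid C b \<one> \<boxtimes> Ident C \<one>)))"
      by (simp add: swap_Assoc)
    also have "\<dots> = RUnit C b \<cdot> ((LUnit C b \<boxtimes> Ident C \<one>) \<cdot> (Braid C b \<one> \<boxtimes> Ident C \<one>))"
      by (subst Comp_reduce[OF LUnit_TenO]) simp_all
    also have "\<dots> = (RUnit C b \<cdot> (Ident C b \<boxtimes> LUnit C \<one>)) \<cdot> Assoc C b \<one> \<one>"
      by (simp add: LUnit_Braid triangle)
    finally show ?thesis by (rule iso_epi) simp_all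
  qed
  have "(RUnit C a \<boxtimes> RUnit C b) = (RUnit C a \<boxtimes> Ident C b) \<cdot> (Ident C (a \<otimes> \<one>) \<boxtimes> RUnit C b)" by simp
  also have "\<dots> = (Ident C a \<boxtimes> LUnit C b) \<cdot> (Assoc C a \<one> b \<cdot> (Ident C (a \<otimes> \<one>) \<boxtimes> RUnit C b))"
    by (subst triangle_reduce) simp_all
  also have "\<dots> = (Ident C a \<boxtimes> (LUnit C b \<cdot> (Ident C \<one> \<boxtimes> RUnit C b))) \<cdot> Assoc C a \<one> (b \<otimes> \<one>)"
    by (subst Assoc_nat_I) simp_all
  also have "\<dots> = (Ident C a \<boxtimes> (RUnit C b \<cdot> LUnit C (b \<otimes> \<one>))) \<cdot> Assoc C a \<one> (b \<otimes> \<one>)"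
    by (subst LUnit_nat) simp_all
  finally have "(RUnit C a \<boxtimes> RUnit C b) \<cdot> (interchange C a b \<one> \<one> \<cdot> (Ident C (a \<otimes> b) \<boxtimes> Inv C (LUnit C \<one>)))
    = (Ident C a \<boxtimes> ((RUnit C b \<cdot> LUnit C (b \<otimes> \<one>)) \<cdot> swap b \<one> \<one>)) \<cdot>
      (Assoc C a b (\<one> \<otimes> \<one>) \<cdot> (Ident C (a \<otimes> b) \<boxtimes> Inv C (LUnit C \<one>)))"
    by (simp add: Assoc_interchange_reduce)
  also have "\<dots> = (Ident C a \<boxtimes> (RUnit C b \<cdot> (Ident C b \<boxtimes> LUnit C \<one>))) \<cdot>
      (Assoc C a b (\<one> \<otimes> \<one>) \<cdot> (Ident C (a \<otimes> b) \<boxtimes> Inv C (LUnit C \<one>)))"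
    by (simp only: 1)
  also have "\<dots> = (Ident C a \<boxtimes> (RUnit C b \<cdot> (Ident C b \<boxtimes> LUnit C \<one>))) \<cdot>
      ((Ident C a \<boxtimes> (Ident C b \<boxtimes> Inv C (LUnit C \<one>))) \<cdot> Assoc C a b \<one>)"
    by (subst Assoc_nat_I) simp_all
  also have "\<dots> = RUnit C (a \<otimes> b)" by (simp add: RUnit_TenO)
  finally show ?thesis .
qed

text \<open>The unit law with the interchange moved across. It yields monoidality of the left unitor
  as a transformation, in \<open>LUnit_SMF_Arr\<close>.\<close>

lemma interchange_LUnit_dual:
  assumes [simp]: "a \<in> Obj C" "b \<in> Obj C"
  shows "LUnit C (a \<otimes> b) \<cdot> ((LUnit C \<one> \<boxtimes> Ident C (a \<otimes> b)) \<cdot> interchange C \<one> a \<one> b) = LUnit C a \<boxtimes> LUnit C b"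
proof -
  have "LUnit C (a \<otimes> b) \<cdot> ((LUnit C \<one> \<boxtimes> Ident C (a \<otimes> b)) \<cdot> interchange C \<one> a \<one> b)
    = ((LUnit C a \<boxtimes> LUnit C b) \<cdot> (interchange C \<one> \<one> a b \<cdot> (Inv C (LUnit C \<one>) \<boxtimes> Ident C (a \<otimes> b)))) \<cdot>
      ((LUnit C \<one> \<boxtimes> Ident C (a \<otimes> b)) \<cdot> interchange C \<one> a \<one> b)"
    by (simp only: interchange_LUnit assms)
  then show ?thesis by simp
qed

lemma interchange_RUnit_dual:
  assumes [simp]: "a \<in> Obj C" "b \<in> Obj C"
  shows "RUnit C (a \<otimes> b) \<cdot> ((Ident C (a \<otimes> b) \<boxtimes> LUnit C \<one>) \<cdot> interchange C a \<one> b \<one>) = RUnit C a \<boxtimes> RUnit C b"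
proof -
  have "RUnit C (a \<otimes> b) \<cdot> ((Ident C (a \<otimes> b) \<boxtimes> LUnit C \<one>) \<cdot> interchange C a \<one> b \<one>)
    = ((RUnit C a \<boxtimes> RUnit C b) \<cdot> (interchange C a b \<one> \<one> \<cdot> (Ident C (a \<otimes> b) \<boxtimes> Inv C (LUnit C \<one>)))) \<cdot>
      ((Ident C (a \<otimes> b) \<boxtimes> LUnit C \<one>) \<cdot> interchange C a \<one> b \<one>)"
    by (simp only: interchange_RUnit assms)
  then show ?thesis by simp
qed

text \<open>The symmetry law of \<otimes>. Once \<open>?K\<close> has moved the target to the word
  c, d, a, b, \<open>hexagon_swap\<close> gathers the moves of b into one past c \<otimes> d,
  \<open>swap_TenO_middle\<close> does the same for a, and \<open>hexagon_swap_left\<close>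
  reassembles the braiding of the two pairs.\<close>

lemma interchange_Braid:
  assumes [simp]: "a \<in> Obj C" "b \<in> Obj C" "c \<in> Obj C" "d \<in> Obj C"
  shows "(Braid C a c \<boxtimes> Braid C b d) \<cdot> interchange C a b c d
    = interchange C c d a b \<cdot> Braid C (a \<otimes> b) (c \<otimes> d)"
proof -
  let ?K = "(Ident C c \<boxtimes> swap a d b) \<cdot> Assoc C c a (d \<otimes> b)"
  have "?K \<cdot> ((Braid C a c \<boxtimes> Braid C b d) \<cdot> interchange C a b c d)
    = (Ident C c \<boxtimes> swap a d b) \<cdot> (Assoc C c a (d \<otimes> b) \<cdot> ((Braid C a c \<boxtimes> Ident C (d \<otimes> b)) \<cdot>
      ((Ident C (a \<otimes> c) \<boxtimes> Braid C b d) \<cdot> interchange C a b c d)))"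
    by simp
  also have "\<dots> = (Ident C c \<boxtimes> swap a d b) \<cdot> (swap a c (d \<otimes> b) \<cdot> (Assoc C a c (d \<otimes> b) \<cdot>
      ((Ident C (a \<otimes> c) \<boxtimes> Braid C b d) \<cdot> interchange C a b c d)))"
    by (subst swap_Assoc_reduce) simp_all
  also have "\<dots> = (Ident C c \<boxtimes> swap a d b) \<cdot> (swap a c (d \<otimes> b) \<cdot> ((Ident C a \<boxtimes> (Ident C c \<boxtimes> Braid C b d)) \<cdot>
      (Assoc C a c (b \<otimes> d) \<cdot> interchange C a b c d)))"
    by (subst Assoc_nat_I') simp_all
  also have "\<dots> = (Ident C c \<boxtimes> swap a d b) \<cdot> (swap a c (d \<otimes> b) \<cdot>
      ((Ident C a \<boxtimes> ((Ident C c \<boxtimes> Braid C b d) \<cdot> swap b c d)) \<cdot> Assoc C a b (c \<otimes> d)))"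
    by (simp add: Assoc_interchange)
  also have "\<dots> = (Ident C c \<boxtimes> swap a d b) \<cdot> (swap a c (d \<otimes> b) \<cdot>
      ((Ident C a \<boxtimes> (Assoc C c d b \<cdot> Braid C b (c \<otimes> d))) \<cdot> Assoc C a b (c \<otimes> d)))"
    by (simp only: hexagon_swap assms)
  also have "\<dots> = ((Ident C c \<boxtimes> swap a d b) \<cdot> (swap a c (d \<otimes> b) \<cdot> (Ident C a \<boxtimes> Assoc C c d b))) \<cdot>
       ((Ident C a \<boxtimes> Braid C b (c \<otimes> d)) \<cdot> Assoc C a b (c \<otimes> d))"
    by simp
  also have "\<dots> = (Assoc C c d (a \<otimes> b) \<cdot> swap a (c \<otimes> d) b) \<cdot> ((Ident C a \<boxtimes> Braid C b (c \<otimes> d)) \<cdot> Assoc C a b (c \<otimes> d))"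
    by (simp only: swap_TenO_middle assms)
  also have "\<dots> = Assoc C c d (a \<otimes> b) \<cdot> Braid C (a \<otimes> b) (c \<otimes> d)"
    by (simp add: hexagon_swap_left)
  also have "\<dots> = ?K \<cdot> (interchange C c d a b \<cdot> Braid C (a \<otimes> b) (c \<otimes> d))"
    by (simp add: Assoc_interchange_reduce)
  finally show ?thesis by (rule iso_mono) simp_all
qed

end


section \<open>Tensor products of strong monoidal functors\<close>

locale smc_pair = A: symmetric_monoidal_category A + B: symmetric_monoidal_category B
  for A :: "('o, 'a) smcat" and B :: "('p, 'b) smcat"
begin

lemma
  assumes "strong_monoidal_functor A B F"
  shows fob_Obj [simp]: "a \<in> Obj A \<Longrightarrow> fob F a \<in> Obj B"
    and Arr_far [simp]: "f \<in> Arr A \<Longrightarrow> far F f \<in> Arr B"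
    and Dom_far [simp]: "f \<in> Arr A \<Longrightarrow> Dom B (far F f) = fob F (Dom A f)"
    and Cod_far [simp]: "f \<in> Arr A \<Longrightarrow> Cod B (far F f) = fob F (Cod A f)"
    and far_Ident [simp]: "a \<in> Obj A \<Longrightarrow> far F (Ident A a) = Ident B (fob F a)"
    and far_Comp: "\<lbrakk>f \<in> Arr A; g \<in> Arr A; Dom A g = Cod A f\<rbrakk>
      \<Longrightarrow> far F (g \<cdot>\<^bsub>A\<^esub> f) = far F g \<cdot>\<^bsub>B\<^esub> far F f"
    and Arr_fmul [simp]: "\<lbrakk>a \<in> Obj A; b \<in> Obj A\<rbrakk> \<Longrightarrow> fmul F (a, b) \<in> Arr B"
    and Dom_fmul [simp]: "\<lbrakk>a \<in> Obj A; b \<in> Obj A\<rbrakk> \<Longrightarrow> Dom B (fmul F (a, b)) = fob F a \<otimes>\<^bsub>B\<^esub> fob F b"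
    and Cod_fmul [simp]: "\<lbrakk>a \<in> Obj A; b \<in> Obj A\<rbrakk> \<Longrightarrow> Cod B (fmul F (a, b)) = fob F (a \<otimes>\<^bsub>A\<^esub> b)"
    and is_iso_fmul [simp]: "\<lbrakk>a \<in> Obj A; b \<in> Obj A\<rbrakk> \<Longrightarrow> is_iso B (fmul F (a, b))"
    and Arr_funi [simp]: "funi F \<in> Arr B"
    and Dom_funi [simp]: "Dom B (funi F) = \<one>\<^bsub>B\<^esub>"
    and Cod_funi [simp]: "Cod B (funi F) = fob F \<one>\<^bsub>A\<^esub>"
    and is_iso_funi [simp]: "is_iso B (funi F)"
    and fmul_nat: "\<lbrakk>f \<in> Arr A; g \<in> Arr A; Cod A f = a; Cod A g = b\<rbrakk>
      \<Longrightarrow> fmul F (a, b) \<cdot>\<^bsub>B\<^esub> (far F f \<boxtimes>\<^bsub>B\<^esub> far F g)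
        = far F (f \<boxtimes>\<^bsub>A\<^esub> g) \<cdot>\<^bsub>B\<^esub> fmul F (Dom A f, Dom A g)"
    and fmul_Assoc: "\<lbrakk>a \<in> Obj A; b \<in> Obj A; c \<in> Obj A\<rbrakk>
      \<Longrightarrow> far F (Assoc A a b c) \<cdot>\<^bsub>B\<^esub> (fmul F (a \<otimes>\<^bsub>A\<^esub> b, c)
          \<cdot>\<^bsub>B\<^esub> (fmul F (a, b) \<boxtimes>\<^bsub>B\<^esub> Ident B (fob F c)))
        = fmul F (a, b \<otimes>\<^bsub>A\<^esub> c) \<cdot>\<^bsub>B\<^esub> ((Ident B (fob F a) \<boxtimes>\<^bsub>B\<^esub> fmul F (b, c))
          \<cdot>\<^bsub>B\<^esub> Assoc B (fob F a) (fob F b) (fob F c))"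
    and fmul_LUnit: "a \<in> Obj A
      \<Longrightarrow> far F (LUnit A a) \<cdot>\<^bsub>B\<^esub> (fmul F (\<one>\<^bsub>A\<^esub>, a) \<cdot>\<^bsub>B\<^esub> (funi F \<boxtimes>\<^bsub>B\<^esub> Ident B (fob F a)))
        = LUnit B (fob F a)"
    and fmul_RUnit: "a \<in> Obj A
      \<Longrightarrow> far F (RUnit A a) \<cdot>\<^bsub>B\<^esub> (fmul F (a, \<one>\<^bsub>A\<^esub>) \<cdot>\<^bsub>B\<^esub> (Ident B (fob F a) \<boxtimes>\<^bsub>B\<^esub> funi F))
        = RUnit B (fob F a)"
    and fmul_Braid: "\<lbrakk>a \<in> Obj A; b \<in> Obj A\<rbrakk>
      \<Longrightarrow> far F (Braid A a b) \<cdot>\<^bsub>B\<^esub> fmul F (a, b)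
        = fmul F (b, a) \<cdot>\<^bsub>B\<^esub> Braid B (fob F a) (fob F b)"
  using assms unfolding strong_monoidal_functor_def Hom_def mem_Collect_eq by (blast | (elim conjE, simp; fail))+

lemma strong_monoidal_functorI:
  assumes "\<And>a. a \<in> Obj A \<Longrightarrow> fob F a \<in> Obj B"
    and "\<And>f. f \<in> Arr A \<Longrightarrow> far F f \<in> Arr B"
    and "\<And>f. f \<in> Arr A \<Longrightarrow> Dom B (far F f) = fob F (Dom A f)"
    and "\<And>f. f \<in> Arr A \<Longrightarrow> Cod B (far F f) = fob F (Cod A f)"
    and "\<And>a. a \<in> Obj A \<Longrightarrow> far F (Ident A a) = Ident B (fob F a)"
    and "\<And>f g. \<lbrakk>f \<in> Arr A; g \<in> Arr A; Dom A g = Cod A f\<rbrakk> \<Longrightarrow> far F (g \<cdot>\<^bsub>A\<^esub> f) = far F g \<cdot>\<^bsub>B\<^esub> far F f"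
    and "\<And>a b. \<lbrakk>a \<in> Obj A; b \<in> Obj A\<rbrakk> \<Longrightarrow> is_iso B (fmul F (a, b))"
    and "\<And>a b. \<lbrakk>a \<in> Obj A; b \<in> Obj A\<rbrakk> \<Longrightarrow> Dom B (fmul F (a, b)) = fob F a \<otimes>\<^bsub>B\<^esub> fob F b"
    and "\<And>a b. \<lbrakk>a \<in> Obj A; b \<in> Obj A\<rbrakk> \<Longrightarrow> Cod B (fmul F (a, b)) = fob F (a \<otimes>\<^bsub>A\<^esub> b)"
    and "is_iso B (funi F)"
    and "Dom B (funi F) = \<one>\<^bsub>B\<^esub>"
    and "Cod B (funi F) = fob F \<one>\<^bsub>A\<^esub>"
    and "\<And>f g. \<lbrakk>f \<in> Arr A; g \<in> Arr A\<rbrakk>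
      \<Longrightarrow> fmul F (Cod A f, Cod A g) \<cdot>\<^bsub>B\<^esub> (far F f \<boxtimes>\<^bsub>B\<^esub> far F g)
        = far F (f \<boxtimes>\<^bsub>A\<^esub> g) \<cdot>\<^bsub>B\<^esub> fmul F (Dom A f, Dom A g)"
    and "\<And>a b c. \<lbrakk>a \<in> Obj A; b \<in> Obj A; c \<in> Obj A\<rbrakk>
      \<Longrightarrow> far F (Assoc A a b c) \<cdot>\<^bsub>B\<^esub> (fmul F (a \<otimes>\<^bsub>A\<^esub> b, c)
          \<cdot>\<^bsub>B\<^esub> (fmul F (a, b) \<boxtimes>\<^bsub>B\<^esub> Ident B (fob F c)))
        = fmul F (a, b \<otimes>\<^bsub>A\<^esub> c) \<cdot>\<^bsub>B\<^esub> ((Ident B (fob F a) \<boxtimes>\<^bsub>B\<^esub> fmul F (b, c))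
          \<cdot>\<^bsub>B\<^esub> Assoc B (fob F a) (fob F b) (fob F c))"
    and "\<And>a. a \<in> Obj A
      \<Longrightarrow> far F (LUnit A a) \<cdot>\<^bsub>B\<^esub> (fmul F (\<one>\<^bsub>A\<^esub>, a) \<cdot>\<^bsub>B\<^esub> (funi F \<boxtimes>\<^bsub>B\<^esub> Ident B (fob F a)))
        = LUnit B (fob F a)"
    and "\<And>a. a \<in> Obj A
      \<Longrightarrow> far F (RUnit A a) \<cdot>\<^bsub>B\<^esub> (fmul F (a, \<one>\<^bsub>A\<^esub>) \<cdot>\<^bsub>B\<^esub> (Ident B (fob F a) \<boxtimes>\<^bsub>B\<^esub> funi F))
        = RUnit B (fob F a)"
    and "\<And>a b. \<lbrakk>a \<in> Obj A; b \<in> Obj A\<rbrakk>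
      \<Longrightarrow> far F (Braid A a b) \<cdot>\<^bsub>B\<^esub> fmul F (a, b)
        = fmul F (b, a) \<cdot>\<^bsub>B\<^esub> Braid B (fob F a) (fob F b)"
  shows "strong_monoidal_functor A B F"
  unfolding strong_monoidal_functor_def Hom_def
  using assms B.iso_Arr by (intro conjI allI ballI) auto

lemma fob_tensor [simp]:
    "a \<in> Obj A \<Longrightarrow> fob (tensor_functors A B F G) a = fob F a \<otimes>\<^bsub>B\<^esub> fob G a"
  and far_tensor [simp]:
    "f \<in> Arr A \<Longrightarrow> far (tensor_functors A B F G) f = far F f \<boxtimes>\<^bsub>B\<^esub> far G f"
  and fmul_tensor [simp]: "\<lbrakk>a \<in> Obj A; b \<in> Obj A\<rbrakk> \<Longrightarrow> fmul (tensor_functors A B F G) (a, b)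
    = (fmul F (a, b) \<boxtimes>\<^bsub>B\<^esub> fmul G (a, b)) \<cdot>\<^bsub>B\<^esub> interchange B (fob F a) (fob G a) (fob F b) (fob G b)"
  and funi_tensor [simp]: "funi (tensor_functors A B F G) = (funi F \<boxtimes>\<^bsub>B\<^esub> funi G) \<cdot>\<^bsub>B\<^esub> Inv B (LUnit B \<one>\<^bsub>B\<^esub>)"
  by (simp_all add: tensor_functors_def)

lemma fob_unit_functor [simp]: "a \<in> Obj A \<Longrightarrow> fob (unit_functor A B) a = \<one>\<^bsub>B\<^esub>"
  and far_unit_functor [simp]: "f \<in> Arr A \<Longrightarrow> far (unit_functor A B) f = Ident B \<one>\<^bsub>B\<^esub>"
  and fmul_unit_functor [simp]: "\<lbrakk>a \<in> Obj A; b \<in> Obj A\<rbrakk> \<Longrightarrow> fmul (unit_functor A B) (a, b) = LUnit B \<one>\<^bsub>B\<^esub>"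
  and funi_unit_functor [simp]: "funi (unit_functor A B) = Ident B \<one>\<^bsub>B\<^esub>"
  by (simp_all add: unit_functor_def)

lemma normalized_tensor [simp]: "normalized A (tensor_functors A B F G)"
  and normalized_unit_functor [simp]: "normalized A (unit_functor A B)"
  by (simp_all add: normalized_def tensor_functors_def unit_functor_def)

text \<open>The axioms of the constant functor are coherence of the unit with itself: associativity
  is the triangle at I, I, and symmetry is \<open>LUnit_Braid\<close>, each combined with the
  equality of the two unitors of I.\<close>

lemma strong_monoidal_unit_functor [simp]: "strong_monoidal_functor A B (unit_functor A B)"
proof (rule strong_monoidal_functorI)
  show "far (unit_functor A B) (Braid A a b) \<cdot>\<^bsub>B\<^esub> fmul (unit_functor A B) (a, b)
    = fmul (unit_functor A B) (b, a) \<cdot>\<^bsub>B\<^esub> Braid B (fob (unit_functor A B) a) (fob (unit_functor A B) b)"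
    if "a \<in> Obj A" "b \<in> Obj A" for a b
    using that B.LUnit_Braid[of "\<one>\<^bsub>B\<^esub>"] by (simp add: B.LUnit_Unit)
qed (use B.triangle[of "\<one>\<^bsub>B\<^esub>" "\<one>\<^bsub>B\<^esub>"] in \<open>simp_all add: B.LUnit_Unit\<close>)

text \<open>\<open>interchange_nat\<close> slides the strongators of F and G past the interchanges.
  Then the axioms of F and G apply in separate tensor factors, and the interchanges left over
  satisfy the corresponding law of \<otimes>.\<close>

lemma strong_monoidal_tensor [simp]:
  assumes [simp]: "strong_monoidal_functor A B F" "strong_monoidal_functor A B G"
  shows "strong_monoidal_functor A B (tensor_functors A B F G)" (is "strong_monoidal_functor A B ?T")
proof (rule strong_monoidal_functorI)
  fix a b c assume [simp]: "a \<in> Obj A" "b \<in> Obj A" "c \<in> Obj A"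
  let ?FA = "far F (Assoc A a b c)" and ?GA = "far G (Assoc A a b c)"
  let ?i = "interchange B (fob F a \<otimes>\<^bsub>B\<^esub> fob F b) (fob G a \<otimes>\<^bsub>B\<^esub> fob G b) (fob F c) (fob G c) \<cdot>\<^bsub>B\<^esub>
    (interchange B (fob F a) (fob G a) (fob F b) (fob G b) \<boxtimes>\<^bsub>B\<^esub> Ident B (fob F c \<otimes>\<^bsub>B\<^esub> fob G c))"
  have "far ?T (Assoc A a b c) \<cdot>\<^bsub>B\<^esub> (fmul ?T (a \<otimes>\<^bsub>A\<^esub> b, c) \<cdot>\<^bsub>B\<^esub> (fmul ?T (a, b) \<boxtimes>\<^bsub>B\<^esub> Ident B (fob ?T c)))
    = ((?FA \<cdot>\<^bsub>B\<^esub> fmul F (a \<otimes>\<^bsub>A\<^esub> b, c)) \<boxtimes>\<^bsub>B\<^esub> (?GA \<cdot>\<^bsub>B\<^esub> fmul G (a \<otimes>\<^bsub>A\<^esub> b, c))) \<cdot>\<^bsub>B\<^esub>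
      (interchange B (fob F (a \<otimes>\<^bsub>A\<^esub> b)) (fob G (a \<otimes>\<^bsub>A\<^esub> b)) (fob F c) (fob G c) \<cdot>\<^bsub>B\<^esub>
      (((fmul F (a, b) \<boxtimes>\<^bsub>B\<^esub> fmul G (a, b)) \<boxtimes>\<^bsub>B\<^esub> (Ident B (fob F c) \<boxtimes>\<^bsub>B\<^esub> Ident B (fob G c))) \<cdot>\<^bsub>B\<^esub>
      (interchange B (fob F a) (fob G a) (fob F b) (fob G b) \<boxtimes>\<^bsub>B\<^esub> Ident B (fob F c \<otimes>\<^bsub>B\<^esub> fob G c))))"
    by simp
  also have "\<dots> = ((?FA \<cdot>\<^bsub>B\<^esub> (fmul F (a \<otimes>\<^bsub>A\<^esub> b, c) \<cdot>\<^bsub>B\<^esub> (fmul F (a, b) \<boxtimes>\<^bsub>B\<^esub> Ident B (fob F c)))) \<boxtimes>\<^bsub>B\<^esub>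
      (?GA \<cdot>\<^bsub>B\<^esub> (fmul G (a \<otimes>\<^bsub>A\<^esub> b, c) \<cdot>\<^bsub>B\<^esub> (fmul G (a, b) \<boxtimes>\<^bsub>B\<^esub> Ident B (fob G c))))) \<cdot>\<^bsub>B\<^esub> ?i"
    by (subst B.interchange_nat') simp_all
  also have "\<dots> = ((fmul F (a, b \<otimes>\<^bsub>A\<^esub> c) \<cdot>\<^bsub>B\<^esub> (Ident B (fob F a) \<boxtimes>\<^bsub>B\<^esub> fmul F (b, c))) \<boxtimes>\<^bsub>B\<^esub>
      (fmul G (a, b \<otimes>\<^bsub>A\<^esub> c) \<cdot>\<^bsub>B\<^esub> (Ident B (fob G a) \<boxtimes>\<^bsub>B\<^esub> fmul G (b, c)))) \<cdot>\<^bsub>B\<^esub>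
      ((Assoc B (fob F a) (fob F b) (fob F c) \<boxtimes>\<^bsub>B\<^esub> Assoc B (fob G a) (fob G b) (fob G c)) \<cdot>\<^bsub>B\<^esub> ?i)"
    by (simp add: fmul_Assoc)
  also have "\<dots> = (fmul F (a, b \<otimes>\<^bsub>A\<^esub> c) \<boxtimes>\<^bsub>B\<^esub> fmul G (a, b \<otimes>\<^bsub>A\<^esub> c)) \<cdot>\<^bsub>B\<^esub>
      (((Ident B (fob F a) \<boxtimes>\<^bsub>B\<^esub> fmul F (b, c)) \<boxtimes>\<^bsub>B\<^esub> (Ident B (fob G a) \<boxtimes>\<^bsub>B\<^esub> fmul G (b, c))) \<cdot>\<^bsub>B\<^esub>
      (interchange B (fob F a) (fob G a) (fob F b \<otimes>\<^bsub>B\<^esub> fob F c) (fob G b \<otimes>\<^bsub>B\<^esub> fob G c) \<cdot>\<^bsub>B\<^esub>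
      ((Ident B (fob F a \<otimes>\<^bsub>B\<^esub> fob G a) \<boxtimes>\<^bsub>B\<^esub> interchange B (fob F b) (fob G b) (fob F c) (fob G c)) \<cdot>\<^bsub>B\<^esub>
      Assoc B (fob F a \<otimes>\<^bsub>B\<^esub> fob G a) (fob F b \<otimes>\<^bsub>B\<^esub> fob G b) (fob F c \<otimes>\<^bsub>B\<^esub> fob G c))))"
    by (subst B.interchange_Assoc) simp_all
  also have "\<dots> = (fmul F (a, b \<otimes>\<^bsub>A\<^esub> c) \<boxtimes>\<^bsub>B\<^esub> fmul G (a, b \<otimes>\<^bsub>A\<^esub> c)) \<cdot>\<^bsub>B\<^esub>
      (interchange B (fob F a) (fob G a) (fob F (b \<otimes>\<^bsub>A\<^esub> c)) (fob G (b \<otimes>\<^bsub>A\<^esub> c)) \<cdot>\<^bsub>B\<^esub>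
      (((Ident B (fob F a) \<boxtimes>\<^bsub>B\<^esub> Ident B (fob G a)) \<boxtimes>\<^bsub>B\<^esub> (fmul F (b, c) \<boxtimes>\<^bsub>B\<^esub> fmul G (b, c))) \<cdot>\<^bsub>B\<^esub>
      ((Ident B (fob F a \<otimes>\<^bsub>B\<^esub> fob G a) \<boxtimes>\<^bsub>B\<^esub> interchange B (fob F b) (fob G b) (fob F c) (fob G c)) \<cdot>\<^bsub>B\<^esub>
      Assoc B (fob F a \<otimes>\<^bsub>B\<^esub> fob G a) (fob F b \<otimes>\<^bsub>B\<^esub> fob G b) (fob F c \<otimes>\<^bsub>B\<^esub> fob G c))))"
    by (subst B.interchange_nat') simp_all
  also have "\<dots> = fmul ?T (a, b \<otimes>\<^bsub>A\<^esub> c) \<cdot>\<^bsub>B\<^esub> ((Ident B (fob ?T a) \<boxtimes>\<^bsub>B\<^esub> fmul ?T (b, c))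
          \<cdot>\<^bsub>B\<^esub> Assoc B (fob ?T a) (fob ?T b) (fob ?T c))"
    by simp
  finally show "far ?T (Assoc A a b c) \<cdot>\<^bsub>B\<^esub> (fmul ?T (a \<otimes>\<^bsub>A\<^esub> b, c) \<cdot>\<^bsub>B\<^esub> (fmul ?T (a, b) \<boxtimes>\<^bsub>B\<^esub> Ident B (fob ?T c)))
    = \<dots>" .
next
  fix a assume [simp]: "a \<in> Obj A"
  have "far ?T (LUnit A a) \<cdot>\<^bsub>B\<^esub> (fmul ?T (\<one>\<^bsub>A\<^esub>, a) \<cdot>\<^bsub>B\<^esub> (funi ?T \<boxtimes>\<^bsub>B\<^esub> Ident B (fob ?T a)))
    = ((far F (LUnit A a) \<cdot>\<^bsub>B\<^esub> fmul F (\<one>\<^bsub>A\<^esub>, a)) \<boxtimes>\<^bsub>B\<^esub> (far G (LUnit A a) \<cdot>\<^bsub>B\<^esub> fmul G (\<one>\<^bsub>A\<^esub>, a))) \<cdot>\<^bsub>B\<^esub>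
      (interchange B (fob F \<one>\<^bsub>A\<^esub>) (fob G \<one>\<^bsub>A\<^esub>) (fob F a) (fob G a) \<cdot>\<^bsub>B\<^esub>
      (((funi F \<boxtimes>\<^bsub>B\<^esub> funi G) \<boxtimes>\<^bsub>B\<^esub> (Ident B (fob F a) \<boxtimes>\<^bsub>B\<^esub> Ident B (fob G a))) \<cdot>\<^bsub>B\<^esub>
      (Inv B (LUnit B \<one>\<^bsub>B\<^esub>) \<boxtimes>\<^bsub>B\<^esub> Ident B (fob F a \<otimes>\<^bsub>B\<^esub> fob G a))))"
    by simp
  also have "\<dots> = LUnit B (fob ?T a)"
    by (subst B.interchange_nat') (simp_all add: fmul_LUnit B.interchange_LUnit)
  finally show "far ?T (LUnit A a) \<cdot>\<^bsub>B\<^esub> (fmul ?T (\<one>\<^bsub>A\<^esub>, a) \<cdot>\<^bsub>B\<^esub> (funi ?T \<boxtimes>\<^bsub>B\<^esub> Ident B (fob ?T a)))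
    = LUnit B (fob ?T a)" .
  have "far ?T (RUnit A a) \<cdot>\<^bsub>B\<^esub> (fmul ?T (a, \<one>\<^bsub>A\<^esub>) \<cdot>\<^bsub>B\<^esub> (Ident B (fob ?T a) \<boxtimes>\<^bsub>B\<^esub> funi ?T))
    = ((far F (RUnit A a) \<cdot>\<^bsub>B\<^esub> fmul F (a, \<one>\<^bsub>A\<^esub>)) \<boxtimes>\<^bsub>B\<^esub> (far G (RUnit A a) \<cdot>\<^bsub>B\<^esub> fmul G (a, \<one>\<^bsub>A\<^esub>))) \<cdot>\<^bsub>B\<^esub>
      (interchange B (fob F a) (fob G a) (fob F \<one>\<^bsub>A\<^esub>) (fob G \<one>\<^bsub>A\<^esub>) \<cdot>\<^bsub>B\<^esub>
      (((Ident B (fob F a) \<boxtimes>\<^bsub>B\<^esub> Ident B (fob G a)) \<boxtimes>\<^bsub>B\<^esub> (funi F \<boxtimes>\<^bsub>B\<^esub> funi G)) \<cdot>\<^bsub>B\<^esub>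
      (Ident B (fob F a \<otimes>\<^bsub>B\<^esub> fob G a) \<boxtimes>\<^bsub>B\<^esub> Inv B (LUnit B \<one>\<^bsub>B\<^esub>))))"
    by simp
  also have "\<dots> = RUnit B (fob ?T a)"
    by (subst B.interchange_nat') (simp_all add: fmul_RUnit B.interchange_RUnit)
  finally show "far ?T (RUnit A a) \<cdot>\<^bsub>B\<^esub> (fmul ?T (a, \<one>\<^bsub>A\<^esub>) \<cdot>\<^bsub>B\<^esub> (Ident B (fob ?T a) \<boxtimes>\<^bsub>B\<^esub> funi ?T))
    = RUnit B (fob ?T a)" .
next
  fix a b assume [simp]: "a \<in> Obj A" "b \<in> Obj A"
  have "far ?T (Braid A a b) \<cdot>\<^bsub>B\<^esub> fmul ?T (a, b)
    = (fmul F (b, a) \<boxtimes>\<^bsub>B\<^esub> fmul G (b, a)) \<cdot>\<^bsub>B\<^esub>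
      ((Braid B (fob F a) (fob F b) \<boxtimes>\<^bsub>B\<^esub> Braid B (fob G a) (fob G b)) \<cdot>\<^bsub>B\<^esub>
      interchange B (fob F a) (fob G a) (fob F b) (fob G b))"
    by (simp add: fmul_Braid)
  also have "\<dots> = fmul ?T (b, a) \<cdot>\<^bsub>B\<^esub> Braid B (fob ?T a) (fob ?T b)"
    by (subst B.interchange_Braid) simp_all
  finally show "far ?T (Braid A a b) \<cdot>\<^bsub>B\<^esub> fmul ?T (a, b) = fmul ?T (b, a) \<cdot>\<^bsub>B\<^esub> Braid B (fob ?T a) (fob ?T b)" .
qed (simp_all add: far_Comp fmul_nat B.interchange_nat)

end


section \<open>Monoidal natural transformations\<close>

context smc_pair
begin

text \<open>With its operations unfolded to records, an equation in \<open>SMF\<close> becomes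
  equality of sources, targets and components. Membership in \<open>Arr\<close> stays folded, so
  that naturality and monoidality are unpacked only on demand.\<close>

lemma SMF_simps [simp]:
  "F \<in> Obj (SMF A B) \<longleftrightarrow> strong_monoidal_functor A B F \<and> normalized A F"
  "Dom (SMF A B) = nsrc"
  "Cod (SMF A B) = ntgt"
  "Ident (SMF A B) F = \<lparr> nsrc = F, ntgt = F, ncmp = (\<lambda>a\<in>Obj A. Ident B (fob F a)) \<rparr>"
  "u \<cdot>\<^bsub>SMF A B\<^esub> t = \<lparr> nsrc = nsrc t, ntgt = ntgt u, ncmp = (\<lambda>a\<in>Obj A. ncmp u a \<cdot>\<^bsub>B\<^esub> ncmp t a) \<rparr>"
  "\<one>\<^bsub>SMF A B\<^esub> = unit_functor A B"
  "F \<otimes>\<^bsub>SMF A B\<^esub> G = tensor_functors A B F G"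
  "t \<boxtimes>\<^bsub>SMF A B\<^esub> u = \<lparr> nsrc = tensor_functors A B (nsrc t) (nsrc u),
     ntgt = tensor_functors A B (ntgt t) (ntgt u), ncmp = (\<lambda>a\<in>Obj A. ncmp t a \<boxtimes>\<^bsub>B\<^esub> ncmp u a) \<rparr>"
  "Assoc (SMF A B) F G H = \<lparr> nsrc = tensor_functors A B (tensor_functors A B F G) H,
     ntgt = tensor_functors A B F (tensor_functors A B G H),
     ncmp = (\<lambda>a\<in>Obj A. Assoc B (fob F a) (fob G a) (fob H a)) \<rparr>"
  "LUnit (SMF A B) F = \<lparr> nsrc = tensor_functors A B (unit_functor A B) F, ntgt = F,
     ncmp = (\<lambda>a\<in>Obj A. LUnit B (fob F a)) \<rparr>"
  "RUnit (SMF A B) F = \<lparr> nsrc = tensor_functors A B F (unit_functor A B), ntgt = F,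
     ncmp = (\<lambda>a\<in>Obj A. RUnit B (fob F a)) \<rparr>"
  "Braid (SMF A B) F G = \<lparr> nsrc = tensor_functors A B F G, ntgt = tensor_functors A B G F,
     ncmp = (\<lambda>a\<in>Obj A. Braid B (fob F a) (fob G a)) \<rparr>"
  by (simp_all add: SMF_def)

lemma Arr_SMF_iff: "t \<in> Arr (SMF A B) \<longleftrightarrow>
    strong_monoidal_functor A B (nsrc t) \<and> normalized A (nsrc t) \<and>
    strong_monoidal_functor A B (ntgt t) \<and> normalized A (ntgt t) \<and>
    monoidal_natural A B t"
  by (simp add: SMF_def)

lemma Arr_SMF_I:
  assumes "strong_monoidal_functor A B (nsrc t)" "normalized A (nsrc t)"
    and "strong_monoidal_functor A B (ntgt t)" "normalized A (ntgt t)"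
    and "ncmp t \<in> extensional (Obj A)"
    and "\<And>a. a \<in> Obj A \<Longrightarrow> ncmp t a \<in> Arr B"
    and "\<And>a. a \<in> Obj A \<Longrightarrow> Dom B (ncmp t a) = fob (nsrc t) a"
    and "\<And>a. a \<in> Obj A \<Longrightarrow> Cod B (ncmp t a) = fob (ntgt t) a"
    and "\<And>f. f \<in> Arr A \<Longrightarrow>
      ncmp t (Cod A f) \<cdot>\<^bsub>B\<^esub> far (nsrc t) f = far (ntgt t) f \<cdot>\<^bsub>B\<^esub> ncmp t (Dom A f)"
    and "\<And>a b. \<lbrakk>a \<in> Obj A; b \<in> Obj A\<rbrakk> \<Longrightarrow> ncmp t (a \<otimes>\<^bsub>A\<^esub> b) \<cdot>\<^bsub>B\<^esub> fmul (nsrc t) (a, b)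
        = fmul (ntgt t) (a, b) \<cdot>\<^bsub>B\<^esub> (ncmp t a \<boxtimes>\<^bsub>B\<^esub> ncmp t b)"
    and "ncmp t \<one>\<^bsub>A\<^esub> \<cdot>\<^bsub>B\<^esub> funi (nsrc t) = funi (ntgt t)"
  shows "t \<in> Arr (SMF A B)"
  using assms by (auto simp: Arr_SMF_iff monoidal_natural_def Hom_def)

lemma
  assumes "t \<in> Arr (SMF A B)"
  shows strong_nsrc [simp]: "strong_monoidal_functor A B (nsrc t)"
    and normalized_nsrc [simp]: "normalized A (nsrc t)"
    and strong_ntgt [simp]: "strong_monoidal_functor A B (ntgt t)"
    and normalized_ntgt [simp]: "normalized A (ntgt t)"
    and ncmp_extensional: "ncmp t \<in> extensional (Obj A)"
    and Arr_ncmp [simp]: "a \<in> Obj A \<Longrightarrow> ncmp t a \<in> Arr B"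
    and Dom_ncmp [simp]: "a \<in> Obj A \<Longrightarrow> Dom B (ncmp t a) = fob (nsrc t) a"
    and Cod_ncmp [simp]: "a \<in> Obj A \<Longrightarrow> Cod B (ncmp t a) = fob (ntgt t) a"
    and ncmp_nat: "f \<in> Arr A \<Longrightarrow>
      ncmp t (Cod A f) \<cdot>\<^bsub>B\<^esub> far (nsrc t) f = far (ntgt t) f \<cdot>\<^bsub>B\<^esub> ncmp t (Dom A f)"
    and ncmp_TenO: "\<lbrakk>a \<in> Obj A; b \<in> Obj A\<rbrakk> \<Longrightarrow> ncmp t (a \<otimes>\<^bsub>A\<^esub> b) \<cdot>\<^bsub>B\<^esub> fmul (nsrc t) (a, b)
        = fmul (ntgt t) (a, b) \<cdot>\<^bsub>B\<^esub> (ncmp t a \<boxtimes>\<^bsub>B\<^esub> ncmp t b)"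
    and ncmp_Unit: "ncmp t \<one>\<^bsub>A\<^esub> \<cdot>\<^bsub>B\<^esub> funi (nsrc t) = funi (ntgt t)"
  using assms by (auto simp: Arr_SMF_iff monoidal_natural_def Hom_def)

lemma mnt_eqI:
  assumes "nsrc t = nsrc u" "ntgt t = ntgt u" "\<And>a. a \<in> Obj A \<Longrightarrow> ncmp t a = ncmp u a"
    and "ncmp t \<in> extensional (Obj A)" "ncmp u \<in> extensional (Obj A)"
  shows "t = (u :: ('o, 'a, 'p, 'b) mnt)"
  using assms by (intro mnt.equality extensionalityI[of _ "Obj A"]) auto

lemma Ident_SMF_Arr:
  assumes [simp]: "strong_monoidal_functor A B F" "normalized A F"
  shows "Ident (SMF A B) F \<in> Arr (SMF A B)"
  by (rule Arr_SMF_I) simp_all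

lemma Comp_SMF_Arr:
  assumes [simp]: "t \<in> Arr (SMF A B)" "u \<in> Arr (SMF A B)" and eq [simp]: "nsrc u = ntgt t"
  shows "u \<cdot>\<^bsub>SMF A B\<^esub> t \<in> Arr (SMF A B)"
proof (rule Arr_SMF_I)
  fix f assume [simp]: "f \<in> Arr A"
  have "(ncmp u (Cod A f) \<cdot>\<^bsub>B\<^esub> ncmp t (Cod A f)) \<cdot>\<^bsub>B\<^esub> far (nsrc t) f
    = ncmp u (Cod A f) \<cdot>\<^bsub>B\<^esub> (far (nsrc u) f \<cdot>\<^bsub>B\<^esub> ncmp t (Dom A f))"
    by (simp add: ncmp_nat)
  also have "\<dots> = far (ntgt u) f \<cdot>\<^bsub>B\<^esub> (ncmp u (Dom A f) \<cdot>\<^bsub>B\<^esub> ncmp t (Dom A f))"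
    by (subst B.Comp_reduce2[OF ncmp_nat]) simp_all
  finally show "ncmp (u \<cdot>\<^bsub>SMF A B\<^esub> t) (Cod A f) \<cdot>\<^bsub>B\<^esub> far (nsrc (u \<cdot>\<^bsub>SMF A B\<^esub> t)) f
    = far (ntgt (u \<cdot>\<^bsub>SMF A B\<^esub> t)) f \<cdot>\<^bsub>B\<^esub> ncmp (u \<cdot>\<^bsub>SMF A B\<^esub> t) (Dom A f)"
    by simp
next
  fix a b assume [simp]: "a \<in> Obj A" "b \<in> Obj A"
  have "(ncmp u (a \<otimes>\<^bsub>A\<^esub> b) \<cdot>\<^bsub>B\<^esub> ncmp t (a \<otimes>\<^bsub>A\<^esub> b)) \<cdot>\<^bsub>B\<^esub> fmul (nsrc t) (a, b)
    = ncmp u (a \<otimes>\<^bsub>A\<^esub> b) \<cdot>\<^bsub>B\<^esub> (fmul (nsrc u) (a, b) \<cdot>\<^bsub>B\<^esub> (ncmp t a \<boxtimes>\<^bsub>B\<^esub> ncmp t b))"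
    by (simp add: ncmp_TenO)
  also have "\<dots> = fmul (ntgt u) (a, b) \<cdot>\<^bsub>B\<^esub> ((ncmp u a \<boxtimes>\<^bsub>B\<^esub> ncmp u b) \<cdot>\<^bsub>B\<^esub> (ncmp t a \<boxtimes>\<^bsub>B\<^esub> ncmp t b))"
    by (subst B.Comp_reduce2[OF ncmp_TenO]) simp_all
  finally show "ncmp (u \<cdot>\<^bsub>SMF A B\<^esub> t) (a \<otimes>\<^bsub>A\<^esub> b) \<cdot>\<^bsub>B\<^esub> fmul (nsrc (u \<cdot>\<^bsub>SMF A B\<^esub> t)) (a, b)
    = fmul (ntgt (u \<cdot>\<^bsub>SMF A B\<^esub> t)) (a, b) \<cdot>\<^bsub>B\<^esub> (ncmp (u \<cdot>\<^bsub>SMF A B\<^esub> t) a \<boxtimes>\<^bsub>B\<^esub> ncmp (u \<cdot>\<^bsub>SMF A B\<^esub> t) b)"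
    by simp
next
  have "(ncmp u \<one>\<^bsub>A\<^esub> \<cdot>\<^bsub>B\<^esub> ncmp t \<one>\<^bsub>A\<^esub>) \<cdot>\<^bsub>B\<^esub> funi (nsrc t) = ncmp u \<one>\<^bsub>A\<^esub> \<cdot>\<^bsub>B\<^esub> funi (nsrc u)"
    by (simp add: ncmp_Unit)
  also have "\<dots> = funi (ntgt u)" by (rule ncmp_Unit) simp
  finally show "ncmp (u \<cdot>\<^bsub>SMF A B\<^esub> t) \<one>\<^bsub>A\<^esub> \<cdot>\<^bsub>B\<^esub> funi (nsrc (u \<cdot>\<^bsub>SMF A B\<^esub> t)) = funi (ntgt (u \<cdot>\<^bsub>SMF A B\<^esub> t))"
    by simp
qed simp_all

text \<open>Gives \<open>SMF\<close> the calculus of inverses of the locale \<open>category\<close>,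
  by which the inverse associators inside \<open>rebracket\<close> are computed.\<close>

lemma category_SMF: "category (SMF A B)"
proof
  show "Ident (SMF A B) F \<in> Hom (SMF A B) F F" if "F \<in> Obj (SMF A B)" for F
    using that Ident_SMF_Arr by (simp add: Hom_def)
  show "u \<cdot>\<^bsub>SMF A B\<^esub> t \<in> Hom (SMF A B) F H"
    if "t \<in> Hom (SMF A B) F G" "u \<in> Hom (SMF A B) G H" for t u F G H
    using that Comp_SMF_Arr[of t u] by (auto simp: Hom_def)
  show "t \<cdot>\<^bsub>SMF A B\<^esub> Ident (SMF A B) F = t" if "t \<in> Hom (SMF A B) F G" for t F G
    using that by (intro mnt_eqI) (auto simp: Hom_def ncmp_extensional)
  show "Ident (SMF A B) G \<cdot>\<^bsub>SMF A B\<^esub> t = t" if "t \<in> Hom (SMF A B) F G" for t F G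
    using that by (intro mnt_eqI) (auto simp: Hom_def ncmp_extensional)
  show "(v \<cdot>\<^bsub>SMF A B\<^esub> u) \<cdot>\<^bsub>SMF A B\<^esub> t = v \<cdot>\<^bsub>SMF A B\<^esub> (u \<cdot>\<^bsub>SMF A B\<^esub> t)"
    if "t \<in> Hom (SMF A B) F G" "u \<in> Hom (SMF A B) G H" "v \<in> Hom (SMF A B) H K" for t u v F G H K
    using that by (intro mnt_eqI) (auto simp: Hom_def)
qed simp_all

lemma TenA_SMF_Arr:
  assumes [simp]: "t \<in> Arr (SMF A B)" "u \<in> Arr (SMF A B)"
  shows "t \<boxtimes>\<^bsub>SMF A B\<^esub> u \<in> Arr (SMF A B)"
proof (rule Arr_SMF_I)
  fix a b assume [simp]: "a \<in> Obj A" "b \<in> Obj A"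
  show "ncmp (t \<boxtimes>\<^bsub>SMF A B\<^esub> u) (a \<otimes>\<^bsub>A\<^esub> b) \<cdot>\<^bsub>B\<^esub> fmul (nsrc (t \<boxtimes>\<^bsub>SMF A B\<^esub> u)) (a, b)
    = fmul (ntgt (t \<boxtimes>\<^bsub>SMF A B\<^esub> u)) (a, b) \<cdot>\<^bsub>B\<^esub> (ncmp (t \<boxtimes>\<^bsub>SMF A B\<^esub> u) a \<boxtimes>\<^bsub>B\<^esub> ncmp (t \<boxtimes>\<^bsub>SMF A B\<^esub> u) b)"
    by (simp add: ncmp_TenO B.interchange_nat)
qed (simp_all add: ncmp_nat ncmp_Unit)

lemma LUnit_SMF_Arr:
  assumes [simp]: "strong_monoidal_functor A B F" "normalized A F"
  shows "LUnit (SMF A B) F \<in> Arr (SMF A B)"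
proof (rule Arr_SMF_I)
  fix a b assume [simp]: "a \<in> Obj A" "b \<in> Obj A"
  have "LUnit B (fob F a \<otimes>\<^bsub>B\<^esub> fob F b) \<cdot>\<^bsub>B\<^esub> ((LUnit B \<one>\<^bsub>B\<^esub> \<boxtimes>\<^bsub>B\<^esub> Ident B (fob F a \<otimes>\<^bsub>B\<^esub> fob F b)) \<cdot>\<^bsub>B\<^esub>
      interchange B \<one>\<^bsub>B\<^esub> (fob F a) \<one>\<^bsub>B\<^esub> (fob F b))
    = LUnit B (fob F a) \<boxtimes>\<^bsub>B\<^esub> LUnit B (fob F b)"
    by (rule B.interchange_LUnit_dual) simp_all
  then have "fmul F (a, b) \<cdot>\<^bsub>B\<^esub> (LUnit B (fob F a) \<boxtimes>\<^bsub>B\<^esub> LUnit B (fob F b))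
    = fmul F (a, b) \<cdot>\<^bsub>B\<^esub> (LUnit B (fob F a \<otimes>\<^bsub>B\<^esub> fob F b) \<cdot>\<^bsub>B\<^esub>
      ((LUnit B \<one>\<^bsub>B\<^esub> \<boxtimes>\<^bsub>B\<^esub> Ident B (fob F a \<otimes>\<^bsub>B\<^esub> fob F b)) \<cdot>\<^bsub>B\<^esub> interchange B \<one>\<^bsub>B\<^esub> (fob F a) \<one>\<^bsub>B\<^esub> (fob F b)))"
    by (simp only:)
  also have "\<dots> = LUnit B (fob F (a \<otimes>\<^bsub>A\<^esub> b)) \<cdot>\<^bsub>B\<^esub> ((Ident B \<one>\<^bsub>B\<^esub> \<boxtimes>\<^bsub>B\<^esub> fmul F (a, b)) \<cdot>\<^bsub>B\<^esub>
      ((LUnit B \<one>\<^bsub>B\<^esub> \<boxtimes>\<^bsub>B\<^esub> Ident B (fob F a \<otimes>\<^bsub>B\<^esub> fob F b)) \<cdot>\<^bsub>B\<^esub> interchange B \<one>\<^bsub>B\<^esub> (fob F a) \<one>\<^bsub>B\<^esub> (fob F b)))"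
    by (subst B.Comp_reduce2[OF B.LUnit_nat]) simp_all
  finally show "ncmp (LUnit (SMF A B) F) (a \<otimes>\<^bsub>A\<^esub> b) \<cdot>\<^bsub>B\<^esub> fmul (nsrc (LUnit (SMF A B) F)) (a, b)
    = fmul (ntgt (LUnit (SMF A B) F)) (a, b) \<cdot>\<^bsub>B\<^esub> (ncmp (LUnit (SMF A B) F) a \<boxtimes>\<^bsub>B\<^esub> ncmp (LUnit (SMF A B) F) b)"
    by simp
next
  have "LUnit B (fob F \<one>\<^bsub>A\<^esub>) \<cdot>\<^bsub>B\<^esub> ((Ident B \<one>\<^bsub>B\<^esub> \<boxtimes>\<^bsub>B\<^esub> funi F) \<cdot>\<^bsub>B\<^esub> Inv B (LUnit B \<one>\<^bsub>B\<^esub>)) = funi F"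
    by (subst B.Comp_reduce2[OF B.LUnit_nat]) simp_all
  then show "ncmp (LUnit (SMF A B) F) \<one>\<^bsub>A\<^esub> \<cdot>\<^bsub>B\<^esub> funi (nsrc (LUnit (SMF A B) F)) = funi (ntgt (LUnit (SMF A B) F))"
    by simp
qed (simp_all add: B.LUnit_nat)

lemma RUnit_SMF_Arr:
  assumes [simp]: "strong_monoidal_functor A B F" "normalized A F"
  shows "RUnit (SMF A B) F \<in> Arr (SMF A B)"
proof (rule Arr_SMF_I)
  fix a b assume [simp]: "a \<in> Obj A" "b \<in> Obj A"
  have "RUnit B (fob F a \<otimes>\<^bsub>B\<^esub> fob F b) \<cdot>\<^bsub>B\<^esub> ((Ident B (fob F a \<otimes>\<^bsub>B\<^esub> fob F b) \<boxtimes>\<^bsub>B\<^esub> LUnit B \<one>\<^bsub>B\<^esub>) \<cdot>\<^bsub>B\<^esub>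
      interchange B (fob F a) \<one>\<^bsub>B\<^esub> (fob F b) \<one>\<^bsub>B\<^esub>)
    = RUnit B (fob F a) \<boxtimes>\<^bsub>B\<^esub> RUnit B (fob F b)"
    by (rule B.interchange_RUnit_dual) simp_all
  then have "fmul F (a, b) \<cdot>\<^bsub>B\<^esub> (RUnit B (fob F a) \<boxtimes>\<^bsub>B\<^esub> RUnit B (fob F b))
    = fmul F (a, b) \<cdot>\<^bsub>B\<^esub> (RUnit B (fob F a \<otimes>\<^bsub>B\<^esub> fob F b) \<cdot>\<^bsub>B\<^esub>
      ((Ident B (fob F a \<otimes>\<^bsub>B\<^esub> fob F b) \<boxtimes>\<^bsub>B\<^esub> LUnit B \<one>\<^bsub>B\<^esub>) \<cdot>\<^bsub>B\<^esub> interchange B (fob F a) \<one>\<^bsub>B\<^esub> (fob F b) \<one>\<^bsub>B\<^esub>))"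
    by (simp only:)
  also have "\<dots> = RUnit B (fob F (a \<otimes>\<^bsub>A\<^esub> b)) \<cdot>\<^bsub>B\<^esub> ((fmul F (a, b) \<boxtimes>\<^bsub>B\<^esub> Ident B \<one>\<^bsub>B\<^esub>) \<cdot>\<^bsub>B\<^esub>
      ((Ident B (fob F a \<otimes>\<^bsub>B\<^esub> fob F b) \<boxtimes>\<^bsub>B\<^esub> LUnit B \<one>\<^bsub>B\<^esub>) \<cdot>\<^bsub>B\<^esub> interchange B (fob F a) \<one>\<^bsub>B\<^esub> (fob F b) \<one>\<^bsub>B\<^esub>))"
    by (subst B.Comp_reduce2[OF B.RUnit_nat]) simp_all
  finally show "ncmp (RUnit (SMF A B) F) (a \<otimes>\<^bsub>A\<^esub> b) \<cdot>\<^bsub>B\<^esub> fmul (nsrc (RUnit (SMF A B) F)) (a, b)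
    = fmul (ntgt (RUnit (SMF A B) F)) (a, b) \<cdot>\<^bsub>B\<^esub> (ncmp (RUnit (SMF A B) F) a \<boxtimes>\<^bsub>B\<^esub> ncmp (RUnit (SMF A B) F) b)"
    by simp
next
  have "RUnit B (fob F \<one>\<^bsub>A\<^esub>) \<cdot>\<^bsub>B\<^esub> ((funi F \<boxtimes>\<^bsub>B\<^esub> Ident B \<one>\<^bsub>B\<^esub>) \<cdot>\<^bsub>B\<^esub> Inv B (LUnit B \<one>\<^bsub>B\<^esub>)) = funi F"
    by (subst B.Comp_reduce2[OF B.RUnit_nat]) (simp_all flip: B.LUnit_Unit)
  then show "ncmp (RUnit (SMF A B) F) \<one>\<^bsub>A\<^esub> \<cdot>\<^bsub>B\<^esub> funi (nsrc (RUnit (SMF A B) F)) = funi (ntgt (RUnit (SMF A B) F))"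
    by simp
qed (simp_all add: B.RUnit_nat)

text \<open>The strongators of F, G, H pass through the associator by naturality; what remains is
  \<open>interchange_Assoc_dual\<close>.\<close>

lemma Assoc_SMF_Arr:
  assumes [simp]: "strong_monoidal_functor A B F" "strong_monoidal_functor A B G" "strong_monoidal_functor A B H"
  shows "Assoc (SMF A B) F G H \<in> Arr (SMF A B)" (is "?t \<in> _")
proof (rule Arr_SMF_I)
  fix a b assume [simp]: "a \<in> Obj A" "b \<in> Obj A"
  let ?Aa = "Assoc B (fob F a) (fob G a) (fob H a)" and ?Ab = "Assoc B (fob F b) (fob G b) (fob H b)"
  have "ncmp ?t (a \<otimes>\<^bsub>A\<^esub> b) \<cdot>\<^bsub>B\<^esub> fmul (nsrc ?t) (a, b)
    = Assoc B (fob F (a \<otimes>\<^bsub>A\<^esub> b)) (fob G (a \<otimes>\<^bsub>A\<^esub> b)) (fob H (a \<otimes>\<^bsub>A\<^esub> b)) \<cdot>\<^bsub>B\<^esub>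
     (((fmul F (a, b) \<boxtimes>\<^bsub>B\<^esub> fmul G (a, b)) \<boxtimes>\<^bsub>B\<^esub> fmul H (a, b)) \<cdot>\<^bsub>B\<^esub>
      ((interchange B (fob F a) (fob G a) (fob F b) (fob G b) \<boxtimes>\<^bsub>B\<^esub> Ident B (fob H a \<otimes>\<^bsub>B\<^esub> fob H b)) \<cdot>\<^bsub>B\<^esub>
      interchange B (fob F a \<otimes>\<^bsub>B\<^esub> fob G a) (fob H a) (fob F b \<otimes>\<^bsub>B\<^esub> fob G b) (fob H b)))"
    by simp
  also have "\<dots> = (fmul F (a, b) \<boxtimes>\<^bsub>B\<^esub> (fmul G (a, b) \<boxtimes>\<^bsub>B\<^esub> fmul H (a, b))) \<cdot>\<^bsub>B\<^esub>
     (Assoc B (fob F a \<otimes>\<^bsub>B\<^esub> fob F b) (fob G a \<otimes>\<^bsub>B\<^esub> fob G b) (fob H a \<otimes>\<^bsub>B\<^esub> fob H b) \<cdot>\<^bsub>B\<^esub>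
      ((interchange B (fob F a) (fob G a) (fob F b) (fob G b) \<boxtimes>\<^bsub>B\<^esub> Ident B (fob H a \<otimes>\<^bsub>B\<^esub> fob H b)) \<cdot>\<^bsub>B\<^esub>
      interchange B (fob F a \<otimes>\<^bsub>B\<^esub> fob G a) (fob H a) (fob F b \<otimes>\<^bsub>B\<^esub> fob G b) (fob H b)))"
    by (subst B.Assoc_nat') simp_all
  also have "\<dots> = fmul (ntgt ?t) (a, b) \<cdot>\<^bsub>B\<^esub> (ncmp ?t a \<boxtimes>\<^bsub>B\<^esub> ncmp ?t b)"
    by (subst B.interchange_Assoc_dual) simp_all
  finally show "ncmp ?t (a \<otimes>\<^bsub>A\<^esub> b) \<cdot>\<^bsub>B\<^esub> fmul (nsrc ?t) (a, b) = fmul (ntgt ?t) (a, b) \<cdot>\<^bsub>B\<^esub> (ncmp ?t a \<boxtimes>\<^bsub>B\<^esub> ncmp ?t b)" .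
next
  have "Assoc B (fob F \<one>\<^bsub>A\<^esub>) (fob G \<one>\<^bsub>A\<^esub>) (fob H \<one>\<^bsub>A\<^esub>) \<cdot>\<^bsub>B\<^esub>
      (((funi F \<boxtimes>\<^bsub>B\<^esub> funi G) \<boxtimes>\<^bsub>B\<^esub> funi H) \<cdot>\<^bsub>B\<^esub> ((Inv B (LUnit B \<one>\<^bsub>B\<^esub>) \<boxtimes>\<^bsub>B\<^esub> Ident B \<one>\<^bsub>B\<^esub>) \<cdot>\<^bsub>B\<^esub> Inv B (LUnit B \<one>\<^bsub>B\<^esub>)))
    = (funi F \<boxtimes>\<^bsub>B\<^esub> (funi G \<boxtimes>\<^bsub>B\<^esub> funi H)) \<cdot>\<^bsub>B\<^esub> (Assoc B \<one>\<^bsub>B\<^esub> \<one>\<^bsub>B\<^esub> \<one>\<^bsub>B\<^esub> \<cdot>\<^bsub>B\<^esub>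
      ((Inv B (LUnit B \<one>\<^bsub>B\<^esub>) \<boxtimes>\<^bsub>B\<^esub> Ident B \<one>\<^bsub>B\<^esub>) \<cdot>\<^bsub>B\<^esub> Inv B (LUnit B \<one>\<^bsub>B\<^esub>)))"
    by (subst B.Assoc_nat') simp_all
  \<comment> \<open>The two ways of splitting the unit into three units agree, by the triangle at I,
    I and \<open>LUnit_Unit\<close>.\<close>
  also have "Assoc B \<one>\<^bsub>B\<^esub> \<one>\<^bsub>B\<^esub> \<one>\<^bsub>B\<^esub> \<cdot>\<^bsub>B\<^esub> ((Inv B (LUnit B \<one>\<^bsub>B\<^esub>) \<boxtimes>\<^bsub>B\<^esub> Ident B \<one>\<^bsub>B\<^esub>) \<cdot>\<^bsub>B\<^esub> Inv B (LUnit B \<one>\<^bsub>B\<^esub>))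
    = (Ident B \<one>\<^bsub>B\<^esub> \<boxtimes>\<^bsub>B\<^esub> Inv B (LUnit B \<one>\<^bsub>B\<^esub>)) \<cdot>\<^bsub>B\<^esub> Inv B (LUnit B \<one>\<^bsub>B\<^esub>)"
  proof -
    have "(Ident B \<one>\<^bsub>B\<^esub> \<boxtimes>\<^bsub>B\<^esub> LUnit B \<one>\<^bsub>B\<^esub>) \<cdot>\<^bsub>B\<^esub> (Assoc B \<one>\<^bsub>B\<^esub> \<one>\<^bsub>B\<^esub> \<one>\<^bsub>B\<^esub> \<cdot>\<^bsub>B\<^esub>
        ((Inv B (LUnit B \<one>\<^bsub>B\<^esub>) \<boxtimes>\<^bsub>B\<^esub> Ident B \<one>\<^bsub>B\<^esub>) \<cdot>\<^bsub>B\<^esub> Inv B (LUnit B \<one>\<^bsub>B\<^esub>))) = Inv B (LUnit B \<one>\<^bsub>B\<^esub>)"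
      by (subst B.triangle_reduce) (simp_all flip: B.LUnit_Unit)
    also have "\<dots> = (Ident B \<one>\<^bsub>B\<^esub> \<boxtimes>\<^bsub>B\<^esub> LUnit B \<one>\<^bsub>B\<^esub>) \<cdot>\<^bsub>B\<^esub>
        ((Ident B \<one>\<^bsub>B\<^esub> \<boxtimes>\<^bsub>B\<^esub> Inv B (LUnit B \<one>\<^bsub>B\<^esub>)) \<cdot>\<^bsub>B\<^esub> Inv B (LUnit B \<one>\<^bsub>B\<^esub>))"
      by simp
    finally show ?thesis by (rule B.iso_mono) simp_all
  qed
  finally show "ncmp ?t \<one>\<^bsub>A\<^esub> \<cdot>\<^bsub>B\<^esub> funi (nsrc ?t) = funi (ntgt ?t)" by simp
qed (simp_all add: B.Assoc_nat)

text \<open>Naturality and monoidality squares whose vertical sides are invertible can be read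
  backwards, so pointwise inverses again form a monoidal transformation.\<close>

lemma inverse_arrows_SMF:
  assumes [simp]: "t \<in> Arr (SMF A B)" and iso: "\<And>a. a \<in> Obj A \<Longrightarrow> is_iso B (ncmp t a)"
  shows "inverse_arrows (SMF A B) t \<lparr> nsrc = ntgt t, ntgt = nsrc t, ncmp = (\<lambda>a\<in>Obj A. Inv B (ncmp t a)) \<rparr>"
    (is "inverse_arrows _ t ?u")
proof -
  note [simp] = iso
  have "?u \<in> Arr (SMF A B)"
  proof (rule Arr_SMF_I)
    fix f assume [simp]: "f \<in> Arr A"
    have "ncmp t (Cod A f) \<cdot>\<^bsub>B\<^esub> (Inv B (ncmp t (Cod A f)) \<cdot>\<^bsub>B\<^esub> far (ntgt t) f)
      = (far (ntgt t) f \<cdot>\<^bsub>B\<^esub> ncmp t (Dom A f)) \<cdot>\<^bsub>B\<^esub> Inv B (ncmp t (Dom A f))"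
      by simp
    also have "\<dots> = ncmp t (Cod A f) \<cdot>\<^bsub>B\<^esub> (far (nsrc t) f \<cdot>\<^bsub>B\<^esub> Inv B (ncmp t (Dom A f)))"
      by (simp flip: ncmp_nat)
    finally have "Inv B (ncmp t (Cod A f)) \<cdot>\<^bsub>B\<^esub> far (ntgt t) f = far (nsrc t) f \<cdot>\<^bsub>B\<^esub> Inv B (ncmp t (Dom A f))"
      by (rule B.iso_mono) simp_all
    then show "ncmp ?u (Cod A f) \<cdot>\<^bsub>B\<^esub> far (nsrc ?u) f = far (ntgt ?u) f \<cdot>\<^bsub>B\<^esub> ncmp ?u (Dom A f)" by simp
  next
    fix a b assume [simp]: "a \<in> Obj A" "b \<in> Obj A"
    have "ncmp t (a \<otimes>\<^bsub>A\<^esub> b) \<cdot>\<^bsub>B\<^esub> (Inv B (ncmp t (a \<otimes>\<^bsub>A\<^esub> b)) \<cdot>\<^bsub>B\<^esub> fmul (ntgt t) (a, b))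
      = (fmul (ntgt t) (a, b) \<cdot>\<^bsub>B\<^esub> (ncmp t a \<boxtimes>\<^bsub>B\<^esub> ncmp t b)) \<cdot>\<^bsub>B\<^esub> (Inv B (ncmp t a) \<boxtimes>\<^bsub>B\<^esub> Inv B (ncmp t b))"
      by simp
    also have "\<dots> = ncmp t (a \<otimes>\<^bsub>A\<^esub> b) \<cdot>\<^bsub>B\<^esub> (fmul (nsrc t) (a, b) \<cdot>\<^bsub>B\<^esub> (Inv B (ncmp t a) \<boxtimes>\<^bsub>B\<^esub> Inv B (ncmp t b)))"
      by (simp flip: ncmp_TenO)
    finally have "Inv B (ncmp t (a \<otimes>\<^bsub>A\<^esub> b)) \<cdot>\<^bsub>B\<^esub> fmul (ntgt t) (a, b)
      = fmul (nsrc t) (a, b) \<cdot>\<^bsub>B\<^esub> (Inv B (ncmp t a) \<boxtimes>\<^bsub>B\<^esub> Inv B (ncmp t b))"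
      by (rule B.iso_mono) simp_all
    then show "ncmp ?u (a \<otimes>\<^bsub>A\<^esub> b) \<cdot>\<^bsub>B\<^esub> fmul (nsrc ?u) (a, b) = fmul (ntgt ?u) (a, b) \<cdot>\<^bsub>B\<^esub> (ncmp ?u a \<boxtimes>\<^bsub>B\<^esub> ncmp ?u b)"
      by simp
  next
    have "Inv B (ncmp t \<one>\<^bsub>A\<^esub>) \<cdot>\<^bsub>B\<^esub> funi (ntgt t) = funi (nsrc t)" by (simp flip: ncmp_Unit)
    then show "ncmp ?u \<one>\<^bsub>A\<^esub> \<cdot>\<^bsub>B\<^esub> funi (nsrc ?u) = funi (ntgt ?u)" by simp
  qed simp_all
  then show ?thesis
    by (intro category.inverse_arrowsI[OF category_SMF]) (auto intro!: mnt_eqI)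
qed

lemma Inv_SMF:
  assumes "t \<in> Arr (SMF A B)" and "\<And>a. a \<in> Obj A \<Longrightarrow> is_iso B (ncmp t a)"
  shows "Inv (SMF A B) t = \<lparr> nsrc = ntgt t, ntgt = nsrc t, ncmp = (\<lambda>a\<in>Obj A. Inv B (ncmp t a)) \<rparr>"
    and "is_iso (SMF A B) t"
    and "Inv (SMF A B) t \<in> Arr (SMF A B)"
proof -
  show "Inv (SMF A B) t = \<lparr> nsrc = ntgt t, ntgt = nsrc t, ncmp = (\<lambda>a\<in>Obj A. Inv B (ncmp t a)) \<rparr>"
    using inverse_arrows_SMF[OF assms] category.Inv_eqI[OF category_SMF] by blast
  show "is_iso (SMF A B) t"
    using inverse_arrows_SMF[OF assms] by (auto simp: is_iso_def)
  then show "Inv (SMF A B) t \<in> Arr (SMF A B)"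
    by (rule category.Arr_Inv[OF category_SMF])
qed

end


section \<open>Tensor powers of a functor\<close>

context smc_pair
begin

lemma strong_normalized_TPow:
  assumes "strong_monoidal_functor A B F" "normalized A F"
  shows "strong_monoidal_functor A B (TPow (SMF A B) F n) \<and> normalized A (TPow (SMF A B) F n)"
proof (induction n)
  case (Suc n)
  then show ?case using assms by (cases n) simp_all
qed simp

lemma strong_TPow [simp]:
    "\<lbrakk>strong_monoidal_functor A B F; normalized A F\<rbrakk> \<Longrightarrow> strong_monoidal_functor A B (TPow (SMF A B) F n)"
  and normalized_TPow [simp]:
    "\<lbrakk>strong_monoidal_functor A B F; normalized A F\<rbrakk> \<Longrightarrow> normalized A (TPow (SMF A B) F n)"
  using strong_normalized_TPow by blast+

lemma fob_TPow [simp]: "a \<in> Obj A \<Longrightarrow> fob (TPow (SMF A B) F n) a = TPow B (fob F a) n"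
proof (induction n)
  case (Suc n)
  then show ?case by (cases n) simp_all
qed simp

lemma far_TPow [simp]: "f \<in> Arr A \<Longrightarrow> far (TPow (SMF A B) F n) f = TPowA B (far F f) n"
proof (induction n)
  case (Suc n)
  then show ?case by (cases n) simp_all
qed simp

text \<open>Each further factor enters both recursions through the same \<open>interchange\<close>,
  so \<open>shuffle\<close> is matched syntactically and no coherence argument is involved. The
  induction starts from identity strongators, as inclusions have.\<close>

lemma fmul_TPow:
  assumes "a \<in> Obj A" "b \<in> Obj A" "fmul F (a, b) = Ident B (fob F a \<otimes>\<^bsub>B\<^esub> fob F b)"
  shows "fmul (TPow (SMF A B) F n) (a, b) = shuffle B (fob F a) (fob F b) n"
proof (induction n)
  case (Suc n)
  then show ?case using assms by (cases n) simp_all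
qed (use assms in simp)

lemma funi_TPow: "funi F = Ident B \<one>\<^bsub>B\<^esub> \<Longrightarrow> funi (TPow (SMF A B) F n) = unit_shuffle B n"
proof (induction n)
  case (Suc n)
  then show ?case by (cases n) simp_all
qed simp

text \<open>Value and membership are proved together: computing the composite in the recursion needs
  the value of the previous stage, and its being an arrow needs the previous membership. The
  exponent \<open>Suc m\<close> selects the clauses of \<open>rebracket\<close> that recurse on
  n.\<close>

lemma rebracket_SMF_Suc:
  assumes [simp]: "strong_monoidal_functor A B F" "normalized A F"
  shows "rebracket (SMF A B) F (Suc m) n =
      \<lparr> nsrc = tensor_functors A B (TPow (SMF A B) F (Suc m)) (TPow (SMF A B) F n),
        ntgt = TPow (SMF A B) F (Suc m + n),
        ncmp = (\<lambda>a\<in>Obj A. rebracket B (fob F a) (Suc m) n) \<rparr>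
    \<and> rebracket (SMF A B) F (Suc m) n \<in> Arr (SMF A B)"
proof (induction n)
  case 0
  have "RUnit (SMF A B) (TPow (SMF A B) F (Suc m)) \<in> Arr (SMF A B)" by (rule RUnit_SMF_Arr) simp_all
  then show ?case by (auto intro!: restrict_ext simp del: TPow.simps(2,3))
next
  case (Suc n)
  \<comment> \<open>Exponent 1 is a second base case of \<open>rebracket\<close>, because
    \<open>TPow\<close> at 1 is the object itself and not a product with the unit.\<close>
  show ?case
  proof (cases n)
    case 0
    have "Ident (SMF A B) (TPow (SMF A B) F (Suc (Suc m))) \<in> Arr (SMF A B)"
      by (rule Ident_SMF_Arr) (simp_all only: strong_TPow normalized_TPow assms)
    then show ?thesis using 0 by (auto intro!: restrict_ext)
  next
    case (Suc k)
    let ?G = "TPow (SMF A B) F (Suc m)" and ?H = "TPow (SMF A B) F (Suc k)"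
    let ?r = "rebracket (SMF A B) F (Suc m) (Suc k)"
    note IH = conjunct1[OF Suc.IH[unfolded \<open>n = Suc k\<close>]] and r = conjunct2[OF Suc.IH[unfolded \<open>n = Suc k\<close>]]
    have A: "Assoc (SMF A B) ?G ?H F \<in> Arr (SMF A B)"
      by (rule Assoc_SMF_Arr) (simp_all only: strong_TPow normalized_TPow assms)
    have iso: "is_iso B (ncmp (Assoc (SMF A B) ?G ?H F) a)" if "a \<in> Obj A" for a
      using that fob_Obj[OF strong_TPow[OF assms]]
      by (simp del: TPow.simps fob_TPow)
    \<comment> \<open>\<open>Inv\<close> is a definite description. Its pointwise value becomes
      available because the associator is already known to be an arrow of \<open>SMF\<close> with
      invertible components.\<close>
    define J where "J = Inv (SMF A B) (Assoc (SMF A B) ?G ?H F)"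
    have J: "J = \<lparr> nsrc = tensor_functors A B ?G (tensor_functors A B ?H F),
          ntgt = tensor_functors A B (tensor_functors A B ?G ?H) F,
          ncmp = (\<lambda>a\<in>Obj A. Inv B (Assoc B (fob ?G a) (fob ?H a) (fob F a))) \<rparr>"
      unfolding J_def using Inv_SMF(1)[OF A] iso by (auto intro!: restrict_ext simp del: TPow.simps fob_TPow)
    have J': "J \<in> Arr (SMF A B)"
      unfolding J_def by (rule Inv_SMF(3)[OF A]) (rule iso)
    have T: "?r \<boxtimes>\<^bsub>SMF A B\<^esub> Ident (SMF A B) F \<in> Arr (SMF A B)"
      using r by (intro TenA_SMF_Arr Ident_SMF_Arr assms)
    have step: "rebracket (SMF A B) F (Suc m) (Suc n) = (?r \<boxtimes>\<^bsub>SMF A B\<^esub> Ident (SMF A B) F) \<cdot>\<^bsub>SMF A B\<^esub> J"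
      by (simp only: \<open>n = Suc k\<close> rebracket.simps J_def)
    have n: "nsrc (?r \<boxtimes>\<^bsub>SMF A B\<^esub> Ident (SMF A B) F) = ntgt J"
      by (subst IH) (simp add: J)
    have "(?r \<boxtimes>\<^bsub>SMF A B\<^esub> Ident (SMF A B) F) \<cdot>\<^bsub>SMF A B\<^esub> J
      = \<lparr> nsrc = tensor_functors A B ?G (TPow (SMF A B) F (Suc n)), ntgt = TPow (SMF A B) F (Suc m + Suc n),
        ncmp = (\<lambda>a\<in>Obj A. rebracket B (fob F a) (Suc m) (Suc n)) \<rparr>"
      by (subst IH) (auto simp: J \<open>n = Suc k\<close> intro!: restrict_ext)
    then show ?thesis
      using Comp_SMF_Arr[OF J' T n] step by (simp only: simp_thms)
  qed
qed

lemma
  assumes [simp]: "strong_monoidal_functor A B F" "normalized A F"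
  shows rebracket_SMF: "rebracket (SMF A B) F m n =
      \<lparr> nsrc = tensor_functors A B (TPow (SMF A B) F m) (TPow (SMF A B) F n),
        ntgt = TPow (SMF A B) F (m + n),
        ncmp = (\<lambda>a\<in>Obj A. rebracket B (fob F a) m n) \<rparr>"
    and rebracket_SMF_Arr: "rebracket (SMF A B) F m n \<in> Arr (SMF A B)"
  \<comment> \<open>At m = 0 the map is a left unitor; for positive m the instance at
    \<open>m - 1\<close> is the claim at m.\<close>
  using rebracket_SMF_Suc[OF assms, of "m - 1" n] LUnit_SMF_Arr[of "TPow (SMF A B) F n"]
  by (cases m; simp cong: restrict_cong)+

end

section \<open>Arrows at which a monoidal family is natural\<close>

locale monoidal_family = smc_pair +
  fixes G H and t
  assumes G [simp]: "strong_monoidal_functor A B G" and H [simp]: "strong_monoidal_functor A B H"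
    and Arr_t [simp]: "a \<in> Obj A \<Longrightarrow> t a \<in> Arr B"
    and Dom_t [simp]: "a \<in> Obj A \<Longrightarrow> Dom B (t a) = fob G a"
    and Cod_t [simp]: "a \<in> Obj A \<Longrightarrow> Cod B (t a) = fob H a"
    and t_TenO: "\<lbrakk>a \<in> Obj A; b \<in> Obj A\<rbrakk>
      \<Longrightarrow> t (a \<otimes>\<^bsub>A\<^esub> b) \<cdot>\<^bsub>B\<^esub> fmul G (a, b) = fmul H (a, b) \<cdot>\<^bsub>B\<^esub> (t a \<boxtimes>\<^bsub>B\<^esub> t b)"
    and t_Unit: "t \<one>\<^bsub>A\<^esub> \<cdot>\<^bsub>B\<^esub> funi G = funi H"
begin

text \<open>The locale asks the family to respect strongators but not to be natural. For c \<mapsto>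
  s_c(\<mu>) this predicate is the homomorphism equation for the single arrow \<mu>.\<close>

definition natural_at :: "'b \<Rightarrow> bool" where
  "natural_at f \<longleftrightarrow> f \<in> Arr A \<and> t (Cod A f) \<cdot>\<^bsub>B\<^esub> far G f = far H f \<cdot>\<^bsub>B\<^esub> t (Dom A f)"

lemma t_TenO_reduce:
  assumes "a \<in> Obj A" "b \<in> Obj A" "h \<in> Arr B" "Cod B h = fob G a \<otimes>\<^bsub>B\<^esub> fob G b"
  shows "t (a \<otimes>\<^bsub>A\<^esub> b) \<cdot>\<^bsub>B\<^esub> (fmul G (a, b) \<cdot>\<^bsub>B\<^esub> h) = fmul H (a, b) \<cdot>\<^bsub>B\<^esub> ((t a \<boxtimes>\<^bsub>B\<^esub> t b) \<cdot>\<^bsub>B\<^esub> h)"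
  using assms by (intro B.Comp_reduce2[OF t_TenO]) auto

lemma natural_at_Ident: "a \<in> Obj A \<Longrightarrow> natural_at (Ident A a)"
  by (simp add: natural_at_def)

lemma natural_at_Comp:
  assumes "natural_at f" "natural_at g" "Dom A g = Cod A f"
  shows "natural_at (g \<cdot>\<^bsub>A\<^esub> f)"
proof -
  note [simp] = assms(3)
  have [simp]: "f \<in> Arr A" "g \<in> Arr A"
    and f: "t (Cod A f) \<cdot>\<^bsub>B\<^esub> far G f = far H f \<cdot>\<^bsub>B\<^esub> t (Dom A f)"
    and g: "t (Cod A g) \<cdot>\<^bsub>B\<^esub> far G g = far H g \<cdot>\<^bsub>B\<^esub> t (Cod A f)"
    using assms by (auto simp: natural_at_def)
  have "t (Cod A g) \<cdot>\<^bsub>B\<^esub> (far G g \<cdot>\<^bsub>B\<^esub> far G f) = far H g \<cdot>\<^bsub>B\<^esub> (t (Cod A f) \<cdot>\<^bsub>B\<^esub> far G f)"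
    by (rule B.Comp_reduce2[OF g]) simp_all
  also have "\<dots> = far H g \<cdot>\<^bsub>B\<^esub> (far H f \<cdot>\<^bsub>B\<^esub> t (Dom A f))" by (simp only: f)
  finally show ?thesis by (simp add: natural_at_def far_Comp)
qed

text \<open>Precomposed with the strongator of G, the square for the tensor splits into the squares
  for f and g; the strongator is invertible and cancels.\<close>

lemma natural_at_TenA:
  assumes "natural_at f" "natural_at g"
  shows "natural_at (f \<boxtimes>\<^bsub>A\<^esub> g)"
proof -
  have [simp]: "f \<in> Arr A" "g \<in> Arr A"
    and f: "t (Cod A f) \<cdot>\<^bsub>B\<^esub> far G f = far H f \<cdot>\<^bsub>B\<^esub> t (Dom A f)"
    and g: "t (Cod A g) \<cdot>\<^bsub>B\<^esub> far G g = far H g \<cdot>\<^bsub>B\<^esub> t (Dom A g)"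
    using assms by (auto simp: natural_at_def)
  let ?c = "Cod A f" and ?d = "Cod A g" and ?a = "Dom A f" and ?b = "Dom A g"
  have "(t (?c \<otimes>\<^bsub>A\<^esub> ?d) \<cdot>\<^bsub>B\<^esub> far G (f \<boxtimes>\<^bsub>A\<^esub> g)) \<cdot>\<^bsub>B\<^esub> fmul G (?a, ?b)
    = t (?c \<otimes>\<^bsub>A\<^esub> ?d) \<cdot>\<^bsub>B\<^esub> (fmul G (?c, ?d) \<cdot>\<^bsub>B\<^esub> (far G f \<boxtimes>\<^bsub>B\<^esub> far G g))"
    by (simp add: fmul_nat)
  also have "\<dots> = fmul H (?c, ?d) \<cdot>\<^bsub>B\<^esub> ((far H f \<boxtimes>\<^bsub>B\<^esub> far H g) \<cdot>\<^bsub>B\<^esub> (t ?a \<boxtimes>\<^bsub>B\<^esub> t ?b))"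
    by (simp add: t_TenO_reduce f g)
  also have "\<dots> = far H (f \<boxtimes>\<^bsub>A\<^esub> g) \<cdot>\<^bsub>B\<^esub> (fmul H (?a, ?b) \<cdot>\<^bsub>B\<^esub> (t ?a \<boxtimes>\<^bsub>B\<^esub> t ?b))"
    by (rule B.Comp_reduce2[OF fmul_nat]) simp_all
  also have "\<dots> = (far H (f \<boxtimes>\<^bsub>A\<^esub> g) \<cdot>\<^bsub>B\<^esub> t (?a \<otimes>\<^bsub>A\<^esub> ?b)) \<cdot>\<^bsub>B\<^esub> fmul G (?a, ?b)"
    by (simp add: t_TenO)
  finally have "t (?c \<otimes>\<^bsub>A\<^esub> ?d) \<cdot>\<^bsub>B\<^esub> far G (f \<boxtimes>\<^bsub>A\<^esub> g) = far H (f \<boxtimes>\<^bsub>A\<^esub> g) \<cdot>\<^bsub>B\<^esub> t (?a \<otimes>\<^bsub>A\<^esub> ?b)"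
    by (rule B.iso_epi) simp_all
  then show ?thesis by (simp add: natural_at_def)
qed

text \<open>The associativity laws of G and H express their images of the associator through
  strongators and the associator of B. The family passes the former by monoidality and the latter by
  naturality in B. Unitors and braidings follow the same pattern.\<close>

lemma natural_at_Assoc:
  assumes [simp]: "a \<in> Obj A" "b \<in> Obj A" "c \<in> Obj A"
  shows "natural_at (Assoc A a b c)"
proof -
  let ?i = "fmul G (a \<otimes>\<^bsub>A\<^esub> b, c) \<cdot>\<^bsub>B\<^esub> (fmul G (a, b) \<boxtimes>\<^bsub>B\<^esub> Ident B (fob G c))"
  have "(t (a \<otimes>\<^bsub>A\<^esub> (b \<otimes>\<^bsub>A\<^esub> c)) \<cdot>\<^bsub>B\<^esub> far G (Assoc A a b c)) \<cdot>\<^bsub>B\<^esub> ?i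
    = fmul H (a, b \<otimes>\<^bsub>A\<^esub> c) \<cdot>\<^bsub>B\<^esub> ((t a \<boxtimes>\<^bsub>B\<^esub> t (b \<otimes>\<^bsub>A\<^esub> c)) \<cdot>\<^bsub>B\<^esub> ((Ident B (fob G a) \<boxtimes>\<^bsub>B\<^esub> fmul G (b, c)) \<cdot>\<^bsub>B\<^esub>
      Assoc B (fob G a) (fob G b) (fob G c)))"
    by (simp add: fmul_Assoc t_TenO_reduce)
  also have "\<dots> = fmul H (a, b \<otimes>\<^bsub>A\<^esub> c) \<cdot>\<^bsub>B\<^esub> ((Ident B (fob H a) \<boxtimes>\<^bsub>B\<^esub> fmul H (b, c)) \<cdot>\<^bsub>B\<^esub>
      ((t a \<boxtimes>\<^bsub>B\<^esub> (t b \<boxtimes>\<^bsub>B\<^esub> t c)) \<cdot>\<^bsub>B\<^esub> Assoc B (fob G a) (fob G b) (fob G c)))"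
    by (simp add: t_TenO)
  also have "\<dots> = (fmul H (a, b \<otimes>\<^bsub>A\<^esub> c) \<cdot>\<^bsub>B\<^esub> ((Ident B (fob H a) \<boxtimes>\<^bsub>B\<^esub> fmul H (b, c)) \<cdot>\<^bsub>B\<^esub>
      Assoc B (fob H a) (fob H b) (fob H c))) \<cdot>\<^bsub>B\<^esub> ((t a \<boxtimes>\<^bsub>B\<^esub> t b) \<boxtimes>\<^bsub>B\<^esub> t c)"
    by (simp add: B.Assoc_nat)
  also have "\<dots> = far H (Assoc A a b c) \<cdot>\<^bsub>B\<^esub> (fmul H (a \<otimes>\<^bsub>A\<^esub> b, c) \<cdot>\<^bsub>B\<^esub> ((t (a \<otimes>\<^bsub>A\<^esub> b) \<boxtimes>\<^bsub>B\<^esub> t c) \<cdot>\<^bsub>B\<^esub>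
      (fmul G (a, b) \<boxtimes>\<^bsub>B\<^esub> Ident B (fob G c))))"
    by (simp flip: fmul_Assoc add: t_TenO)
  also have "\<dots> = (far H (Assoc A a b c) \<cdot>\<^bsub>B\<^esub> t (a \<otimes>\<^bsub>A\<^esub> b \<otimes>\<^bsub>A\<^esub> c)) \<cdot>\<^bsub>B\<^esub> ?i"
    by (simp add: t_TenO_reduce)
  finally have "t (a \<otimes>\<^bsub>A\<^esub> (b \<otimes>\<^bsub>A\<^esub> c)) \<cdot>\<^bsub>B\<^esub> far G (Assoc A a b c)
    = far H (Assoc A a b c) \<cdot>\<^bsub>B\<^esub> t (a \<otimes>\<^bsub>A\<^esub> b \<otimes>\<^bsub>A\<^esub> c)"
    by (rule B.iso_epi) simp_all
  then show ?thesis by (simp add: natural_at_def)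
qed

text \<open>Here \<open>t_Unit\<close> trades the unit strongator of H for that of G.\<close>

lemma natural_at_LUnit:
  assumes [simp]: "a \<in> Obj A"
  shows "natural_at (LUnit A a)"
proof -
  let ?i = "fmul G (\<one>\<^bsub>A\<^esub>, a) \<cdot>\<^bsub>B\<^esub> (funi G \<boxtimes>\<^bsub>B\<^esub> Ident B (fob G a))"
  have "(t a \<cdot>\<^bsub>B\<^esub> far G (LUnit A a)) \<cdot>\<^bsub>B\<^esub> ?i = LUnit B (fob H a) \<cdot>\<^bsub>B\<^esub> (Ident B \<one>\<^bsub>B\<^esub> \<boxtimes>\<^bsub>B\<^esub> t a)"
    by (simp add: fmul_LUnit B.LUnit_nat)
  also have "\<dots> = far H (LUnit A a) \<cdot>\<^bsub>B\<^esub> (fmul H (\<one>\<^bsub>A\<^esub>, a) \<cdot>\<^bsub>B\<^esub> (funi H \<boxtimes>\<^bsub>B\<^esub> t a))"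
    by (simp flip: fmul_LUnit)
  also have "\<dots> = far H (LUnit A a) \<cdot>\<^bsub>B\<^esub> (fmul H (\<one>\<^bsub>A\<^esub>, a) \<cdot>\<^bsub>B\<^esub> ((t \<one>\<^bsub>A\<^esub> \<boxtimes>\<^bsub>B\<^esub> t a) \<cdot>\<^bsub>B\<^esub>
      (funi G \<boxtimes>\<^bsub>B\<^esub> Ident B (fob G a))))"
    by (simp add: t_Unit)
  also have "\<dots> = (far H (LUnit A a) \<cdot>\<^bsub>B\<^esub> t (\<one>\<^bsub>A\<^esub> \<otimes>\<^bsub>A\<^esub> a)) \<cdot>\<^bsub>B\<^esub> ?i"
    by (simp add: t_TenO_reduce)
  finally have "t a \<cdot>\<^bsub>B\<^esub> far G (LUnit A a) = far H (LUnit A a) \<cdot>\<^bsub>B\<^esub> t (\<one>\<^bsub>A\<^esub> \<otimes>\<^bsub>A\<^esub> a)"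
    by (rule B.iso_epi) simp_all
  then show ?thesis by (simp add: natural_at_def)
qed

lemma natural_at_RUnit:
  assumes [simp]: "a \<in> Obj A"
  shows "natural_at (RUnit A a)"
proof -
  let ?i = "fmul G (a, \<one>\<^bsub>A\<^esub>) \<cdot>\<^bsub>B\<^esub> (Ident B (fob G a) \<boxtimes>\<^bsub>B\<^esub> funi G)"
  have "(t a \<cdot>\<^bsub>B\<^esub> far G (RUnit A a)) \<cdot>\<^bsub>B\<^esub> ?i = RUnit B (fob H a) \<cdot>\<^bsub>B\<^esub> (t a \<boxtimes>\<^bsub>B\<^esub> Ident B \<one>\<^bsub>B\<^esub>)"
    by (simp add: fmul_RUnit B.RUnit_nat)
  also have "\<dots> = far H (RUnit A a) \<cdot>\<^bsub>B\<^esub> (fmul H (a, \<one>\<^bsub>A\<^esub>) \<cdot>\<^bsub>B\<^esub> (t a \<boxtimes>\<^bsub>B\<^esub> funi H))"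
    by (simp flip: fmul_RUnit)
  also have "\<dots> = far H (RUnit A a) \<cdot>\<^bsub>B\<^esub> (fmul H (a, \<one>\<^bsub>A\<^esub>) \<cdot>\<^bsub>B\<^esub> ((t a \<boxtimes>\<^bsub>B\<^esub> t \<one>\<^bsub>A\<^esub>) \<cdot>\<^bsub>B\<^esub>
      (Ident B (fob G a) \<boxtimes>\<^bsub>B\<^esub> funi G)))"
    by (simp add: t_Unit)
  also have "\<dots> = (far H (RUnit A a) \<cdot>\<^bsub>B\<^esub> t (a \<otimes>\<^bsub>A\<^esub> \<one>\<^bsub>A\<^esub>)) \<cdot>\<^bsub>B\<^esub> ?i"
    by (simp add: t_TenO_reduce)
  finally have "t a \<cdot>\<^bsub>B\<^esub> far G (RUnit A a) = far H (RUnit A a) \<cdot>\<^bsub>B\<^esub> t (a \<otimes>\<^bsub>A\<^esub> \<one>\<^bsub>A\<^esub>)"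
    by (rule B.iso_epi) simp_all
  then show ?thesis by (simp add: natural_at_def)
qed

lemma natural_at_Braid:
  assumes [simp]: "a \<in> Obj A" "b \<in> Obj A"
  shows "natural_at (Braid A a b)"
proof -
  have "(t (b \<otimes>\<^bsub>A\<^esub> a) \<cdot>\<^bsub>B\<^esub> far G (Braid A a b)) \<cdot>\<^bsub>B\<^esub> fmul G (a, b)
    = (fmul H (b, a) \<cdot>\<^bsub>B\<^esub> Braid B (fob H a) (fob H b)) \<cdot>\<^bsub>B\<^esub> (t a \<boxtimes>\<^bsub>B\<^esub> t b)"
    by (simp add: fmul_Braid t_TenO_reduce B.Braid_nat)
  also have "\<dots> = (far H (Braid A a b) \<cdot>\<^bsub>B\<^esub> t (a \<otimes>\<^bsub>A\<^esub> b)) \<cdot>\<^bsub>B\<^esub> fmul G (a, b)"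
    by (simp flip: fmul_Braid add: t_TenO)
  finally have "t (b \<otimes>\<^bsub>A\<^esub> a) \<cdot>\<^bsub>B\<^esub> far G (Braid A a b) = far H (Braid A a b) \<cdot>\<^bsub>B\<^esub> t (a \<otimes>\<^bsub>A\<^esub> b)"
    by (rule B.iso_epi) simp_all
  then show ?thesis by (simp add: natural_at_def)
qed

text \<open>Functors preserve isomorphisms, so the square at f can be inverted horizontally after
  composing with the invertible \<open>far H f\<close>.\<close>

lemma natural_at_Inv:
  assumes "natural_at f" and iso [simp]: "is_iso A f"
  shows "natural_at (Inv A f)"
proof -
  have [simp]: "f \<in> Arr A"
    and f: "t (Cod A f) \<cdot>\<^bsub>B\<^esub> far G f = far H f \<cdot>\<^bsub>B\<^esub> t (Dom A f)"
    using assms by (auto simp: natural_at_def)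
  have inv: "far F f \<cdot>\<^bsub>B\<^esub> far F (Inv A f) = Ident B (fob F (Cod A f))"
      "far F (Inv A f) \<cdot>\<^bsub>B\<^esub> far F f = Ident B (fob F (Dom A f))"
    if [simp]: "strong_monoidal_functor A B F" for F
    by (simp_all flip: far_Comp)
  have iso': "is_iso B (far H f)"
    unfolding is_iso_def by (rule exI[of _ "far H (Inv A f)"], rule B.inverse_arrowsI) (simp_all add: inv)
  have "far H f \<cdot>\<^bsub>B\<^esub> (t (Dom A f) \<cdot>\<^bsub>B\<^esub> far G (Inv A f)) = t (Cod A f) \<cdot>\<^bsub>B\<^esub> (far G f \<cdot>\<^bsub>B\<^esub> far G (Inv A f))"
    by (rule B.Comp_reduce2[OF f[symmetric]]) simp_all
  also have "\<dots> = (far H f \<cdot>\<^bsub>B\<^esub> far H (Inv A f)) \<cdot>\<^bsub>B\<^esub> t (Cod A f)" by (simp only: inv G H) simp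
  also have "\<dots> = far H f \<cdot>\<^bsub>B\<^esub> (far H (Inv A f) \<cdot>\<^bsub>B\<^esub> t (Cod A f))" by simp
  finally have "t (Dom A f) \<cdot>\<^bsub>B\<^esub> far G (Inv A f) = far H (Inv A f) \<cdot>\<^bsub>B\<^esub> t (Cod A f)"
    by (rule B.iso_mono) (simp_all add: iso')
  then show ?thesis by (simp add: natural_at_def)
qed

lemma natural_at_coherence_arrows: "f \<in> coherence_arrows A \<Longrightarrow> natural_at f"
  by (induction rule: coherence_arrows.induct)
    (simp_all add: natural_at_Ident natural_at_Comp natural_at_TenA natural_at_Assoc natural_at_LUnit
      natural_at_RUnit natural_at_Braid natural_at_Inv del: A.Inv_Braid)

end


section \<open>Subcategories and supplies\<close>

lemma subcat_simps [simp]: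
  "Obj (subcat C X M) = X" "Arr (subcat C X M) = M" "Dom (subcat C X M) = Dom C" "Cod (subcat C X M) = Cod C"
  "Ident (subcat C X M) = Ident C" "Comp (subcat C X M) = Comp C" "Unit (subcat C X M) = Unit C"
  "TenO (subcat C X M) = TenO C" "TenA (subcat C X M) = TenA C" "Assoc (subcat C X M) = Assoc C"
  "LUnit (subcat C X M) = LUnit C" "RUnit (subcat C X M) = RUnit C" "Braid (subcat C X M) = Braid C"
  by (simp_all add: subcat_def)

lemma subcat_self [simp]: "subcat C (Obj C) (Arr C) = C"
  by (simp add: subcat_def)

context symmetric_monoidal_category
begin

text \<open>The equations are inherited from C, which leaves membership and invertibility of the
  structure maps. Braidings form a hypothesis of their own because
  \<open>monoidal_subcategory\<close> speaks of the monoidal structure alone.\<close>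

lemma symmetric_monoidal_category_subcat:
  assumes sub: "monoidal_subcategory (subcat C X M) C"
    and braid: "\<And>a b. \<lbrakk>a \<in> X; b \<in> X\<rbrakk> \<Longrightarrow> Braid C a b \<in> M"
  shows "symmetric_monoidal_category (subcat C X M)"
proof -
  let ?S = "subcat C X M"
  have X [simp]: "\<And>a. a \<in> X \<Longrightarrow> a \<in> Obj C" and M [simp]: "\<And>f. f \<in> M \<Longrightarrow> f \<in> Arr C"
    using sub by (auto simp: monoidal_subcategory_def)
  \<comment> \<open>An isomorphism of C remains one only if its inverse also lies in the
    subcategory; this is where closure under inverse associators and unitors enters.\<close>
  have iso: "is_iso ?S f" if "f \<in> M" "Inv C f \<in> M" "is_iso C f" for f
    using that inverse_arrows_Inv[OF that(3)] unfolding is_iso_def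
    by (intro exI[of _ "Inv C f"]) (auto simp: inverse_arrows_def Hom_def)
  show ?thesis
    by unfold_locales
      (use sub in \<open>auto simp: monoidal_subcategory_def Hom_def braid iso Assoc_nat Braid_nat LUnit_nat RUnit_nat
         pentagon triangle hexagon\<close>)
qed

end

locale smc_subcat = smc_pair "subcat C X M" C for C :: "('o, 'a) smcat" and X M +
  assumes X_subset: "X \<subseteq> Obj C" and M_subset: "M \<subseteq> Arr C"
begin

abbreviation "S \<equiv> subcat C X M"
abbreviation "inc \<equiv> inclusion S C"

lemma X_Obj [simp]: "a \<in> X \<Longrightarrow> a \<in> Obj C" and M_Arr [simp]: "f \<in> M \<Longrightarrow> f \<in> Arr C"
  using X_subset M_subset by auto

lemma inclusion_simps [simp]:
  "a \<in> X \<Longrightarrow> fob inc a = a" "f \<in> M \<Longrightarrow> far inc f = f"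
  "\<lbrakk>a \<in> X; b \<in> X\<rbrakk> \<Longrightarrow> fmul inc (a, b) = Ident C (a \<otimes>\<^bsub>C\<^esub> b)" "funi inc = Ident C \<one>\<^bsub>C\<^esub>"
  by (simp_all add: inclusion_def)

lemma normalized_inclusion [simp]: "normalized S inc"
  by (simp add: normalized_def inclusion_def)

text \<open>Closure is read off from the typing rules of the symmetric monoidal category
  \<open>S\<close>, whose operations are those of C.\<close>

lemma S_closed:
  "a \<in> X \<Longrightarrow> Ident C a \<in> M" "\<lbrakk>f \<in> M; g \<in> M; Dom C g = Cod C f\<rbrakk> \<Longrightarrow> g \<cdot>\<^bsub>C\<^esub> f \<in> M"
  "\<one>\<^bsub>C\<^esub> \<in> X" "\<lbrakk>a \<in> X; b \<in> X\<rbrakk> \<Longrightarrow> a \<otimes>\<^bsub>C\<^esub> b \<in> X" "\<lbrakk>f \<in> M; g \<in> M\<rbrakk> \<Longrightarrow> f \<boxtimes>\<^bsub>C\<^esub> g \<in> M"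
  "\<lbrakk>a \<in> X; b \<in> X; c \<in> X\<rbrakk> \<Longrightarrow> Assoc C a b c \<in> M" "a \<in> X \<Longrightarrow> LUnit C a \<in> M" "a \<in> X \<Longrightarrow> RUnit C a \<in> M"
  "\<lbrakk>a \<in> X; b \<in> X\<rbrakk> \<Longrightarrow> Braid C a b \<in> M" "f \<in> M \<Longrightarrow> Dom C f \<in> X" "f \<in> M \<Longrightarrow> Cod C f \<in> X"
  using A.Arr_Ident A.Arr_Comp A.Obj_Unit A.Obj_TenO A.Arr_TenA A.Arr_Assoc A.Arr_LUnit A.Arr_RUnit
    A.Arr_Braid A.Dom_Obj' A.Cod_Obj'
  by simp_all

lemma strong_monoidal_inclusion [simp]: "strong_monoidal_functor S C inc"
  by (rule strong_monoidal_functorI) (simp_all add: S_closed)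

end

text \<open>Makes powers of the inclusion available over all of C, where the homomorphism condition
  can be tested on every arrow before the homomorphisms are known to form a category.\<close>

lemma (in symmetric_monoidal_category) smc_subcat_self: "smc_subcat C (Obj C) (Arr C)"
  by (simp add: smc_subcat_def smc_subcat_axioms_def smc_pair_def symmetric_monoidal_category_axioms)

text \<open>Every operation on functors is pointwise, so restriction commutes with it
  strictly.\<close>

lemma
  assumes sub: "Obj S \<subseteq> Obj A" "Arr S \<subseteq> Arr A"
  shows restrict_tensor_functors: "restrict_functor S (tensor_functors A B F G)
      = tensor_functors S B (restrict_functor S F) (restrict_functor S G)"
    and restrict_unit_functor: "restrict_functor S (unit_functor A B) = unit_functor S B"
  using sub by (auto simp: restrict_functor_def tensor_functors_def unit_functor_def restrict_def fun_eq_iff)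

section \<open>Supplies and their homomorphisms\<close>

locale supplied_category = C: symmetric_monoidal_category C + P: symmetric_monoidal_category P
  for C :: "('o, 'a) smcat" and P :: "(nat, 'p) smcat" +
  fixes s :: "'o \<Rightarrow> (nat, 'p, 'o, 'a) smfun"
  assumes P_prop: "is_prop P" and s_supply: "is_supply P C s"
begin

sublocale PC: smc_pair P C ..
sublocale CC: smc_subcat C "Obj C" "Arr C"
  rewrites "subcat C (Obj C) (Arr C) = C"
  by (rule C.smc_subcat_self) simp

lemma prop_simps [simp]: "Obj P = UNIV" "\<one>\<^bsub>P\<^esub> = 0" "m \<otimes>\<^bsub>P\<^esub> n = m + n"
  using P_prop by (auto simp: is_prop_def)

lemma
  assumes "c \<in> Obj C"
  shows strong_supply [simp]: "strong_monoidal_functor P C (s c)"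
    and fob_supply [simp]: "fob (s c) m = TPow C c m"
    and fmul_supply [simp]: "fmul (s c) (m, n) = rebracket C c m n"
  using assms s_supply by (auto simp: is_supply_def)

lemma supply_TenO:
  assumes "c \<in> Obj C" "d \<in> Obj C" "\<mu> \<in> Arr P"
  shows "far (s (c \<otimes>\<^bsub>C\<^esub> d)) \<mu> \<cdot>\<^bsub>C\<^esub> shuffle C c d (Dom P \<mu>)
    = shuffle C c d (Cod P \<mu>) \<cdot>\<^bsub>C\<^esub> (far (s c) \<mu> \<boxtimes>\<^bsub>C\<^esub> far (s d) \<mu>)"
  using assms s_supply by (auto simp: is_supply_def Hom_def)

lemma supply_Unit: "\<mu> \<in> Arr P \<Longrightarrow> far (s \<one>\<^bsub>C\<^esub>) \<mu> \<cdot>\<^bsub>C\<^esub> unit_shuffle C (Dom P \<mu>) = unit_shuffle C (Cod P \<mu>)"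
  using s_supply by (auto simp: is_supply_def Hom_def)

lemma Obj_TPow [simp]: "c \<in> Obj C \<Longrightarrow> TPow C c n \<in> Obj C"
  using PC.fob_Obj[OF strong_supply, of c n] by simp

text \<open>\<open>rebracket\<close> is the strongator of s_c, so its type and invertibility are
  part of the strong monoidal functor s_c; no induction on exponents is required.\<close>

lemma
  assumes [simp]: "c \<in> Obj C"
  shows Arr_rebracket [simp]: "rebracket C c m n \<in> Arr C"
    and Dom_rebracket [simp]: "Dom C (rebracket C c m n) = TPow C c m \<otimes>\<^bsub>C\<^esub> TPow C c n"
    and Cod_rebracket [simp]: "Cod C (rebracket C c m n) = TPow C c (m + n)"
    and is_iso_rebracket [simp]: "is_iso C (rebracket C c m n)"
  using PC.Arr_fmul[OF strong_supply, of c m n] PC.Dom_fmul[OF strong_supply, of c m n]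
    PC.Cod_fmul[OF strong_supply, of c m n] PC.is_iso_fmul[OF strong_supply, of c m n]
  by simp_all

text \<open>The unit strongator is not prescribed by \<^const>\<open>is_supply\<close>; the left unit law at \<open>0\<close> forces it.\<close>

lemma funi_supply [simp]:
  assumes [simp]: "c \<in> Obj C"
  shows "funi (s c) = Ident C \<one>\<^bsub>C\<^esub>"
proof -
  have L: "LUnit P 0 = Ident P 0" using P_prop by (simp add: is_prop_def)
  have "LUnit C \<one>\<^bsub>C\<^esub> \<cdot>\<^bsub>C\<^esub> (funi (s c) \<boxtimes>\<^bsub>C\<^esub> Ident C \<one>\<^bsub>C\<^esub>) = LUnit C \<one>\<^bsub>C\<^esub> \<cdot>\<^bsub>C\<^esub> (Ident C \<one>\<^bsub>C\<^esub> \<boxtimes>\<^bsub>C\<^esub> Ident C \<one>\<^bsub>C\<^esub>)"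
    using PC.fmul_LUnit[OF strong_supply, of c 0] by (simp add: L)
  then have "funi (s c) \<boxtimes>\<^bsub>C\<^esub> Ident C \<one>\<^bsub>C\<^esub> = Ident C \<one>\<^bsub>C\<^esub> \<boxtimes>\<^bsub>C\<^esub> Ident C \<one>\<^bsub>C\<^esub>"
    by (rule C.iso_mono) simp_all
  then show ?thesis by (rule C.TenA_unit_right_inject) simp_all
qed

text \<open>The strong monoidal functor laws of s_c with its strongators named. These are the
  components at c of the laws of the lifted functor. The unit strongator has dropped out of the unit
  laws because it is an identity.\<close>

lemma
  assumes [simp]: "c \<in> Obj C"
  shows rebracket_nat: "\<lbrakk>\<mu> \<in> Arr P; \<nu> \<in> Arr P; Cod P \<mu> = m; Cod P \<nu> = n\<rbrakk>
      \<Longrightarrow> rebracket C c m n \<cdot>\<^bsub>C\<^esub> (far (s c) \<mu> \<boxtimes>\<^bsub>C\<^esub> far (s c) \<nu>)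
        = far (s c) (\<mu> \<boxtimes>\<^bsub>P\<^esub> \<nu>) \<cdot>\<^bsub>C\<^esub> rebracket C c (Dom P \<mu>) (Dom P \<nu>)"
    and rebracket_Assoc: "far (s c) (Assoc P l m n) \<cdot>\<^bsub>C\<^esub> (rebracket C c (l + m) n \<cdot>\<^bsub>C\<^esub>
        (rebracket C c l m \<boxtimes>\<^bsub>C\<^esub> Ident C (TPow C c n)))
      = rebracket C c l (m + n) \<cdot>\<^bsub>C\<^esub> ((Ident C (TPow C c l) \<boxtimes>\<^bsub>C\<^esub> rebracket C c m n) \<cdot>\<^bsub>C\<^esub>
        Assoc C (TPow C c l) (TPow C c m) (TPow C c n))"
    and rebracket_LUnit: "far (s c) (LUnit P n) \<cdot>\<^bsub>C\<^esub> rebracket C c 0 n = LUnit C (TPow C c n)"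
    and rebracket_RUnit: "far (s c) (RUnit P n) \<cdot>\<^bsub>C\<^esub> rebracket C c n 0 = RUnit C (TPow C c n)"
    and rebracket_Braid: "far (s c) (Braid P m n) \<cdot>\<^bsub>C\<^esub> rebracket C c m n
      = rebracket C c n m \<cdot>\<^bsub>C\<^esub> Braid C (TPow C c m) (TPow C c n)"
  using PC.fmul_nat[OF strong_supply, of c \<mu> \<nu> m n] PC.fmul_Assoc[OF strong_supply, of c l m n]
    PC.fmul_LUnit[OF strong_supply, of c n] PC.fmul_RUnit[OF strong_supply, of c n]
    PC.fmul_Braid[OF strong_supply, of c m n]
  by (simp_all del: rebracket.simps)

lemma monoidal_family_supply:
  assumes [simp]: "\<mu> \<in> Arr P"
  shows "monoidal_family C C (TPow (SMF C C) (inclusion C C) (Dom P \<mu>)) (TPow (SMF C C) (inclusion C C) (Cod P \<mu>))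
    (\<lambda>c. far (s c) \<mu>)"
  using CC.strong_TPow[OF CC.strong_monoidal_inclusion CC.normalized_inclusion]
    CC.fob_TPow CC.fmul_TPow CC.funi_TPow CC.inclusion_simps
  by unfold_locales (simp_all add: supply_TenO supply_Unit)

lemma s_homomorphism_iff:
  "s_homomorphism P C s f \<longleftrightarrow> f \<in> Arr C \<and> (\<forall>\<mu>\<in>Arr P.
    monoidal_family.natural_at C C (TPow (SMF C C) (inclusion C C) (Dom P \<mu>))
      (TPow (SMF C C) (inclusion C C) (Cod P \<mu>)) (\<lambda>c. far (s c) \<mu>) f)"
  using CC.far_TPow[of f] CC.inclusion_simps(2)[of f]
  by (auto simp: s_homomorphism_def monoidal_family.natural_at_def[OF monoidal_family_supply] Hom_def)

lemmas natural_at_rules =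
  monoidal_family.natural_at_Ident[OF monoidal_family_supply]
  monoidal_family.natural_at_Comp[OF monoidal_family_supply]
  monoidal_family.natural_at_TenA[OF monoidal_family_supply]
  monoidal_family.natural_at_Inv[OF monoidal_family_supply]
  monoidal_family.natural_at_coherence_arrows[OF monoidal_family_supply]

lemma coherence_arrows_Arr: "f \<in> coherence_arrows C \<Longrightarrow> f \<in> Arr C"
  by (induction rule: coherence_arrows.induct) simp_all

lemma coherence_arrows_s_homomorphism: "f \<in> coherence_arrows C \<Longrightarrow> s_homomorphism P C s f"
  by (simp add: s_homomorphism_iff natural_at_rules coherence_arrows_Arr)

text \<open>Structure maps and their inverses are coherence arrows, hence homomorphisms; the closure
  conditions are those of the naturality loci, taken for all \<mu> at once.\<close>

lemma monoidal_subcategory_homomorphisms: "monoidal_subcategory (homomorphism_subcat P C s) C"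
  by (auto simp: monoidal_subcategory_def homomorphism_subcat_def coherence_arrows_s_homomorphism
      coherence_arrows.intros)
    (auto simp: s_homomorphism_iff natural_at_rules)

lemma monoidal_subcategory_coherence: "monoidal_subcategory (coherence_subcat C) C"
  by (auto simp: monoidal_subcategory_def coherence_subcat_def coherence_arrows.intros coherence_arrows_Arr)

text \<open>Containing the coherence arrows provides the braidings, so the subcategory is symmetric.
  Applied to both \<open>C\<^sub>s\<close> and \<open>C\<^sub>0\<close>.\<close>

lemma smc_subcat_wide:
  assumes "monoidal_subcategory (subcat C (Obj C) M) C" "coherence_arrows C \<subseteq> M"
  shows "smc_subcat C (Obj C) M"
proof -
  interpret S: symmetric_monoidal_category "subcat C (Obj C) M"
    using assms by (intro C.symmetric_monoidal_category_subcat) (auto intro: coherence_arrows.intros)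
  show ?thesis
    using assms(1) by unfold_locales (auto simp: monoidal_subcategory_def)
qed

end


section \<open>The lifted functor\<close>

text \<open>M may be any set of homomorphisms whose wide subcategory is symmetric monoidal. All
  homomorphisms give \<open>C\<^sub>s\<close>, the coherence arrows give
  \<open>C\<^sub>0\<close>.\<close>

locale supplied_subcategory = supplied_category C P s + D: smc_subcat C "Obj C" M
  for C :: "('o, 'a) smcat" and P :: "(nat, 'p) smcat" and s M +
  assumes M_homomorphism: "f \<in> M \<Longrightarrow> s_homomorphism P C s f"
begin

abbreviation "T \<equiv> TPow (SMF D.S C) D.inc"

definition supply_arrow :: "'p \<Rightarrow> ('o, 'a, 'o, 'a) mnt" where
  "supply_arrow \<mu> = \<lparr> nsrc = T (Dom P \<mu>), ntgt = T (Cod P \<mu>), ncmp = (\<lambda>c\<in>Obj C. far (s c) \<mu>) \<rparr>"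

text \<open>The formulas of \<open>supply_functor\<close> over a larger domain of inclusion. The
  arrow part need not be cut off outside \<open>Arr P\<close>, because
  \<open>compose_functors\<close> does so.\<close>

definition lifted_functor :: "(nat, 'p, ('o, 'a, 'o, 'a) smfun, ('o, 'a, 'o, 'a) mnt) smfun" where
  "lifted_functor = \<lparr> fob = T, far = supply_arrow,
     fmul = (\<lambda>(m, n). rebracket (SMF D.S C) D.inc m n),
     funi = Ident (SMF D.S C) \<one>\<^bsub>SMF D.S C\<^esub> \<rparr>"

lemma T_simps [simp]:
  "c \<in> Obj C \<Longrightarrow> fob (T n) c = TPow C c n" "f \<in> M \<Longrightarrow> far (T n) f = TPowA C f n"
  "\<lbrakk>c \<in> Obj C; d \<in> Obj C\<rbrakk> \<Longrightarrow> fmul (T n) (c, d) = shuffle C c d n" "funi (T n) = unit_shuffle C n"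
  using D.fob_TPow[of c] D.far_TPow[of f] D.fmul_TPow[of c d D.inc] D.funi_TPow[of D.inc]
  by simp_all

lemma supply_arrow_Arr: "\<mu> \<in> Arr P \<Longrightarrow> supply_arrow \<mu> \<in> Arr (SMF D.S C)"
proof (rule D.Arr_SMF_I)
  fix f assume [simp]: "\<mu> \<in> Arr P" and "f \<in> Arr D.S"
  then have [simp]: "f \<in> M" by simp
  have "TPowA C f (Cod P \<mu>) \<cdot>\<^bsub>C\<^esub> far (s (Dom C f)) \<mu> = far (s (Cod C f)) \<mu> \<cdot>\<^bsub>C\<^esub> TPowA C f (Dom P \<mu>)"
    using M_homomorphism[of f] by (simp add: s_homomorphism_def Hom_def)
  then show "ncmp (supply_arrow \<mu>) (Cod D.S f) \<cdot>\<^bsub>C\<^esub> far (nsrc (supply_arrow \<mu>)) f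
    = far (ntgt (supply_arrow \<mu>)) f \<cdot>\<^bsub>C\<^esub> ncmp (supply_arrow \<mu>) (Dom D.S f)"
    by (simp add: supply_arrow_def)
qed (simp_all add: supply_arrow_def supply_TenO supply_Unit)

lemma strong_monoidal_lifted_functor: "strong_monoidal_functor P (SMF D.S C) lifted_functor"
proof -
  have unit: "Ident (SMF D.S C) (unit_functor D.S C) \<in> Arr (SMF D.S C)"
    by (rule D.Ident_SMF_Arr) simp_all
  have iso: "is_iso (SMF D.S C) (rebracket (SMF D.S C) D.inc m n)" for m n
    by (rule D.Inv_SMF(2)[OF D.rebracket_SMF_Arr]) (simp_all add: D.rebracket_SMF)
  have unit_iso: "is_iso (SMF D.S C) (Ident (SMF D.S C) (unit_functor D.S C))"
    by (rule category.is_iso_Ident[OF D.category_SMF]) simp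
  show ?thesis
    unfolding strong_monoidal_functor_def
  proof (intro conjI allI ballI)
    show "far lifted_functor \<mu> \<in> Hom (SMF D.S C) (fob lifted_functor m) (fob lifted_functor n)"
      if "\<mu> \<in> Hom P m n" for \<mu> m n
      using that supply_arrow_Arr[of \<mu>] by (auto simp: Hom_def lifted_functor_def) (simp_all add: supply_arrow_def)
    show "fmul lifted_functor (m, n) \<in> Hom (SMF D.S C)
        (fob lifted_functor m \<otimes>\<^bsub>SMF D.S C\<^esub> fob lifted_functor n) (fob lifted_functor (m \<otimes>\<^bsub>P\<^esub> n))" for m n
      using D.rebracket_SMF_Arr[of D.inc m n] by (simp add: Hom_def lifted_functor_def D.rebracket_SMF)
    show "is_iso (SMF D.S C) (fmul lifted_functor (m, n))" for m n
      using iso[of m n] by (simp add: lifted_functor_def)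
    show "is_iso (SMF D.S C) (funi lifted_functor)"
      using unit_iso by (simp add: lifted_functor_def)
    show "funi lifted_functor \<in> Hom (SMF D.S C) \<one>\<^bsub>SMF D.S C\<^esub> (fob lifted_functor \<one>\<^bsub>P\<^esub>)"
      using unit by (simp add: Hom_def lifted_functor_def)
    show "far lifted_functor (\<nu> \<cdot>\<^bsub>P\<^esub> \<mu>) = far lifted_functor \<nu> \<cdot>\<^bsub>SMF D.S C\<^esub> far lifted_functor \<mu>"
      if "\<mu> \<in> Hom P l m" "\<nu> \<in> Hom P m n" for \<mu> \<nu> l m n
      using that by (auto simp: Hom_def lifted_functor_def supply_arrow_def PC.far_Comp intro!: restrict_ext)
    show "fmul lifted_functor (m', n') \<cdot>\<^bsub>SMF D.S C\<^esub> (far lifted_functor \<mu> \<boxtimes>\<^bsub>SMF D.S C\<^esub> far lifted_functor \<nu>)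
        = far lifted_functor (\<mu> \<boxtimes>\<^bsub>P\<^esub> \<nu>) \<cdot>\<^bsub>SMF D.S C\<^esub> fmul lifted_functor (m, n)"
      if "\<mu> \<in> Hom P m m'" "\<nu> \<in> Hom P n n'" for \<mu> \<nu> m m' n n'
      using that by (auto simp: Hom_def lifted_functor_def supply_arrow_def D.rebracket_SMF rebracket_nat intro!: restrict_ext)
  \<comment> \<open>The remaining laws are equations of records: sources and targets agree by
    arithmetic of exponents, components by the laws of each s_c. \<open>rebracket.simps\<close>
    stays off so that \<open>rebracket C c 0 n\<close> is not unfolded before the unit laws can
    match it.\<close>
  qed (auto simp: lifted_functor_def supply_arrow_def D.rebracket_SMF rebracket_Assoc rebracket_LUnit rebracket_RUnit
      rebracket_Braid add.assoc simp del: rebracket.simps intro!: restrict_ext)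
qed

end

section \<open>Factorization of the supply functor through restriction\<close>

theorem theorem3p20:
  fixes P :: "(nat, 'p) smcat"
    and C :: "('o, 'a) smcat"
    and s :: "'o \<Rightarrow> (nat, 'p, 'o, 'a) smfun"
  assumes "is_prop P"
    and "symmetric_monoidal_category C"
    and "is_supply P C s"
  shows "let C\<^sub>0 = coherence_subcat C;
             C\<^sub>s = homomorphism_subcat P C s;
             inc\<^sub>s = inclusion C\<^sub>s C
    in monoidal_subcategory C\<^sub>s C
       \<and> Obj C\<^sub>0 \<subseteq> Obj C\<^sub>s \<and> Arr C\<^sub>0 \<subseteq> Arr C\<^sub>s
       \<and> Obj C\<^sub>s \<subseteq> Obj C \<and> Arr C\<^sub>s \<subseteq> Arr C
       \<and> (\<exists>F. strong_monoidal_functor P (SMF C\<^sub>s C) F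
            \<and> compose_functors P (SMF C\<^sub>0 C) (restriction C\<^sub>s C\<^sub>0 C) F = supply_functor P C s
            \<and> (\<forall>m. fob F m = TPow (SMF C\<^sub>s C) inc\<^sub>s m)
            \<and> (\<forall>m n. fmul F (m, n) = rebracket (SMF C\<^sub>s C) inc\<^sub>s m n))"
proof -
  interpret C: symmetric_monoidal_category C by (rule assms)
  interpret P: symmetric_monoidal_category P using assms(1) by (simp add: is_prop_def)
  interpret supplied_category C P s by unfold_locales (fact assms)+
  let ?M = "{f. s_homomorphism P C s f}" and ?N = "coherence_arrows C"
  have "smc_subcat C (Obj C) ?M"
    by (rule smc_subcat_wide[OF monoidal_subcategory_homomorphisms[unfolded homomorphism_subcat_def]])
      (auto simp: coherence_arrows_s_homomorphism)
  \<comment> \<open>The construction is instantiated twice. \<open>S\<close>, over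
    \<open>C\<^sub>s\<close>, carries the functor sought; \<open>Z\<close>, over
    \<open>C\<^sub>0\<close>, describes powers of the inclusion and \<open>rebracket\<close> on the
    side with which its restriction is compared.\<close>
  then interpret S: supplied_subcategory C P s ?M
    by (simp add: supplied_subcategory_def supplied_category_axioms supplied_subcategory_axioms_def)
  have "smc_subcat C (Obj C) ?N"
    by (rule smc_subcat_wide[OF monoidal_subcategory_coherence[unfolded coherence_subcat_def]]) simp
  then interpret Z: supplied_subcategory C P s ?N
    by (simp add: supplied_subcategory_def supplied_category_axioms supplied_subcategory_axioms_def
        coherence_arrows_s_homomorphism)
  have sub: "Obj Z.D.S \<subseteq> Obj S.D.S" "Arr Z.D.S \<subseteq> Arr S.D.S"
    using coherence_arrows_s_homomorphism by auto
  have res_inc: "restrict_functor Z.D.S S.D.inc = Z.D.inc"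
    using coherence_arrows_s_homomorphism
    by (auto simp: restrict_functor_def inclusion_def restrict_def fun_eq_iff)
  \<comment> \<open>Restriction is strictly monoidal and sends one inclusion to the other, hence
    sends powers to powers on the nose, with no comparison isomorphism.\<close>
  have res: "restrict_functor Z.D.S (S.T n) = Z.T n" for n
  proof (induction n)
    case (Suc n)
    then show ?case by (cases n) (simp_all add: res_inc restrict_tensor_functors[OF sub])
  qed (simp add: restrict_unit_functor[OF sub])
  let ?R = "restriction S.D.S Z.D.S C"
  have fob_R: "fob ?R (S.T m) = Z.T m" for m
    by (simp add: restriction_def res)
  have far_R: "far ?R t = \<lparr> nsrc = restrict_functor Z.D.S (nsrc t), ntgt = restrict_functor Z.D.S (ntgt t),
      ncmp = restrict (ncmp t) (Obj C) \<rparr>" if "t \<in> Arr (SMF S.D.S C)" for t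
    using that by (simp add: restriction_def)
  have fmul_R: "fmul ?R (S.T m, S.T n) = Ident (SMF Z.D.S C) (tensor_functors Z.D.S C (Z.T m) (Z.T n))" for m n
    by (simp add: restriction_def restrict_tensor_functors[OF sub] res)
  have unit: "Ident (SMF S.D.S C) (unit_functor S.D.S C) \<in> Arr (SMF S.D.S C)"
    by (rule S.D.Ident_SMF_Arr) simp_all
  have "compose_functors P (SMF Z.D.S C) ?R S.lifted_functor = supply_functor P C s"
  proof (rule smfun.equality)
    show "fob (compose_functors P (SMF Z.D.S C) ?R S.lifted_functor) = fob (supply_functor P C s)"
      by (simp add: compose_functors_def supply_functor_def Let_def coherence_subcat_def S.lifted_functor_def
          fob_R fun_eq_iff)
    show "far (compose_functors P (SMF Z.D.S C) ?R S.lifted_functor) = far (supply_functor P C s)"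
      using S.supply_arrow_Arr
      by (auto simp: compose_functors_def supply_functor_def Let_def coherence_subcat_def S.lifted_functor_def
          far_R S.supply_arrow_def res intro!: restrict_ext)
    \<comment> \<open>The composite strongator is the restricted \<open>rebracket\<close> after an
      identity strongator of \<open>?R\<close>. Both versions of \<open>rebracket\<close> have the
      same components, namely those of \<open>rebracket\<close> in C.\<close>
    show "fmul (compose_functors P (SMF Z.D.S C) ?R S.lifted_functor) = fmul (supply_functor P C s)"
      using S.D.rebracket_SMF_Arr[of S.D.inc]
      by (auto simp: compose_functors_def supply_functor_def Let_def coherence_subcat_def S.lifted_functor_def
          fmul_R far_R res S.D.rebracket_SMF Z.D.rebracket_SMF restrict_tensor_functors[OF sub]
          fun_eq_iff intro!: restrict_ext)
    show "funi (compose_functors P (SMF Z.D.S C) ?R S.lifted_functor) = funi (supply_functor P C s)"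
      using unit
      by (auto simp: compose_functors_def supply_functor_def Let_def coherence_subcat_def S.lifted_functor_def
          far_R restriction_def restrict_unit_functor[OF sub] intro!: restrict_ext)
  qed simp
  then show ?thesis
    using S.strong_monoidal_lifted_functor monoidal_subcategory_homomorphisms sub S.D.M_subset
    by (auto simp: Let_def coherence_subcat_def homomorphism_subcat_def S.lifted_functor_def
        intro!: exI[of _ S.lifted_functor])
qed

end
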